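(* Let $w \in \mathfrak{S}_n$ be a smooth permutation, i.e. $w$ avoids the patterns $3412$ and $4231$. Then \[ \max_{u \in P^w_1} \operatorname{udeg}_w(u) \leq \max_{u \in P^w_{\ell(w)-1}} \operatorname{ddeg}_w(u), \] with equality if and only if the interval $[e,w]$ in Bruhat order is self-dual.
   Context: $\mathfrak{S}_n$ is the symmetric group, viewed as a Coxeter group with simple generators $s_i=(i\ i+1)$, $1\le i\le n-1$. For $w\in\mathfrak{S}_n$, $\ell(w)$ is the number of inversions of $w$ (pairs $i<j$ with $w(i)>w(j)$). Bruhat order is the transitive closure of the relations $w < wt$ for transpositions $t$ with $\ell(wt)>\ell(w)$; $e$ is the identity and $[e,w]=\{u: u\le w\}$. For $0\le k\le \ell(w)$, $P^w_k=\{u\le w:\ell(u)=k\}$. For $u\in[e,w]$, $\operatorname{udeg}_w(u)$ is the number of $v\in[e,w]$ covering $u$, and $\operatorname{ddeg}_w(u)$ is the number of elements of $[e,w]$ covered by $u$. For $\pi\in\mathfrak{S}_m$, $w\in\mathfrak{S}_n$ avoids $\pi$ if there are no indices $i_1<\dots<i_m$ with $w(i_1),\dots,w(i_m)$ in the same relative order as $\pi(1),\dots,\pi(m)$. A poset is self-dual if it is isomorphic to the poset on the same set with the order reversed. *)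

theory Defs
  imports "HOL-Combinatorics.Permutations"
begin

text \<open>Elements of \<open>S\<^sub>n\<close> are functions \<open>w :: nat \<Rightarrow> nat\<close> with \<^term>\<open>w permutes {1..n}\<close>.\<close>

definition perm_length :: "nat \<Rightarrow> (nat \<Rightarrow> nat) \<Rightarrow> nat" where
  "perm_length n w = card {(i, j). i \<in> {1..n} \<and> j \<in> {1..n} \<and> i < j \<and> w i > w j}"

definition bruhat_step :: "nat \<Rightarrow> (nat \<Rightarrow> nat) \<Rightarrow> (nat \<Rightarrow> nat) \<Rightarrow> bool" where
  "bruhat_step n u v \<longleftrightarrow> u permutes {1..n} \<and>
     (\<exists>i\<in>{1..n}. \<exists>j\<in>{1..n}. i \<noteq> j \<and> v = u \<circ> transpose i j \<and> perm_length n v > perm_length n u)"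

definition bruhat_less :: "nat \<Rightarrow> (nat \<Rightarrow> nat) \<Rightarrow> (nat \<Rightarrow> nat) \<Rightarrow> bool" where
  "bruhat_less n = (bruhat_step n)\<^sup>+\<^sup>+"

definition bruhat_le :: "nat \<Rightarrow> (nat \<Rightarrow> nat) \<Rightarrow> (nat \<Rightarrow> nat) \<Rightarrow> bool" where
  "bruhat_le n u v \<longleftrightarrow> u permutes {1..n} \<and> (u = v \<or> bruhat_less n u v)"

definition bruhat_covered_by :: "nat \<Rightarrow> (nat \<Rightarrow> nat) \<Rightarrow> (nat \<Rightarrow> nat) \<Rightarrow> bool" where
  "bruhat_covered_by n u v \<longleftrightarrow>
     bruhat_less n u v \<and> \<not> (\<exists>x. bruhat_less n u x \<and> bruhat_less n x v)"

definition lower_interval :: "nat \<Rightarrow> (nat \<Rightarrow> nat) \<Rightarrow> (nat \<Rightarrow> nat) set" where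
  "lower_interval n w = {u. bruhat_le n u w}"

definition rank_set :: "nat \<Rightarrow> (nat \<Rightarrow> nat) \<Rightarrow> nat \<Rightarrow> (nat \<Rightarrow> nat) set" where
  "rank_set n w k = {u \<in> lower_interval n w. perm_length n u = k}"

definition udeg :: "nat \<Rightarrow> (nat \<Rightarrow> nat) \<Rightarrow> (nat \<Rightarrow> nat) \<Rightarrow> nat" where
  "udeg n w u = card {v \<in> lower_interval n w. bruhat_covered_by n u v}"

definition ddeg :: "nat \<Rightarrow> (nat \<Rightarrow> nat) \<Rightarrow> (nat \<Rightarrow> nat) \<Rightarrow> nat" where
  "ddeg n w u = card {v \<in> lower_interval n w. bruhat_covered_by n v u}"

text \<open>The pattern is given by its one-line notation; \<open>ps\<close> lists the positions
  \<open>i\<^sub>1 < \<dots> < i\<^sub>m\<close> of an occurrence.\<close>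

definition avoids :: "nat \<Rightarrow> (nat \<Rightarrow> nat) \<Rightarrow> nat list \<Rightarrow> bool" where
  "avoids n w p \<longleftrightarrow>
     \<not> (\<exists>ps. length ps = length p \<and> sorted_wrt (<) ps \<and> set ps \<subseteq> {1..n} \<and>
          (\<forall>a<length p. \<forall>b<length p. w (ps ! a) < w (ps ! b) \<longleftrightarrow> p ! a < p ! b))"

definition smooth_perm :: "nat \<Rightarrow> (nat \<Rightarrow> nat) \<Rightarrow> bool" where
  "smooth_perm n w \<longleftrightarrow> w permutes {1..n} \<and> avoids n w [3,4,1,2] \<and> avoids n w [4,2,3,1]"

definition self_dual :: "'a set \<Rightarrow> ('a \<Rightarrow> 'a \<Rightarrow> bool) \<Rightarrow> bool" where
  "self_dual A le \<longleftrightarrow>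
     (\<exists>f. bij_betw f A A \<and> (\<forall>x\<in>A. \<forall>y\<in>A. le x y \<longleftrightarrow> le (f y) (f x)))"

text \<open>The maximum over an empty set is \<open>0\<close>. This matters only for the identity permutation,
  which has no elements of length \<open>1\<close> below it. There the truncated index
  \<^term>\<open>perm_length n w - 1\<close> is \<open>0\<close>, and the maximal down-degree is again \<open>0\<close>.\<close>

definition max_over :: "'a set \<Rightarrow> ('a \<Rightarrow> nat) \<Rightarrow> nat" where
  "max_over A f = (if A = {} then 0 else Max (f ` A))"

end

theory Submission
  imports Defs
begin

text \<open>Put points at \<open>(i, w i)\<close> and order them by inversions; the Hasse diagram of this order has the
  coatoms of \<open>[e, w]\<close> as its edges. Let \<open>m\<close> be the number of simple reflections below \<open>w\<close>. An atom has
  up-degree at most \<open>m + 1\<close>, and more precisely \<open>m - 1\<close> plus the number of neighbouring generators that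
  occur in both orders below \<open>w\<close>. For smooth \<open>w\<close> the coatom belonging to an edge \<open>(x, y)\<close> has down-degree
  at least \<open>m - 1\<close> plus the number of upper covers of \<open>x\<close> plus the number of lower covers of \<open>y\<close>.
  Small patterns in \<open>w\<close> relate the two corrections. The latter is at least 3 for some edge iff \<open>w\<close>
  contains 34521, 45321, 54312 or 54123. If \<open>w\<close> avoids these patterns, it is built by gluing longest
  elements of intervals of generators along at most one generator at a time, and an order reversing
  involution of \<open>[e, w]\<close> can be assembled from multiplications by these longest elements.\<close>

section \<open>Bruhat order\<close>

text \<open>The threshold 3 has a simple origin: a generator has only two neighbours, so the
  correction of an atom is at most 2, and a coatom correction of 3 makes the inequality strict.
  Equality thus forces the absence of four five-letter patterns, and the real work is to get
  self-duality from this absence. The converse is formal: an order reversing bijection exchanges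
  atoms and coatoms together with their degrees. The obstacle to gluing is a shared generator.
  Elements then factor in two ways, so a map defined factor by factor is well defined only if both
  partial maps commute with that generator on the side where the factors meet. Moreover a pair
  swapped by the shared generator would be reversed by both partial maps, hence not at all, so one
  of them has to be corrected. Not every interval has a reversal with this commutation, so the
  induction carries two equivariant versions of the claim, for a generator acting on the right and
  on the left; taking inverses exchanges them.\<close>

definition ustep :: "(nat \<Rightarrow> nat) \<Rightarrow> (nat \<Rightarrow> nat) \<Rightarrow> bool" where
  "ustep u v \<longleftrightarrow> (\<exists>i j. i < j \<and> u i < u j \<and> v = u \<circ> transpose i j)"

definition inversions :: "nat \<Rightarrow> (nat \<Rightarrow> nat) \<Rightarrow> (nat \<times> nat) set" where
  "inversions n u = {(i, j). i \<in> {1..n} \<and> j \<in> {1..n} \<and> i < j \<and> u i > u j}"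

lemma perm_length_eq: "perm_length n u = card (inversions n u)"
  by (simp add: perm_length_def inversions_def)

lemma finite_inversions [simp]: "finite (inversions n u)"
  by (rule finite_subset[of _ "{1..n} \<times> {1..n}"]) (auto simp: inversions_def)

text \<open>The injection behind all length comparisons. A pair whose order survives
  \<open>transpose i j\<close> is moved by it; a pair that would be turned around stays in place.
  The two kinds of images cannot collide, because the transposition is an involution.\<close>

definition move_pair :: "nat \<Rightarrow> nat \<Rightarrow> nat \<times> nat \<Rightarrow> nat \<times> nat" where
  "move_pair i j = (\<lambda>(k, l). if transpose i j k < transpose i j l
     then (transpose i j k, transpose i j l) else (k, l))"

lemma inj_on_move_pair: "inj_on (move_pair i j) {(k, l). k < l}"
  unfolding inj_on_def move_pair_def
  by (auto split: if_splits dest: transpose_eq_imp_eq simp: transpose_eq_iff)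

text \<open>\<open>move_pair\<close> embeds the inversions of \<open>u\<close> into those of the new
  permutation, and the image misses the new inversion \<open>(i, j)\<close>.\<close>

lemma perm_length_up:
  assumes "i \<in> {1..n}" "j \<in> {1..n}" "i < j" "u i < u j"
  shows "perm_length n u < perm_length n (u \<circ> transpose i j)"
proof -
  have "move_pair i j ` inversions n u \<subseteq> inversions n (u \<circ> transpose i j) - {(i, j)}"
  proof
    fix x assume "x \<in> move_pair i j ` inversions n u"
    then obtain k l where kl: "k \<in> {1..n}" "l \<in> {1..n}" "k < l" "u k > u l" "x = move_pair i j (k, l)"
      by (auto simp: inversions_def)
    then show "x \<in> inversions n (u \<circ> transpose i j) - {(i, j)}"
      using assms by (auto simp: inversions_def move_pair_def transpose_def split: if_splits)
  qed
  then have "card (move_pair i j ` inversions n u) \<le> card (inversions n (u \<circ> transpose i j) - {(i, j)})"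
    by (intro card_mono) auto
  moreover have "inj_on (move_pair i j) (inversions n u)"
    by (rule inj_on_subset[OF inj_on_move_pair]) (auto simp: inversions_def)
  moreover have "(i, j) \<in> inversions n (u \<circ> transpose i j)"
    using assms by (auto simp: inversions_def)
  ultimately show ?thesis
    unfolding perm_length_eq
    by (metis card_Diff1_less card_image finite_inversions le_less_trans)
qed

text \<open>With an empty box \<open>move_pair\<close> also leads back: every inversion of the new
  permutation other than \<open>(i, j)\<close> goes to one of \<open>u\<close>. The box is closed,
  since \<open>u\<close> is not assumed injective here.\<close>

lemma perm_length_up_empty:
  assumes "i \<in> {1..n}" "j \<in> {1..n}" "i < j" "u i < u j"
    and empty: "\<And>k. i < k \<Longrightarrow> k < j \<Longrightarrow> \<not> (u i \<le> u k \<and> u k \<le> u j)"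
  shows "perm_length n (u \<circ> transpose i j) = Suc (perm_length n u)"
proof -
  have "move_pair i j ` (inversions n (u \<circ> transpose i j) - {(i, j)}) \<subseteq> inversions n u"
  proof
    fix x assume "x \<in> move_pair i j ` (inversions n (u \<circ> transpose i j) - {(i, j)})"
    then obtain k l where kl: "k \<in> {1..n}" "l \<in> {1..n}" "k < l" "(k, l) \<noteq> (i, j)"
        "u (transpose i j k) > u (transpose i j l)" "x = move_pair i j (k, l)"
      by (auto simp: inversions_def)
    then show "x \<in> inversions n u"
      using assms(1-4) empty[of k] empty[of l]
      by (auto simp: inversions_def move_pair_def transpose_def split: if_splits)
  qed
  then have "card (move_pair i j ` (inversions n (u \<circ> transpose i j) - {(i, j)})) \<le> card (inversions n u)"
    by (intro card_mono) auto
  moreover have "inj_on (move_pair i j) (inversions n (u \<circ> transpose i j) - {(i, j)})"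
    by (rule inj_on_subset[OF inj_on_move_pair]) (auto simp: inversions_def)
  ultimately have "card (inversions n (u \<circ> transpose i j) - {(i, j)}) \<le> card (inversions n u)"
    by (simp add: card_image)
  then have "perm_length n (u \<circ> transpose i j) \<le> Suc (perm_length n u)"
    unfolding perm_length_eq by (auto simp: card_Diff_singleton_if split: if_splits)
  then show ?thesis using perm_length_up[of i n j u] assms(1-4) by simp
qed

lemma permutes_comp_transpose:
  assumes "u permutes S" "i \<in> S" "j \<in> S"
  shows "u \<circ> transpose i j permutes S"
  using assms by (intro permutes_compose permutes_swap_id)

lemma permutes_comp_transpose_mem:
  assumes "u permutes S" "u \<circ> transpose i j permutes S" "i \<noteq> j"
  shows "i \<in> S" "j \<in> S"
proof -
  have inj: "inj u" using assms(1) by (rule permutes_inj)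
  have ne: "u j \<noteq> u i" using assms(3) inj by (auto dest: injD)
  show "i \<in> S"
    using ne permutes_not_in[OF assms(1), of i] permutes_not_in[OF assms(2), of i] by (cases "i \<in> S") auto
  show "j \<in> S"
    using ne permutes_not_in[OF assms(1), of j] permutes_not_in[OF assms(2), of j] by (cases "j \<in> S") auto
qed

text \<open>\<open>ustep\<close> mentions neither the length nor \<open>n\<close>, so the same
  relation serves for permutations of every \<open>{q..n}\<close> in the recursion. The two notions
  agree because swapping a descent lowers the length, by \<open>perm_length_up\<close> applied to
  \<open>v\<close>.\<close>

lemma bruhat_step_iff:
  "bruhat_step n u v \<longleftrightarrow> u permutes {1..n} \<and> v permutes {1..n} \<and> ustep u v"
proof
  assume "bruhat_step n u v"
  then obtain i j where u: "u permutes {1..n}" and ij: "i \<in> {1..n}" "j \<in> {1..n}" "i \<noteq> j"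
      and v: "v = u \<circ> transpose i j" and len: "perm_length n u < perm_length n v"
    by (auto simp: bruhat_step_def)
  have v': "v permutes {1..n}" unfolding v by (rule permutes_comp_transpose[OF u ij(1,2)])
  obtain i j where ij: "i \<in> {1..n}" "j \<in> {1..n}" "i < j" and v: "v = u \<circ> transpose i j"
  proof (cases "i < j")
    case True
    show ?thesis by (rule that[OF ij(1,2) True v])
  next
    case False
    then have "j < i" using ij(3) by simp
    then show ?thesis by (rule that[OF ij(2,1)]) (simp add: v transpose_commute)
  qed
  have "u i < u j"
  proof (rule ccontr)
    assume "\<not> u i < u j"
    moreover have "u i \<noteq> u j" using u ij permutes_inj by (metis injD less_irrefl)
    ultimately have "v i < v j" using v by simp
    then have "perm_length n v < perm_length n (v \<circ> transpose i j)"
      using perm_length_up ij by blast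
    then show False using len v by (simp add: comp_assoc)
  qed
  then show "u permutes {1..n} \<and> v permutes {1..n} \<and> ustep u v"
    using u v v' ij by (auto simp: ustep_def)
next
  assume *: "u permutes {1..n} \<and> v permutes {1..n} \<and> ustep u v"
  then obtain i j where ij: "i < j" "u i < u j" "v = u \<circ> transpose i j" by (auto simp: ustep_def)
  then have mem: "i \<in> {1..n}" "j \<in> {1..n}"
    using permutes_comp_transpose_mem[of u "{1..n}" i j] * by auto
  have "perm_length n u < perm_length n v"
    unfolding ij(3) by (rule perm_length_up[OF mem ij(1,2)])
  then show "bruhat_step n u v"
    unfolding bruhat_step_def using * ij(1,3) mem by (metis less_irrefl)
qed

lemma bruhat_step_length: "bruhat_step n u v \<Longrightarrow> perm_length n u < perm_length n v"
  by (auto simp: bruhat_step_def)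

lemma bruhat_less_length: "bruhat_less n u v \<Longrightarrow> perm_length n u < perm_length n v"
  unfolding bruhat_less_def
  by (induction rule: tranclp_induct) (auto dest: bruhat_step_length)

lemma bruhat_less_permutes:
  assumes "bruhat_less n u v"
  shows "u permutes {1..n}" "v permutes {1..n}"
  using assms unfolding bruhat_less_def
  by (auto elim: tranclp.cases converse_tranclpE simp: bruhat_step_iff)

lemma bruhat_le_iff: "bruhat_le n u v \<longleftrightarrow> u permutes {1..n} \<and> (bruhat_step n)\<^sup>*\<^sup>* u v"
  unfolding bruhat_le_def bruhat_less_def by (metis rtranclp.rtrancl_refl rtranclpD tranclp_into_rtranclp)

lemma bruhat_le_trans: "bruhat_le n u v \<Longrightarrow> bruhat_le n v x \<Longrightarrow> bruhat_le n u x"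
  unfolding bruhat_le_iff by auto

lemma bruhat_less_iff: "bruhat_less n u v \<longleftrightarrow> bruhat_le n u v \<and> u \<noteq> v"
  using bruhat_less_length bruhat_less_permutes by (auto simp: bruhat_le_def)

lemma bruhat_le_antisym: "bruhat_le n u v \<Longrightarrow> bruhat_le n v u \<Longrightarrow> u = v"
  by (metis bruhat_less_iff bruhat_less_length less_asym)

definition empty_box :: "(nat \<Rightarrow> nat) \<Rightarrow> nat \<Rightarrow> nat \<Rightarrow> bool" where
  "empty_box u i j \<longleftrightarrow> (\<forall>k. i < k \<and> k < j \<longrightarrow> \<not> (u i < u k \<and> u k < u j))"

text \<open>If the box contains \<open>k\<close>, then \<open>u \<circ> (i j) = u \<circ> (i k) \<circ> (i j) \<circ> (k j)\<close> is reached in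
  three upward steps.\<close>

lemma bruhat_covered_by_cases:
  assumes "bruhat_covered_by n u v"
  obtains i j where "i \<in> {1..n}" "j \<in> {1..n}" "i < j" "u i < u j" "empty_box u i j"
    "v = u \<circ> transpose i j"
proof -
  have less: "bruhat_less n u v" and no: "\<And>x. bruhat_less n u x \<Longrightarrow> \<not> bruhat_less n x v"
    using assms by (auto simp: bruhat_covered_by_def)
  have "bruhat_step n u v"
    using less[unfolded bruhat_less_def]
  proof (cases rule: tranclp.cases)
    case (trancl_into_trancl x)
    then have "bruhat_less n u x" "bruhat_less n x v" by (auto simp: bruhat_less_def)
    then show ?thesis using no by blast
  qed
  then have u: "u permutes {1..n}" and v: "v permutes {1..n}" and "ustep u v"
    by (auto simp: bruhat_step_iff)
  then obtain i j where ij: "i < j" "u i < u j" "v = u \<circ> transpose i j" by (auto simp: ustep_def)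
  then have mem: "i \<in> {1..n}" "j \<in> {1..n}" using permutes_comp_transpose_mem[of u "{1..n}" i j] u v by auto
  have "empty_box u i j"
    unfolding empty_box_def
  proof (intro allI impI notI, elim conjE)
    fix k assume k: "i < k" "k < j" "u i < u k" "u k < u j"
    have kn: "k \<in> {1..n}" using k mem by auto
    define x where "x = u \<circ> transpose i k"
    define y where "y = x \<circ> transpose i j"
    have "v = y \<circ> transpose k j"
      using k unfolding ij x_def y_def by (auto simp: fun_eq_iff transpose_def)
    have x: "x permutes {1..n}" and y: "y permutes {1..n}"
      unfolding x_def y_def using u mem kn by (auto intro!: permutes_comp_transpose)
    have "ustep u x" unfolding ustep_def x_def using k by blast
    moreover have "ustep x y" unfolding ustep_def y_def
      using k by (intro exI[of _ i] exI[of _ j]) (auto simp: x_def)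
    moreover have "ustep y v" unfolding ustep_def \<open>v = y \<circ> transpose k j\<close>
      using k by (intro exI[of _ k] exI[of _ j]) (auto simp: x_def y_def)
    ultimately have "bruhat_step n u x" "bruhat_step n x y" "bruhat_step n y v"
      using u v x y by (simp_all add: bruhat_step_iff)
    then have "bruhat_less n u x" "bruhat_less n x v"
      unfolding bruhat_less_def by auto
    then show False using no by blast
  qed
  then show ?thesis by (intro that[OF mem ij(1,2) _ ij(3)])
qed

text \<open>An empty box adds exactly one inversion; conversely the length is strictly monotone, so
  a difference of one leaves no room for an intermediate element.\<close>

lemma bruhat_covered_by_length:
  assumes "bruhat_less n u v"
  shows "bruhat_covered_by n u v \<longleftrightarrow> perm_length n v = Suc (perm_length n u)"
proof
  assume "bruhat_covered_by n u v"
  then obtain i j where ij: "i \<in> {1..n}" "j \<in> {1..n}" "i < j" "u i < u j" "empty_box u i j"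
    "v = u \<circ> transpose i j" by (rule bruhat_covered_by_cases)
  have "inj u" using bruhat_less_permutes assms permutes_inj by blast
  then show "perm_length n v = Suc (perm_length n u)"
    unfolding ij(6) using ij by (intro perm_length_up_empty)
     (auto simp: empty_box_def inj_eq order.order_iff_strict)
next
  assume "perm_length n v = Suc (perm_length n u)"
  then show "bruhat_covered_by n u v"
    using assms by (force simp: bruhat_covered_by_def dest: bruhat_less_length)
qed

lemma bruhat_covered_byI:
  assumes "u permutes {1..n}" "i \<in> {1..n}" "j \<in> {1..n}" "i < j" "u i < u j" "empty_box u i j"
  shows "bruhat_covered_by n u (u \<circ> transpose i j)"
proof -
  have "bruhat_step n u (u \<circ> transpose i j)"
    unfolding bruhat_step_iff ustep_def using permutes_comp_transpose[OF assms(1-3)] assms by auto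
  then have "bruhat_less n u (u \<circ> transpose i j)" unfolding bruhat_less_def by blast
  moreover have "inj u" using assms permutes_inj by blast
  ultimately show ?thesis
    using assms by (subst bruhat_covered_by_length, simp)
     (intro perm_length_up_empty, auto simp: empty_box_def inj_eq order.order_iff_strict)
qed

section \<open>The bottom element and the elements of length one\<close>

lemma perm_length_id [simp]: "perm_length n id = 0"
proof -
  have "inversions n id = {}" by (auto simp: inversions_def)
  then show ?thesis by (simp add: perm_length_eq)
qed

lemma descent_exists:
  assumes "u permutes {1..n}" "u \<noteq> id"
  obtains i where "i \<in> {1..n}" "Suc i \<in> {1..n}" "u (Suc i) < u i"
proof -
  have "\<exists>i. i \<in> {1..n} \<and> Suc i \<in> {1..n} \<and> u (Suc i) < u i"
  proof (rule ccontr)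
    assume no: "\<nexists>i. i \<in> {1..n} \<and> Suc i \<in> {1..n} \<and> u (Suc i) < u i"
    have up: "u i < u (Suc i)" if "i \<in> {1..n}" "Suc i \<in> {1..n}" for i
      using no that assms(1) permutes_inj by (metis injD linorder_neqE_nat n_not_Suc_n)
    have ge: "i \<le> u i" if "i \<in> {1..n}" for i
      using that
    proof (induction i)
      case (Suc i)
      show ?case
      proof (cases "i = 0")
        case True
        have "u (Suc i) \<in> {1..n}" using Suc.prems permutes_in_image[OF assms(1), of "Suc i"] by blast
        then show ?thesis using True by simp
      next
        case False
        then show ?thesis using Suc up[of i] by auto
      qed
    qed simp
    \<comment> \<open>Without descents \<open>u\<close> is increasing, hence
      \<open>i \<le> u i\<close> throughout; a strict inequality somewhere would change the sum of
      all values, which a permutation preserves.\<close>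
    have "u i = i" for i
    proof (rule ccontr)
      assume ne: "u i \<noteq> i"
      then have i: "i \<in> {1..n}" using assms(1) permutes_not_in by metis
      have "(\<Sum>k\<in>{1..n}. k) < (\<Sum>k\<in>{1..n}. u k)"
        using ge ne i by (intro sum_strict_mono_ex1) (auto intro!: bexI[of _ i] simp: le_neq_implies_less)
      moreover have "(\<Sum>k\<in>{1..n}. u k) = (\<Sum>k\<in>{1..n}. k)"
        using sum.permute[OF assms(1), of "\<lambda>k. k"] by (simp add: comp_def)
      ultimately show False by simp
    qed
    then show False using assms(2) by auto
  qed
  then show ?thesis using that by blast
qed

lemma ustep_downI:
  assumes "i < j" "u j < u i"
  shows "ustep (u \<circ> transpose i j) u"
  unfolding ustep_def using assms by (intro exI[of _ i] exI[of _ j]) (auto simp: comp_assoc)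

lemma id_bruhat_le:
  assumes "u permutes {1..n}"
  shows "bruhat_le n id u"
  using assms
proof (induction "perm_length n u" arbitrary: u rule: less_induct)
  case less
  show ?case
  proof (cases "u = id")
    case True
    then show ?thesis by (simp add: bruhat_le_def)
  next
    case False
    then obtain i where i: "i \<in> {1..n}" "Suc i \<in> {1..n}" "u (Suc i) < u i"
      using descent_exists less.prems by blast
    let ?v = "u \<circ> transpose i (Suc i)"
    have v: "?v permutes {1..n}" by (rule permutes_comp_transpose[OF less.prems i(1,2)])
    have "bruhat_step n ?v u"
      using v less.prems ustep_downI[of i "Suc i" u] i by (simp add: bruhat_step_iff)
    moreover from this have "bruhat_le n id ?v"
      using less.hyps v bruhat_step_length by blast
    ultimately show ?thesis unfolding bruhat_le_iff by auto
  qed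
qed

lemma perm_length_0_iff: "u permutes {1..n} \<Longrightarrow> perm_length n u = 0 \<longleftrightarrow> u = id"
  using id_bruhat_le[of u n] bruhat_less_length[of n id u] by (cases "u = id") (auto simp: bruhat_less_iff)

lemma perm_length_1E:
  assumes "u permutes {1..n}" "perm_length n u = 1"
  obtains i where "i \<in> {1..n}" "Suc i \<in> {1..n}" "u = transpose i (Suc i)"
proof -
  have "u \<noteq> id" using assms by auto
  then obtain i where i: "i \<in> {1..n}" "Suc i \<in> {1..n}" "u (Suc i) < u i"
    using descent_exists assms by blast
  let ?v = "u \<circ> transpose i (Suc i)"
  have v: "?v permutes {1..n}" by (rule permutes_comp_transpose[OF assms(1) i(1,2)])
  have "bruhat_step n ?v u"
    using v assms ustep_downI[of i "Suc i" u] i by (simp add: bruhat_step_iff)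
  then have "perm_length n ?v = 0" using bruhat_step_length assms(2) by fastforce
  then have "?v = id" using perm_length_0_iff v by blast
  then have "?v \<circ> transpose i (Suc i) = transpose i (Suc i)" by simp
  then have "u = transpose i (Suc i)" by (simp add: comp_assoc)
  then show ?thesis using that i by blast
qed

section \<open>Up-degrees of the atoms\<close>

text \<open>For a permutation these are the indices of the simple generators below
  \<open>w\<close>.\<close>

definition supp :: "nat \<Rightarrow> (nat \<Rightarrow> nat) \<Rightarrow> nat set" where
  "supp n w = {p \<in> {1..<n}. \<exists>a\<le>p. p < w a}"

text \<open>For a permutation: both 3-cycles on \<open>p - 1\<close>, \<open>p\<close>,
  \<open>p + 1\<close> lie below \<open>w\<close>, that is, the generators at \<open>p - 1\<close>
  and \<open>p\<close> occur in both orders.\<close>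

definition doubled :: "(nat \<Rightarrow> nat) \<Rightarrow> nat \<Rightarrow> bool" where
  "doubled w p \<longleftrightarrow> (\<exists>a<p. p < w a) \<and> (\<exists>b>p. w b < p)"

lemma finite_supp [simp]: "finite (supp n w)"
  by (simp add: supp_def)

text \<open>The rank condition for Bruhat order when a single entry is asked for. An upward step
  brings the larger value to the left position, so the witness survives, possibly moved to
  \<open>i\<close>.\<close>

lemma bruhat_le_mono_left:
  assumes "bruhat_le n u v" "\<exists>a\<le>p. q < u a"
  shows "\<exists>a\<le>p. q < v a"
proof -
  have "(bruhat_step n)\<^sup>*\<^sup>* u v" using assms(1) by (simp add: bruhat_le_iff)
  then show ?thesis
  proof (induction rule: rtranclp_induct)
    case base
    then show ?case using assms(2) .
  next
    case (step y z)
    then obtain a where a: "a \<le> p" "q < y a" by blast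
    from step obtain i j where ij: "i < j" "y i < y j" "z = y \<circ> transpose i j"
      by (auto simp: bruhat_step_iff ustep_def)
    show ?case
    proof (cases "a = i \<or> a = j")
      case True
      then show ?thesis using a ij by (intro exI[of _ i]) auto
    next
      case False
      then show ?thesis using a ij by (intro exI[of _ a]) auto
    qed
  qed
qed

lemma bruhat_le_mono_right:
  assumes "bruhat_le n u v" "\<exists>b\<ge>p. u b < q"
  shows "\<exists>b\<ge>p. v b < q"
proof -
  have "(bruhat_step n)\<^sup>*\<^sup>* u v" using assms(1) by (simp add: bruhat_le_iff)
  then show ?thesis
  proof (induction rule: rtranclp_induct)
    case base
    then show ?case using assms(2) .
  next
    case (step y z)
    then obtain b where b: "b \<ge> p" "y b < q" by blast
    from step obtain i j where ij: "i < j" "y i < y j" "z = y \<circ> transpose i j"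
      by (auto simp: bruhat_step_iff ustep_def)
    show ?case
    proof (cases "b = i \<or> b = j")
      case True
      then show ?thesis using b ij by (intro exI[of _ j]) auto
    next
      case False
      then show ?thesis using b ij by (intro exI[of _ b]) auto
    qed
  qed
qed

text \<open>One adjacent swap hardly disturbs the identity: for positions further apart than listed,
  some position strictly between them has a value strictly between theirs.\<close>

lemma simple_covers:
  assumes "u = transpose i (Suc i)" "k < l" "u k < u l" "empty_box u k l"
  shows "l = Suc k \<and> k \<noteq> i \<or> l = Suc i \<and> Suc k = i \<or> k = i \<and> l = Suc (Suc i)"
proof (rule ccontr)
  assume no: "\<not> ?thesis"
  have e: "\<not> (k < c \<and> c < l \<and> u k < u c \<and> u c < u l)" for c
    using assms(4) by (auto simp: empty_box_def)
  have u: "u c = (if c = i then Suc i else if c = Suc i then i else c)" for c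
    by (simp add: assms(1) transpose_def)
  have "l \<noteq> Suc k"
  proof
    assume "l = Suc k"
    then have "k = i" using no by blast
    then show False using assms(3) \<open>l = Suc k\<close> by (simp add: u)
  qed
  then have l: "k + 2 \<le> l" using assms(2) by linarith
  consider "k = i" | "Suc k = i" | "k \<noteq> i" "Suc k \<noteq> i" by blast
  then show False
  proof cases
    case 1
    then have "l \<ge> i + 3" using l no by linarith
    then show False using e[of "i + 2"] 1 by (simp add: u)
  next
    case 2
    then have "l \<ge> i + 2" using l no by linarith
    then show False using e[of "Suc i"] 2 by (simp add: u)
  next
    case 3
    then show False using e[of "Suc k"] l by (simp add: u split: if_splits)
  qed
qed

lemma card_Int_pair_le:
  assumes "x \<in> V \<or> y \<in> V \<Longrightarrow> P" "x \<in> V \<Longrightarrow> y \<in> V \<Longrightarrow> Q"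
  shows "card (V \<inter> {x, y}) \<le> of_bool P + of_bool Q"
  using assms by (cases "x \<in> V"; cases "y \<in> V") (auto simp: card_insert_if Int_insert_right)

text \<open>A generator away from \<open>i\<close> commutes with that at \<open>i\<close> and yields
  one product above it. A neighbour yields two, and both lie below \<open>w\<close> only if the pair
  is doubled. So beyond the \<open>card (supp n w) - 1\<close> other generators only doubled pairs
  contribute.\<close>

lemma udeg_simple_le:
  assumes w: "w permutes {1..n}" and u: "u = transpose i (Suc i)"
    and i: "i \<in> {1..n}" "Suc i \<in> {1..n}" and uw: "u \<in> lower_interval n w"
  shows "udeg n w u + 1 \<le> card (supp n w) + of_bool (doubled w i) + of_bool (doubled w (Suc i))"
proof -
  define V where "V = {v \<in> lower_interval n w. bruhat_covered_by n u v}"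
  define K where "K = supp n w - {i}"
  define F where "F = (\<lambda>k. u \<circ> transpose k (Suc k))"
  \<comment> \<open>With \<open>s_j\<close> for the generator at \<open>j\<close>,
    \<open>F (i - 1)\<close> and \<open>v1\<close> are the products \<open>s_i s_(i-1)\<close> and
    \<open>s_(i-1) s_i\<close>; likewise \<open>F (Suc i)\<close> and \<open>v2\<close> are
    \<open>s_i s_(i+1)\<close> and \<open>s_(i+1) s_i\<close>. For \<open>i = 1\<close> the index
    \<open>i - 1\<close> is 0, which is not in \<open>K\<close>.\<close>
  define v1 where "v1 = u \<circ> transpose (i - 1) (Suc i)"
  define v2 where "v2 = u \<circ> transpose i (Suc (Suc i))"
  have le: "bruhat_le n v w" if "v \<in> V" for v
    using that by (simp add: V_def lower_interval_def)
  have perm: "v permutes {1..n}" if "v \<in> V" for v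
    using le[OF that] by (simp add: bruhat_le_def)
  have isupp: "i \<in> supp n w"
  proof -
    have "\<exists>a\<le>i. i < u a" using u by (intro exI[of _ i]) simp
    then have "\<exists>a\<le>i. i < w a" using bruhat_le_mono_left uw by (auto simp: lower_interval_def)
    then show ?thesis using i by (simp add: supp_def)
  qed
  have FK: "k \<in> K" if "F k \<in> V" "k \<noteq> i" for k
  proof -
    have "k \<in> {1..n}" "Suc k \<in> {1..n}"
      using permutes_comp_transpose_mem[of u "{1..n}" k "Suc k"] perm[OF that(1)] uw
      by (auto simp: F_def lower_interval_def bruhat_le_def)
    moreover have "\<exists>a\<le>k. k < F k a"
      using that(2) by (intro exI[of _ k]) (auto simp: F_def u transpose_def)
    then have "\<exists>a\<le>k. k < w a" using bruhat_le_mono_left le[OF that(1)] by blast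
    ultimately show ?thesis using that(2) by (auto simp: K_def supp_def)
  qed
  have v1: "i - 1 \<in> K" "\<exists>b>i. w b < i" if "v1 \<in> V"
  proof -
    have "i - 1 \<in> {1..n}"
      using permutes_comp_transpose_mem[of u "{1..n}" "i - 1" "Suc i"] perm[OF that(1)] uw
      by (auto simp: v1_def lower_interval_def bruhat_le_def)
    moreover have "\<exists>a\<le>i-1. i-1 < v1 a"
      using i by (intro exI[of _ "i-1"]) (auto simp: v1_def u transpose_def)
    then have "\<exists>a\<le>i-1. i-1 < w a" using bruhat_le_mono_left le[OF that(1)] by blast
    ultimately show "i - 1 \<in> K" using i by (auto simp: K_def supp_def)
    then have "1 < i" by (auto simp: K_def supp_def)
    then have "\<exists>b\<ge>Suc i. v1 b < i"
      by (intro exI[of _ "Suc i"]) (auto simp: v1_def u transpose_def)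
    then have "\<exists>b\<ge>Suc i. w b < i" using bruhat_le_mono_right le[OF that(1)] by blast
    then show "\<exists>b>i. w b < i" by (simp add: Suc_le_eq)
  qed
  have F1: "\<exists>a<i. i < w a" if "F (i - 1) \<in> V" "i - 1 \<in> K"
  proof -
    have "\<exists>a\<le>i-1. i < F (i-1) a"
      using that(2) i by (intro exI[of _ "i-1"]) (auto simp: F_def u transpose_def K_def supp_def)
    then have "\<exists>a\<le>i-1. i < w a" using bruhat_le_mono_left le[OF that(1)] by blast
    then show ?thesis using i by (metis One_nat_def Suc_pred atLeastAtMost_iff le_imp_less_Suc less_eq_Suc_le)
  qed
  have v2: "Suc i \<in> K" "\<exists>a<Suc i. Suc i < w a" if "v2 \<in> V"
  proof -
    have "Suc (Suc i) \<in> {1..n}"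
      using permutes_comp_transpose_mem[of u "{1..n}" i "Suc (Suc i)"] perm[OF that(1)] uw
      by (auto simp: v2_def lower_interval_def bruhat_le_def)
    moreover have "\<exists>a\<le>i. Suc i < v2 a"
      by (intro exI[of _ i]) (auto simp: v2_def u transpose_def)
    then have *: "\<exists>a\<le>i. Suc i < w a" using bruhat_le_mono_left le[OF that(1)] by blast
    ultimately show "Suc i \<in> K" by (auto simp: K_def supp_def intro: le_SucI)
    show "\<exists>a<Suc i. Suc i < w a" using * by (simp add: less_Suc_eq_le)
  qed
  have F2: "\<exists>b>Suc i. w b < Suc i" if "F (Suc i) \<in> V"
  proof -
    have "\<exists>b\<ge>Suc (Suc i). F (Suc i) b < Suc i"
      by (intro exI[of _ "Suc (Suc i)"]) (auto simp: F_def u transpose_def)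
    then have "\<exists>b\<ge>Suc (Suc i). w b < Suc i" using bruhat_le_mono_right le[OF that(1)] by blast
    then show ?thesis by (simp add: Suc_le_eq)
  qed
  have "V \<subseteq> F ` (K - {i - 1, Suc i}) \<union> V \<inter> {v1, F (i - 1)} \<union> V \<inter> {v2, F (Suc i)}"
  proof
    fix v assume v: "v \<in> V"
    then have "bruhat_covered_by n u v" by (simp add: V_def)
    then obtain k l where kl: "k < l" "u k < u l" "empty_box u k l" "v = u \<circ> transpose k l"
      by (rule bruhat_covered_by_cases)
    from simple_covers[OF u kl(1-3)] consider "l = Suc k" "k \<noteq> i" | "l = Suc i" "Suc k = i"
      | "k = i" "l = Suc (Suc i)" by blast
    then show "v \<in> F ` (K - {i - 1, Suc i}) \<union> V \<inter> {v1, F (i - 1)} \<union> V \<inter> {v2, F (Suc i)}"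
    proof cases
      case 1
      then have "v = F k" using kl by (simp add: F_def)
      then show ?thesis using FK[of k] 1 v by blast
    next
      case 2
      then have "v = v1" using kl by (auto simp: v1_def)
      then show ?thesis using v by simp
    next
      case 3
      then show ?thesis using v kl by (simp add: v2_def)
    qed
  qed
  then have "card V \<le> card (F ` (K - {i - 1, Suc i}) \<union> V \<inter> {v1, F (i - 1)} \<union> V \<inter> {v2, F (Suc i)})"
    by (intro card_mono) (auto simp: K_def)
  also have "\<dots> \<le> card (F ` (K - {i - 1, Suc i})) + card (V \<inter> {v1, F (i - 1)}) + card (V \<inter> {v2, F (Suc i)})"
    by (metis (no_types, lifting) add_right_mono card_Un_le order_trans)
  also have "card (F ` (K - {i - 1, Suc i})) \<le> card (K - {i - 1, Suc i})"
    by (intro card_image_le) (simp add: K_def)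
  also have "card (V \<inter> {v1, F (i - 1)}) \<le> of_bool (i - 1 \<in> K) + of_bool (doubled w i)"
  proof (rule card_Int_pair_le)
    assume "v1 \<in> V \<or> F (i - 1) \<in> V"
    then show "i - 1 \<in> K" using v1 FK[of "i - 1"] i by auto
  next
    assume "v1 \<in> V" "F (i - 1) \<in> V"
    then show "doubled w i" using v1 F1 by (simp add: doubled_def)
  qed
  also have "card (V \<inter> {v2, F (Suc i)}) \<le> of_bool (Suc i \<in> K) + of_bool (doubled w (Suc i))"
  proof (rule card_Int_pair_le)
    assume "v2 \<in> V \<or> F (Suc i) \<in> V"
    then show "Suc i \<in> K" using v2 FK[of "Suc i"] by auto
  next
    assume "v2 \<in> V" "F (Suc i) \<in> V"
    then show "doubled w (Suc i)" using v2 F2 by (simp add: doubled_def)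
  qed
  finally have "card V \<le> card (K - {i - 1, Suc i}) + (of_bool (i - 1 \<in> K) + of_bool (doubled w i)) +
      (of_bool (Suc i \<in> K) + of_bool (doubled w (Suc i)))" by simp
  moreover have "card (K - {i - 1, Suc i}) + of_bool (i - 1 \<in> K) + of_bool (Suc i \<in> K) = card K"
  proof -
    have "finite K" by (simp add: K_def)
    have "K = (K - {i - 1, Suc i}) \<union> (K \<inter> {i - 1, Suc i})" by blast
    then have "card K = card (K - {i - 1, Suc i}) + card (K \<inter> {i - 1, Suc i})"
      using \<open>finite K\<close> by (metis card_Diff_subset_Int card_Int_Diff add.commute finite_Int)
    moreover have "card (K \<inter> {i - 1, Suc i}) = of_bool (i - 1 \<in> K) + of_bool (Suc i \<in> K)"
      by (simp add: Int_insert_right)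
    ultimately show ?thesis by simp
  qed
  moreover have "card K + 1 = card (supp n w)"
    using isupp card.remove[of "supp n w" i] by (simp add: K_def)
  ultimately show ?thesis unfolding udeg_def V_def by simp
qed

section \<open>The Hasse diagram of the inversion order\<close>

definition cover_pairs :: "nat \<Rightarrow> (nat \<Rightarrow> nat) \<Rightarrow> (nat \<times> nat) set" where
  "cover_pairs n w = {(i, j) \<in> inversions n w. \<forall>k. i < k \<and> k < j \<longrightarrow> \<not> (w j < w k \<and> w k < w i)}"

text \<open>Unlike \<open>supp\<close> this never compares positions with values, so it makes sense
  for any injective word. The induction needs that, since deleting the last entry need not leave a
  permutation.\<close>

definition linked_cuts :: "nat \<Rightarrow> (nat \<Rightarrow> nat) \<Rightarrow> nat set" where
  "linked_cuts n w = {p \<in> {1..<n}. \<exists>a\<in>{1..p}. \<exists>b\<in>{p<..n}. w b < w a}"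

lemma finite_cover_pairs [simp]: "finite (cover_pairs n w)"
  by (rule finite_subset[OF _ finite_inversions[of n w]]) (auto simp: cover_pairs_def)

text \<open>A cut first linked by position \<open>n + 1\<close> is sent to a point covering that position:
  the lowest point behind the cut, or, for the last cut, the lowest point above \<open>w (n + 1)\<close>.\<close>

lemma card_linked_cuts_le:
  assumes "inj_on w {1..n}"
  shows "card (linked_cuts n w) \<le> card (cover_pairs n w)"
  using assms
proof (induction n)
  case 0
  then show ?case by (simp add: linked_cuts_def)
next
  case (Suc n)
  define N where "N = {p \<in> {1..n}. p \<notin> linked_cuts n w \<and> (\<exists>a\<in>{1..p}. w (Suc n) < w a)}"
  define A where "A = {a \<in> {1..n}. w (Suc n) < w a}"
  define U where "U = {u \<in> A. \<forall>k. u < k \<and> k \<le> n \<longrightarrow> \<not> (w (Suc n) < w k \<and> w k < w u)}"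
  define g where "g = (\<lambda>p. if p = n then arg_min_on w A else arg_min_on w {p<..n})"
  have inj: "inj_on w {1..n}" using Suc.prems by (rule inj_on_subset) auto
  have low: "w a < w b" if "p \<in> N" "a \<in> {1..p}" "b \<in> {p<..n}" for p a b
  proof -
    have "\<not> w b < w a" using that by (auto simp: N_def linked_cuts_def)
    moreover have "w a \<noteq> w b" using inj_onD[OF inj, of a b] that by (auto simp: N_def)
    ultimately show ?thesis by simp
  qed
  have A: "finite A" "A \<noteq> {}" if "p \<in> N" for p
    using that by (auto simp: A_def N_def) (metis atLeastAtMost_iff le_trans)
  have gn: "arg_min_on w A \<in> A" "\<And>a. a \<in> A \<Longrightarrow> w (arg_min_on w A) \<le> w a" if "p \<in> N" for p
    using A[OF that] by (auto intro: arg_min_if_finite arg_min_least)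
  have gp: "arg_min_on w {p<..n} \<in> {p<..n}" "\<And>a. a \<in> {p<..n} \<Longrightarrow> w (arg_min_on w {p<..n}) \<le> w a"
    if "p \<in> N" "p \<noteq> n" for p
    using arg_min_if_finite(1)[of "{p<..n}" w] arg_min_least[of "{p<..n}" _ w] that
    by (auto simp: N_def)
  have gU: "g p \<in> U" if p: "p \<in> N" for p
  proof (cases "p = n")
    case True
    have "\<not> w k < w (arg_min_on w A)" if "w (Suc n) < w k" "arg_min_on w A < k" "k \<le> n" for k
      using gn(2)[OF p, of k] that by (simp add: A_def)
    then show ?thesis using gn(1)[OF p] True by (auto simp: U_def g_def)
  next
    case False
    obtain a where a: "a \<in> {1..p}" "w (Suc n) < w a" using p by (auto simp: N_def)
    have "w (Suc n) < w (g p)" using low[OF p a(1), of "g p"] gp(1)[OF p False] a(2) False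
      by (simp add: g_def)
    then have "g p \<in> A" using gp(1)[OF p False] False by (auto simp: A_def g_def)
    moreover have "\<not> w k < w (g p)" if "g p < k" "k \<le> n" for k
      using gp(1)[OF p False] gp(2)[OF p False, of k] that False by (simp add: g_def)
    ultimately show ?thesis by (auto simp: U_def)
  qed
  \<comment> \<open>The values \<open>w (g p)\<close> tell the cuts apart. For cuts before
    \<open>n\<close> they increase with \<open>p\<close>, since nothing before a cut in
    \<open>N\<close> exceeds anything behind it; the value chosen for \<open>p = n\<close> is lower
    than all of them.\<close>
  have "inj_on g N"
  proof (rule linorder_inj_onI')
    fix p q assume pq: "p \<in> N" "q \<in> N" "p < q"
    then have p: "p \<noteq> n" by (auto simp: N_def)
    obtain a where a: "a \<in> {1..p}" "w (Suc n) < w a" using pq by (auto simp: N_def)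
    have q: "q \<le> n" using pq by (simp add: N_def)
    show "g p \<noteq> g q"
    proof (cases "q = n")
      case True
      have "w (g q) \<le> w a" using gn(2)[OF pq(1), of a] a pq q True by (auto simp: A_def g_def)
      moreover have "w a < w (g p)"
        using low[OF pq(1) a(1), of "g p"] gp(1)[OF pq(1) p] p by (simp add: g_def)
      ultimately show ?thesis by auto
    next
      case False
      have q1: "q \<in> {p<..n}" using pq q by simp
      have "w (g p) \<le> w q" using gp(2)[OF pq(1) p q1] p by (simp add: g_def)
      moreover have "w q < w (g q)"
        using low[OF pq(2), of q "g q"] gp(1)[OF pq(2) False] False pq by (simp add: g_def N_def)
      ultimately show ?thesis by auto
    qed
  qed
  then have NU: "card N \<le> card U"
    using gU by (intro card_inj_on_le) (auto simp: U_def A_def)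
  have "linked_cuts (Suc n) w = linked_cuts n w \<union> N"
  proof (intro equalityI subsetI)
    fix p assume "p \<in> linked_cuts (Suc n) w"
    then obtain a b where p: "p \<in> {1..n}" "a \<in> {1..p}" "p < b" "b \<le> Suc n" "w b < w a"
      by (auto simp: linked_cuts_def less_Suc_eq_le)
    show "p \<in> linked_cuts n w \<union> N"
    proof (cases "b = Suc n")
      case True
      then show ?thesis using p by (auto simp: N_def)
    next
      case False
      then have "b \<in> {p<..n}" "p \<in> {1..<n}" using p by auto
      then have "p \<in> linked_cuts n w" unfolding linked_cuts_def using p by blast
      then show ?thesis by blast
    qed
  next
    fix p assume "p \<in> linked_cuts n w \<union> N"
    then consider "p \<in> linked_cuts n w" | "p \<in> N" by blast
    then show "p \<in> linked_cuts (Suc n) w"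
    proof cases
      case 1
      then obtain a b where "p \<in> {1..<n}" "a \<in> {1..p}" "b \<in> {p<..n}" "w b < w a"
        by (auto simp: linked_cuts_def)
      then have "p \<in> {1..<Suc n}" "a \<in> {1..p}" "b \<in> {p<..Suc n}" "w b < w a" by auto
      then show ?thesis unfolding linked_cuts_def by blast
    next
      case 2
      then obtain a where "p \<in> {1..<Suc n}" "a \<in> {1..p}" "Suc n \<in> {p<..Suc n}" "w (Suc n) < w a"
        by (auto simp: N_def)
      then show ?thesis unfolding linked_cuts_def by blast
    qed
  qed
  then have "card (linked_cuts (Suc n) w) \<le> card (linked_cuts n w) + card N"
    by (simp add: card_Un_le)
  moreover have "cover_pairs (Suc n) w = cover_pairs n w \<union> (\<lambda>u. (u, Suc n)) ` U"
    by (auto simp: cover_pairs_def inversions_def U_def A_def le_Suc_eq less_Suc_eq_le)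
  moreover have "card (cover_pairs n w \<union> (\<lambda>u. (u, Suc n)) ` U) = card (cover_pairs n w) + card U"
  proof (subst card_Un_disjoint)
    show "cover_pairs n w \<inter> (\<lambda>u. (u, Suc n)) ` U = {}"
      by (auto simp: cover_pairs_def inversions_def)
    show "finite ((\<lambda>u. (u, Suc n)) ` U)" by (simp add: U_def A_def)
  qed (auto simp: card_image inj_on_def)
  ultimately show ?case using Suc.IH[OF inj] NU by simp
qed

text \<open>Pigeonhole: a value leaving the first \<open>p\<close> places forces another one in from
  behind, and the two form an inversion across the cut.\<close>

lemma supp_subset_linked_cuts:
  assumes w: "w permutes {1..n}"
  shows "supp n w \<subseteq> linked_cuts n w"
proof
  fix p assume p: "p \<in> supp n w"
  then obtain a where a: "a \<le> p" "p < w a" by (auto simp: supp_def)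
  have an: "a \<in> {1..n}" using a w permutes_not_in[OF w, of a] by force
  have pn: "p \<in> {1..<n}" using p by (simp add: supp_def)
  have "\<exists>b\<in>{p<..n}. w b \<le> p"
  proof (rule ccontr)
    assume no: "\<not> ?thesis"
    have "w b \<in> {p<..n}" if "b \<in> {p<..n}" for b
      using no that permutes_in_image[OF w, of b] by (simp add: not_le)
    then have "w ` {p<..n} \<subseteq> {p<..n}" by blast
    then have "w ` {p<..n} = {p<..n}"
      using permutes_inj[OF w] by (intro endo_inj_surj) (auto intro: inj_on_subset)
    moreover have "w a \<in> {p<..n}" using a an permutes_in_image[OF w, of a] by simp
    ultimately obtain c where "c \<in> {p<..n}" "w a = w c" by (metis imageE)
    then have "a = c" using permutes_inj[OF w] by (simp add: inj_eq)
    then show False using a \<open>c \<in> {p<..n}\<close> by simp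
  qed
  then obtain b where "b \<in> {p<..n}" "w b \<le> p" by blast
  then show "p \<in> linked_cuts n w"
    unfolding linked_cuts_def using pn a an by force
qed

lemma card_supp_le:
  assumes w: "w permutes {1..n}"
  shows "card (supp n w) \<le> card (cover_pairs n w)"
proof -
  have "card (supp n w) \<le> card (linked_cuts n w)"
    using supp_subset_linked_cuts[OF w] by (intro card_mono) (auto simp: linked_cuts_def)
  also have "\<dots> \<le> card (cover_pairs n w)"
    using permutes_inj_on[OF w] by (rule card_linked_cuts_le)
  finally show ?thesis .
qed

section \<open>Down-degrees of the coatoms\<close>

definition no_3412 :: "(nat \<Rightarrow> nat) \<Rightarrow> nat set \<Rightarrow> bool" where
  "no_3412 w A \<longleftrightarrow> (\<forall>i\<in>A. \<forall>j\<in>A. \<forall>k\<in>A. \<forall>l\<in>A. i < j \<longrightarrow> j < k \<longrightarrow> k < l \<longrightarrow>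
     \<not> (w k < w l \<and> w l < w i \<and> w i < w j))"

definition no_4231 :: "(nat \<Rightarrow> nat) \<Rightarrow> nat set \<Rightarrow> bool" where
  "no_4231 w A \<longleftrightarrow> (\<forall>i\<in>A. \<forall>j\<in>A. \<forall>k\<in>A. \<forall>l\<in>A. i < j \<longrightarrow> j < k \<longrightarrow> k < l \<longrightarrow>
     \<not> (w l < w j \<and> w j < w k \<and> w k < w i))"

lemma no_3412D:
  assumes "no_3412 w A" "i \<in> A" "j \<in> A" "k \<in> A" "l \<in> A" "i < j" "j < k" "k < l"
    "w k < w l" "w l < w i" "w i < w j"
  shows False
  using assms unfolding no_3412_def by blast

lemma no_4231D:
  assumes "no_4231 w A" "i \<in> A" "j \<in> A" "k \<in> A" "l \<in> A" "i < j" "j < k" "k < l"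
    "w l < w j" "w j < w k" "w k < w i"
  shows False
  using assms unfolding no_4231_def by blast

lemma in_cover_pairs_iff:
  "(i, j) \<in> cover_pairs n w \<longleftrightarrow> i \<in> {1..n} \<and> j \<in> {1..n} \<and> i < j \<and> w j < w i \<and>
     (\<forall>k. i < k \<and> k < j \<longrightarrow> \<not> (w j < w k \<and> w k < w i))"
  by (auto simp: cover_pairs_def inversions_def)

lemma finite_lower_interval [simp]: "finite (lower_interval n w)"
  by (rule finite_subset[OF _ finite_permutations[of "{1..n}"]])
    (auto simp: lower_interval_def bruhat_le_def)

lemma cover_pairs_covered:
  assumes v: "v permutes {1..n}" and ij: "(i, j) \<in> cover_pairs n v"
  shows "bruhat_covered_by n (v \<circ> transpose i j) v"
proof -
  have ij: "i \<in> {1..n}" "j \<in> {1..n}" "i < j" "v j < v i"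
    and e: "\<And>k. i < k \<Longrightarrow> k < j \<Longrightarrow> \<not> (v j < v k \<and> v k < v i)"
    using ij by (auto simp: in_cover_pairs_iff)
  have "bruhat_covered_by n (v \<circ> transpose i j) (v \<circ> transpose i j \<circ> transpose i j)"
    using ij e by (intro bruhat_covered_byI permutes_comp_transpose v) (auto simp: empty_box_def)
  then show ?thesis by (simp add: comp_assoc)
qed

lemma inj_on_cover_pairs:
  assumes v: "v permutes {1..n}"
  shows "inj_on (\<lambda>(i, j). v \<circ> transpose i j) (cover_pairs n v)"
proof (rule inj_onI, clarify)
  fix i j k l
  assume *: "(i, j) \<in> cover_pairs n v" "(k, l) \<in> cover_pairs n v"
    and eq: "v \<circ> transpose i j = v \<circ> transpose k l"
  have t: "transpose i j x = transpose k l x" for x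
    using fun_cong[OF eq, of x] permutes_inj[OF v] by (simp add: inj_eq)
  have "i < j" "k < l" using * by (auto simp: in_cover_pairs_iff)
  then show "i = k \<and> j = l"
    using t[of i] t[of j] by (auto simp: transpose_def split: if_splits)
qed

lemma card_cover_pairs_le_ddeg:
  assumes vw: "v \<in> lower_interval n w"
  shows "card (cover_pairs n v) \<le> ddeg n w v"
proof -
  have v: "v permutes {1..n}" and le: "bruhat_le n v w"
    using vw by (auto simp: lower_interval_def bruhat_le_def)
  have "(\<lambda>(i, j). v \<circ> transpose i j) ` cover_pairs n v
      \<subseteq> {x \<in> lower_interval n w. bruhat_covered_by n x v}"
  proof clarify
    fix i j assume "(i, j) \<in> cover_pairs n v"
    then have c: "bruhat_covered_by n (v \<circ> transpose i j) v" using cover_pairs_covered v by blast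
    then have "bruhat_le n (v \<circ> transpose i j) v"
      by (simp add: bruhat_covered_by_def bruhat_less_iff)
    then show "v \<circ> transpose i j \<in> lower_interval n w \<and> bruhat_covered_by n (v \<circ> transpose i j) v"
      using c le bruhat_le_trans by (auto simp: lower_interval_def)
  qed
  then show ?thesis
    unfolding ddeg_def using inj_on_cover_pairs[OF v] by (intro card_inj_on_le) auto
qed

lemma cover_pairs_coatom:
  assumes w: "w permutes {1..n}" and ij: "(i, j) \<in> cover_pairs n w"
  shows "w \<circ> transpose i j \<in> rank_set n w (perm_length n w - 1)"
proof -
  have c: "bruhat_covered_by n (w \<circ> transpose i j) w" using cover_pairs_covered assms by blast
  then have l: "bruhat_less n (w \<circ> transpose i j) w" by (simp add: bruhat_covered_by_def)
  then have "perm_length n w = Suc (perm_length n (w \<circ> transpose i j))"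
    using bruhat_covered_by_length c by blast
  then show ?thesis using l by (simp add: rank_set_def lower_interval_def bruhat_less_iff)
qed

text \<open>An edge \<open>(x, y)\<close> of the Hasse diagram is removed by swapping its end points. Every point above
  \<open>x\<close> then covers both of them, every point below \<open>y\<close> is covered by both of them, and avoidance of
  3412 and 4231 protects all other edges.\<close>

lemma card_cover_pairs_swap:
  assumes w: "inj w" and av: "no_3412 w {1..n}" "no_4231 w {1..n}"
    and xy: "(x, y) \<in> cover_pairs n w"
  defines "U \<equiv> {u. (u, x) \<in> cover_pairs n w}" and "D \<equiv> {d. (y, d) \<in> cover_pairs n w}"
  shows "card (cover_pairs n w) + card U + card D \<le> card (cover_pairs n (w \<circ> transpose x y)) + 1"
proof -
  define v where "v = w \<circ> transpose x y"
  define E where "E = cover_pairs n w"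
  \<comment> \<open>After the swap the larger value sits at \<open>y\<close>. An edge from
    \<open>x\<close> to a position right of \<open>y\<close> now starts at \<open>y\<close>, and an
    edge into \<open>y\<close> from the left of \<open>x\<close> now ends at \<open>x\<close>; all
    other edges keep their end points.\<close>
  define \<phi> where "\<phi> = (\<lambda>(i, j). if i = x \<and> y < j then (y, j)
    else if j = y \<and> i < x then (i, x) else (i, j))"
  have x: "x \<in> {1..n}" and y: "y \<in> {1..n}" and lt: "x < y" "w y < w x"
    and e: "\<And>k. x < k \<Longrightarrow> k < y \<Longrightarrow> \<not> (w y < w k \<and> w k < w x)"
    using xy by (auto simp: in_cover_pairs_iff)
  have vx: "v x = w y" "v y = w x" and vo: "\<And>k. k \<noteq> x \<Longrightarrow> k \<noteq> y \<Longrightarrow> v k = w k"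
    by (auto simp: v_def)
  have neq: "w i \<noteq> w j" if "i \<noteq> j" for i j using w that by (simp add: inj_eq)
  \<comment> \<open>If the swap put a value into the box of an edge disjoint from
    \<open>(x, y)\<close>, the two edges would form a 3412.\<close>
  have other: "(i, j) \<in> cover_pairs n v"
    if ij: "(i, j) \<in> E" and ne: "i \<noteq> x" "i \<noteq> y" "j \<noteq> x" "j \<noteq> y" for i j
  proof -
    have mem: "i \<in> {1..n}" "j \<in> {1..n}" and ij: "i < j" "w j < w i"
      and b: "\<And>k. i < k \<Longrightarrow> k < j \<Longrightarrow> \<not> (w j < w k \<and> w k < w i)"
      using ij by (auto simp: E_def in_cover_pairs_iff)
    have "\<not> (v j < v k \<and> v k < v i)" if k: "i < k" "k < j" for k
    proof
      assume vk: "v j < v k \<and> v k < v i"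
      consider "k = x" | "k = y" | "k \<noteq> x" "k \<noteq> y" by blast
      then show False
      proof cases
        case 1
        then have *: "w j < w y" "w y < w i" using vk ne by (auto simp: vx vo)
        then have "w i < w x" using b[of x] k 1 lt neq[of x i] ne by auto
        moreover have "j < y" using b[of y] k 1 lt * ne by (cases "j < y") auto
        ultimately show False
          using no_3412D[OF av(1) mem(1) x mem(2) y] k 1 * by blast
      next
        case 2
        then have *: "w j < w x" "w x < w i" using vk ne by (auto simp: vx vo)
        then have "w y < w j" using b[of y] k 2 lt neq[of y j] ne by auto
        moreover have "x < i" using b[of x] k 2 lt * ne by (cases "x < i") auto
        ultimately show False
          using no_3412D[OF av(1) x mem(1) y mem(2)] k 2 * by blast
      next
        case 3
        then show False using b[of k] k vk ne by (auto simp: vo)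
      qed
    qed
    then show ?thesis using mem ij ne by (auto simp: in_cover_pairs_iff vo)
  qed
  have up: "(u, x) \<in> cover_pairs n v" "(u, y) \<in> cover_pairs n v" if ux: "(u, x) \<in> E" for u
  proof -
    have mem: "u \<in> {1..n}" and ux: "u < x" "w x < w u"
      and b: "\<And>k. u < k \<Longrightarrow> k < x \<Longrightarrow> \<not> (w x < w k \<and> w k < w u)"
      using ux by (auto simp: E_def in_cover_pairs_iff)
    have "\<not> (w y < w k \<and> w k < w u)" if k: "u < k" "k < x" for k
      using no_4231D[OF av(2) mem _ x y, of k] b[OF k] k ux lt neq[of k x] x mem by fastforce
    then show "(u, x) \<in> cover_pairs n v"
      using mem x ux lt by (auto simp: in_cover_pairs_iff vx vo)
    have "\<not> (w x < w k \<and> w k < w u)" if k: "x < k" "k < y" for k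
      using no_4231D[OF av(2) mem x _ y, of k] k ux lt x y by fastforce
    then have "\<not> (w x < v k \<and> v k < w u)" if "u < k" "k < y" for k
      using that b[of k] vo[of k] vx lt by (cases k x rule: linorder_cases) auto
    then show "(u, y) \<in> cover_pairs n v"
      using mem y ux lt by (auto simp: in_cover_pairs_iff vx vo)
  qed
  have down: "(y, d) \<in> cover_pairs n v" "(x, d) \<in> cover_pairs n v" if yd: "(y, d) \<in> E" for d
  proof -
    have mem: "d \<in> {1..n}" and yd: "y < d" "w d < w y"
      and b: "\<And>k. y < k \<Longrightarrow> k < d \<Longrightarrow> \<not> (w d < w k \<and> w k < w y)"
      using yd by (auto simp: E_def in_cover_pairs_iff)
    have "\<not> (w d < w k \<and> w k < w x)" if k: "y < k" "k < d" for k
      using no_4231D[OF av(2) x y _ mem, of k] b[OF k] k yd lt neq[of k y] y mem by fastforce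
    then show "(y, d) \<in> cover_pairs n v"
      using mem y yd lt by (auto simp: in_cover_pairs_iff vx vo)
    have "\<not> (w d < w k \<and> w k < w y)" if k: "x < k" "k < y" for k
      using no_4231D[OF av(2) x _ y mem, of k] k yd lt x y by fastforce
    then have "\<not> (w d < v k \<and> v k < w y)" if "x < k" "k < d" for k
      using that b[of k] vo[of k] vx lt by (cases k y rule: linorder_cases) auto
    then show "(x, d) \<in> cover_pairs n v"
      using mem x yd lt by (auto simp: in_cover_pairs_iff vx vo)
  qed
  have from_x: "if y < d then (y, d) \<in> cover_pairs n v else (x, d) \<in> cover_pairs n v"
    if xd: "(x, d) \<in> E" "d \<noteq> y" for d
  proof -
    have mem: "d \<in> {1..n}" and xd': "x < d" "w d < w x"
      and b: "\<And>k. x < k \<Longrightarrow> k < d \<Longrightarrow> \<not> (w d < w k \<and> w k < w x)"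
      using xd by (auto simp: E_def in_cover_pairs_iff)
    show ?thesis
    proof (cases "y < d")
      case True
      then show ?thesis using mem y xd' b lt by (auto simp: in_cover_pairs_iff vx vo)
    next
      case False
      then have "w d < w y" using e[of d] xd xd' neq[of d y] by auto
      moreover have "\<not> (w d < w k \<and> w k < w y)" if "x < k" "k < d" for k
        using b[OF that] lt by linarith
      ultimately show ?thesis using mem x xd' lt False xd(2) by (auto simp: in_cover_pairs_iff vx vo)
    qed
  qed
  have to_y: "if u < x then (u, x) \<in> cover_pairs n v else (u, y) \<in> cover_pairs n v"
    if uy: "(u, y) \<in> E" "u \<noteq> x" for u
  proof -
    have mem: "u \<in> {1..n}" and uy': "u < y" "w y < w u"
      and b: "\<And>k. u < k \<Longrightarrow> k < y \<Longrightarrow> \<not> (w y < w k \<and> w k < w u)"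
      using uy by (auto simp: E_def in_cover_pairs_iff)
    show ?thesis
    proof (cases "u < x")
      case True
      then show ?thesis using mem x uy' b lt by (auto simp: in_cover_pairs_iff vx vo)
    next
      case False
      then have "w x < w u" using e[of u] uy uy' neq[of x u] by auto
      moreover have "\<not> (w x < w k \<and> w k < w u)" if "u < k" "k < y" for k
        using b[OF that] lt by linarith
      ultimately show ?thesis using mem y uy' lt False uy(2) by (auto simp: in_cover_pairs_iff vx vo)
    qed
  qed
  have not_x: "(x, d) \<notin> E" if "(y, d) \<in> E" for d
    using that lt by (auto simp: E_def in_cover_pairs_iff)
  have not_y: "(u, y) \<notin> E" if "(u, x) \<in> E" for u
    using that lt by (auto simp: E_def in_cover_pairs_iff)
  have lt_E: "i < j" if "(i, j) \<in> E" for i j using that by (simp add: E_def in_cover_pairs_iff)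
  \<comment> \<open>\<open>S1\<close> has one edge for each old edge except \<open>(x, y)\<close>,
    which the swap destroys; \<open>S2\<close> and \<open>S3\<close> are the additional edges into
    \<open>y\<close> and out of \<open>x\<close>.\<close>
  define S1 where "S1 = \<phi> ` (E - {(x, y)})"
  define S2 where "S2 = (\<lambda>u. (u, y)) ` U"
  define S3 where "S3 = Pair x ` D"
  have fin: "finite E" by (simp add: E_def)
  have finU: "finite U"
    by (rule finite_subset[of _ "fst ` E"]) (auto simp: U_def E_def image_iff, force)
  have finD: "finite D"
    by (rule finite_subset[of _ "snd ` E"]) (auto simp: D_def E_def image_iff, force)
  have "\<phi> p \<in> cover_pairs n v" if "p \<in> E - {(x, y)}" for p
  proof -
    obtain i j where p: "p = (i, j)" by fastforce
    then have ij: "(i, j) \<in> E" "(i, j) \<noteq> (x, y)" using that by auto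
    consider "i = x" "j \<noteq> y" | "j = y" "i \<noteq> x" | "i = y" | "j = x" | "i \<noteq> x" "i \<noteq> y" "j \<noteq> x" "j \<noteq> y"
      using ij(2) by blast
    then show ?thesis
    proof cases
      case 1
      then show ?thesis using from_x[of j] ij p by (auto simp: \<phi>_def split: if_splits)
    next
      case 2
      then show ?thesis using to_y[of i] ij p by (auto simp: \<phi>_def split: if_splits)
    next
      case 3
      then show ?thesis using down(1)[of j] ij p lt lt_E[OF ij(1)] by (auto simp: \<phi>_def)
    next
      case 4
      then show ?thesis using up(1)[of i] ij p lt lt_E[OF ij(1)] by (auto simp: \<phi>_def)
    next
      case 5
      then show ?thesis using other[of i j] ij p by (auto simp: \<phi>_def)
    qed
  qed
  then have "S1 \<subseteq> cover_pairs n v" unfolding S1_def by blast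
  moreover have "S2 \<subseteq> cover_pairs n v" "S3 \<subseteq> cover_pairs n v"
    using up(2) down(2) unfolding S2_def S3_def U_def D_def E_def by auto
  ultimately have sub: "S1 \<union> S2 \<union> S3 \<subseteq> cover_pairs n v" by blast
  have inj: "inj_on \<phi> (E - {(x, y)})"
  proof (rule inj_onI)
    fix p q assume "p \<in> E - {(x, y)}" "q \<in> E - {(x, y)}" and eq: "\<phi> p = \<phi> q"
    then obtain i j k l where p: "p = (i, j)" "(i, j) \<in> E" "(i, j) \<noteq> (x, y)"
      and q: "q = (k, l)" "(k, l) \<in> E" "(k, l) \<noteq> (x, y)" by (metis DiffE insertCI prod.exhaust)
    show "p = q"
      using eq not_x[of j] not_x[of l] not_y[of i] not_y[of k] lt lt_E[OF p(2)] lt_E[OF q(2)] p q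
      unfolding \<phi>_def by (auto split: if_splits)
  qed
  have disj1: "S1 \<inter> S2 = {}"
    using lt not_y lt_E unfolding S1_def S2_def U_def E_def[symmetric] \<phi>_def by (fastforce split: if_splits)
  have disj2: "(S1 \<union> S2) \<inter> S3 = {}"
    using lt not_x not_y lt_E unfolding S1_def S2_def S3_def U_def D_def E_def[symmetric] \<phi>_def
    by (fastforce split: if_splits)
  have "card S1 + card S2 + card S3 = card (S1 \<union> S2 \<union> S3)"
    using disj1 disj2 fin finU finD by (subst card_Un_disjoint; simp add: S1_def S2_def S3_def card_Un_disjoint)
  also have "\<dots> \<le> card (cover_pairs n v)" using sub by (intro card_mono) auto
  also have "card S1 = card E - 1" using card_image[OF inj] xy fin by (simp add: S1_def E_def)
  also have "card S2 = card U" by (simp add: S2_def card_image inj_on_def)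
  also have "card S3 = card D" by (simp add: S3_def card_image inj_on_def)
  finally have "card E - 1 + card U + card D \<le> card (cover_pairs n v)" .
  moreover have "card E \<noteq> 0" using xy fin by (auto simp: E_def)
  ultimately show ?thesis unfolding E_def v_def by linarith
qed

section \<open>Covers in finite orders\<close>

locale finite_strict_order =
  fixes A :: "'a set" and lt :: "'a \<Rightarrow> 'a \<Rightarrow> bool"
  assumes finite: "finite A"
    and irrefl: "\<not> lt x x"
    and trans: "lt x y \<Longrightarrow> lt y z \<Longrightarrow> lt x z"
begin

definition cov :: "'a \<Rightarrow> 'a \<Rightarrow> bool" where
  "cov y x \<longleftrightarrow> lt y x \<and> \<not> (\<exists>z\<in>A. lt y z \<and> lt z x)"

definition Up :: "'a \<Rightarrow> 'a set" where "Up x = {u \<in> A. cov x u}"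

definition Down :: "'a \<Rightarrow> 'a set" where "Down y = {d \<in> A. cov d y}"

text \<open>For the inversion order, \<open>k\<close> is a lower bound for the correction at the
  coatom given by the edge between \<open>x\<close> and \<open>y\<close>: it counts the additional
  edges in \<open>card_cover_pairs_swap\<close>.\<close>

definition heavy :: "nat \<Rightarrow> bool" where
  "heavy k \<longleftrightarrow> (\<exists>x\<in>A. \<exists>y\<in>A. cov y x \<and> k \<le> card (Up x) + card (Down y))"

lemma heavyI: "x \<in> A \<Longrightarrow> y \<in> A \<Longrightarrow> cov y x \<Longrightarrow> k \<le> card (Up x) + card (Down y) \<Longrightarrow> heavy k"
  unfolding heavy_def by blast

lemma finite_Up [simp]: "finite (Up x)" and finite_Down [simp]: "finite (Down x)"
  using finite by (simp_all add: Up_def Down_def)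

definition height :: "'a \<Rightarrow> nat" where "height x = card {z \<in> A. lt z x}"

lemma height_mono: "x \<in> A \<Longrightarrow> lt x y \<Longrightarrow> height x < height y"
  unfolding height_def using finite irrefl by (intro psubset_card_mono) (auto dest: trans)

lemma dual: "finite_strict_order A (\<lambda>x y. lt y x)"
  by unfold_locales (auto simp: finite irrefl dest: trans)

lemma dual_cov: "finite_strict_order.cov A (\<lambda>x y. lt y x) y x = cov x y"
  by (auto simp: finite_strict_order.cov_def[OF dual] cov_def)

lemma dual_heavy: "finite_strict_order.heavy A (\<lambda>x y. lt y x) k = heavy k"
  unfolding finite_strict_order.heavy_def[OF dual] heavy_def
    finite_strict_order.Up_def[OF dual] finite_strict_order.Down_def[OF dual] Up_def Down_def dual_cov
  by (auto simp: add.commute)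

lemma cov_above:
  assumes "x \<in> A" "lt y x"
  obtains z where "z \<in> A" "cov y z" "z = x \<or> lt z x"
proof -
  let ?P = "\<lambda>z. z \<in> A \<and> lt y z \<and> (z = x \<or> lt z x)"
  have "?P x" using assms by simp
  then obtain z where z: "?P z" "\<And>z'. ?P z' \<Longrightarrow> height z \<le> height z'"
    using ex_has_least_nat[of ?P x height] by blast
  have "cov y z"
    using z height_mono trans unfolding cov_def by (metis leD)
  then show ?thesis using that z by blast
qed

lemma cov_below:
  assumes "y \<in> A" "lt y x"
  obtains z where "z \<in> A" "cov z x" "z = y \<or> lt y z"
proof -
  interpret d: finite_strict_order A "\<lambda>x y. lt y x" by (rule dual)
  show ?thesis using d.cov_above[of y x] assms that unfolding dual_cov by blast
qed

lemma card_Up_ge_1: "lt x u \<Longrightarrow> u \<in> A \<Longrightarrow> 1 \<le> card (Up x)"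
  by (rule cov_above[of u x]) (auto simp: Up_def Suc_le_eq card_gt_0_iff finite)

lemma card_Down_ge_1: "lt d y \<Longrightarrow> d \<in> A \<Longrightarrow> 1 \<le> card (Down y)"
  by (rule cov_below[of d y]) (auto simp: Down_def Suc_le_eq card_gt_0_iff finite)

text \<open>Take \<open>z\<close> of greatest height among the common lower bounds of
  \<open>a\<close> and \<open>b\<close> that equal or exceed \<open>c\<close>. Its covers towards
  \<open>a\<close> and \<open>b\<close> differ, since a common one would be a higher common lower
  bound.\<close>

lemma branch_above:
  assumes "c \<in> A" "a \<in> A" "b \<in> A" "lt c a" "lt c b" "a \<noteq> b" "\<not> lt a b" "\<not> lt b a"
  obtains z where "z \<in> A" "z = c \<or> lt c z" "2 \<le> card (Up z)"
proof -
  let ?P = "\<lambda>z. z \<in> A \<and> (z = c \<or> lt c z) \<and> lt z a \<and> lt z b"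
  have "?P c" using assms by simp
  moreover have "\<forall>z. ?P z \<longrightarrow> height z < Suc (height a)" using height_mono less_SucI by blast
  ultimately obtain z where z: "?P z" "\<And>z'. ?P z' \<Longrightarrow> height z' \<le> height z"
    using ex_has_greatest_nat[of ?P c height "Suc (height a)"] by blast
  obtain a' where a': "a' \<in> A" "cov z a'" "a' = a \<or> lt a' a" using cov_above z assms by blast
  obtain b' where b': "b' \<in> A" "cov z b'" "b' = b \<or> lt b' b" using cov_above z assms by blast
  have "a' \<noteq> b'"
  proof
    assume eq: "a' = b'"
    then have "?P a'" using a' b' z assms trans unfolding cov_def by metis
    moreover have "height z < height a'" using a' z height_mono unfolding cov_def by blast
    ultimately show False using z by (metis leD)
  qed
  then have "card {a', b'} = 2" by simp
  moreover have "{a', b'} \<subseteq> Up z" using a' b' by (simp add: Up_def)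
  then have "card {a', b'} \<le> card (Up z)" by (intro card_mono) simp_all
  ultimately have "2 \<le> card (Up z)" by simp
  then show ?thesis using that z(1) by blast
qed

lemma heavy_chain3:
  assumes "a \<in> A" "b \<in> A" "c \<in> A" "lt b a" "lt c b"
  shows "heavy 1"
proof -
  obtain y where y: "y \<in> A" "cov y b" using cov_below assms by blast
  moreover have "1 \<le> card (Up b)" using card_Up_ge_1 assms by blast
  ultimately show ?thesis using assms by (intro heavyI[of b y]) auto
qed

lemma heavy_chain4:
  assumes "a \<in> A" "b \<in> A" "c \<in> A" "d \<in> A" "lt b a" "lt c b" "lt d c"
  shows "heavy 2"
proof -
  obtain y where y: "y \<in> A" "cov y b" "y = c \<or> lt c y" using cov_below assms by blast
  then have "lt d y" using assms trans by blast
  then have "1 \<le> card (Down y)" using card_Down_ge_1 assms by blast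
  moreover have "1 \<le> card (Up b)" using card_Up_ge_1 assms by blast
  ultimately show ?thesis using assms y by (intro heavyI[of b y]) auto
qed

lemma heavy_fork4:
  assumes "a \<in> A" "b \<in> A" "c \<in> A" "d \<in> A" "a \<noteq> b" "\<not> lt a b" "\<not> lt b a"
    "lt c a" "lt c b" "lt d c"
  shows "heavy 2"
proof -
  obtain z where z: "z \<in> A" "z = c \<or> lt c z" "2 \<le> card (Up z)" using branch_above assms by blast
  then have "lt d z" using assms trans by blast
  then obtain y where "y \<in> A" "cov y z" using cov_below assms by blast
  then show ?thesis using z by (intro heavyI[of z y]) auto
qed

text \<open>The branch point supplies two upper covers. The edge going down from it towards
  \<open>d\<close> ends at a point still above \<open>e\<close>, which supplies the third.\<close>

lemma heavy_fork5:
  assumes "a \<in> A" "b \<in> A" "c \<in> A" "d \<in> A" "e \<in> A" "a \<noteq> b" "\<not> lt a b" "\<not> lt b a"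
    "lt c a" "lt c b" "lt d c" "lt e d"
  shows "heavy 3"
proof -
  obtain z where z: "z \<in> A" "z = c \<or> lt c z" "2 \<le> card (Up z)" using branch_above assms by blast
  then have "lt d z" using assms trans by blast
  then obtain y where y: "y \<in> A" "cov y z" "y = d \<or> lt d y" using cov_below assms by blast
  then have "lt e y" using assms trans by blast
  then have "1 \<le> card (Down y)" using card_Down_ge_1 assms by blast
  then show ?thesis using z y by (intro heavyI[of z y]) auto
qed

text \<open>Either the covers of \<open>d\<close> towards \<open>a\<close>, \<open>b\<close>,
  \<open>c\<close> are distinct, or two of them agree; the common one is then the stem of a fork
  with the chain \<open>d\<close>, \<open>e\<close> below it, as in
  \<open>heavy_fork5\<close>.\<close>

lemma heavy_trident:
  assumes "a \<in> A" "b \<in> A" "c \<in> A" "d \<in> A" "e \<in> A" "a \<noteq> b" "a \<noteq> c" "b \<noteq> c"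
    "\<not> lt a b" "\<not> lt b a" "\<not> lt a c" "\<not> lt c a" "\<not> lt b c" "\<not> lt c b"
    "lt d a" "lt d b" "lt d c" "lt e d"
  shows "heavy 3"
proof -
  obtain a' where a': "a' \<in> A" "cov d a'" "a' = a \<or> lt a' a" using cov_above assms by blast
  obtain b' where b': "b' \<in> A" "cov d b'" "b' = b \<or> lt b' b" using cov_above assms by blast
  obtain c' where c': "c' \<in> A" "cov d c'" "c' = c \<or> lt c' c" using cov_above assms by blast
  have same: "heavy 3" if "p \<in> A" "q \<in> A" "t \<in> A" "cov d t" "t = p \<or> lt t p" "t = q \<or> lt t q"
    "p \<noteq> q" "\<not> lt p q" "\<not> lt q p" for p q t
    using that assms(4,5,18) by (intro heavy_fork5[of p q t d e]) (auto simp: cov_def)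
  consider "a' = b'" | "a' = c'" | "b' = c'" | "a' \<noteq> b'" "a' \<noteq> c'" "b' \<noteq> c'" by blast
  then show ?thesis
  proof cases
    case 1
    then show ?thesis using same[of a b a'] a' b' assms by auto
  next
    case 2
    then show ?thesis using same[of a c a'] a' c' assms by auto
  next
    case 3
    then show ?thesis using same[of b c b'] b' c' assms by auto
  next
    case 4
    then have "card {a', b', c'} = 3" by simp
    moreover have "{a', b', c'} \<subseteq> Up d" using a' b' c' by (simp add: Up_def)
    then have "card {a', b', c'} \<le> card (Up d)" by (intro card_mono) simp_all
    moreover obtain y where "y \<in> A" "cov y d" using cov_below assms by blast
    ultimately show ?thesis using assms by (intro heavyI[of d y]) auto
  qed
qed

end

section \<open>Patterns that force large corrections\<close>

lemma inversion_order: "finite_strict_order {1..n::nat} (\<lambda>j i. i < j \<and> w j < (w i :: nat))"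
  by unfold_locales auto

definition heavy_perm :: "nat \<Rightarrow> (nat \<Rightarrow> nat) \<Rightarrow> nat \<Rightarrow> bool" where
  "heavy_perm n w k \<longleftrightarrow> (\<exists>x y. (x, y) \<in> cover_pairs n w \<and>
     k \<le> card {u. (u, x) \<in> cover_pairs n w} + card {d. (y, d) \<in> cover_pairs n w})"

lemma heavy_perm_iff:
  "heavy_perm n w = finite_strict_order.heavy {1..n} (\<lambda>j i. i < j \<and> w j < w i)"
proof -
  interpret finite_strict_order "{1..n}" "\<lambda>j i. i < j \<and> w j < w i" by (rule inversion_order)
  have c: "(i, j) \<in> cover_pairs n w \<longleftrightarrow> i \<in> {1..n} \<and> j \<in> {1..n} \<and> cov j i" for i j
    unfolding in_cover_pairs_iff cov_def by fastforce
  show ?thesis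
  proof
    fix k
    have "{u. (u, x) \<in> cover_pairs n w} = Up x" if "x \<in> {1..n}" for x
      unfolding Up_def c using that by blast
    moreover have "{d. (y, d) \<in> cover_pairs n w} = Down y" if "y \<in> {1..n}" for y
      unfolding Down_def c using that by blast
    ultimately show "heavy_perm n w k = heavy k"
      unfolding heavy_perm_def heavy_def c by (metis (no_types, lifting))
  qed
qed

lemma heavy_321:
  assumes "i \<in> {1..n}" "k \<in> {1..n}" "i < j" "j < k" "w j < w i" "w k < w j"
  shows "heavy_perm n w 1"
  unfolding heavy_perm_iff
  using assms by (intro finite_strict_order.heavy_chain3[OF inversion_order, of i n j k]) auto

lemma heavy_4321:
  assumes "i \<in> {1..n}" "l \<in> {1..n}" "i < j" "j < k" "k < l" "w j < w i" "w k < w j" "w l < w k"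
  shows "heavy_perm n w 2"
  unfolding heavy_perm_iff
  using assms by (intro finite_strict_order.heavy_chain4[OF inversion_order, of i n j k l]) auto

lemma heavy_3421:
  assumes "i \<in> {1..n}" "l \<in> {1..n}" "i < j" "j < k" "k < l" "w i < w j" "w k < w i" "w l < w k"
  shows "heavy_perm n w 2"
  unfolding heavy_perm_iff
  using assms by (intro finite_strict_order.heavy_fork4[OF inversion_order, of i n j k l]) auto

lemma heavy_45321:
  assumes "i \<in> {1..n}" "m \<in> {1..n}" "i < j" "j < k" "k < l" "l < m"
    "w i < w j" "w k < w i" "w l < w k" "w m < w l"
  shows "heavy_perm n w 3"
  unfolding heavy_perm_iff
  using assms by (intro finite_strict_order.heavy_fork5[OF inversion_order, of i n j k l m]) auto

lemma heavy_34521: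
  assumes "i \<in> {1..n}" "m \<in> {1..n}" "i < j" "j < k" "k < l" "l < m"
    "w i < w j" "w j < w k" "w l < w i" "w m < w l"
  shows "heavy_perm n w 3"
  unfolding heavy_perm_iff
  using assms by (intro finite_strict_order.heavy_trident[OF inversion_order, of i n j k l m]) auto

text \<open>Turning the order upside down preserves \<open>heavy\<close>, so patterns branching at
  the bottom reduce to the upward forks and the trident.\<close>

lemma heavy_perm_dual:
  "heavy_perm n w = finite_strict_order.heavy {1..n} (\<lambda>i j. i < j \<and> w j < w i)"
  unfolding heavy_perm_iff
  by (rule ext, subst finite_strict_order.dual_heavy[OF inversion_order, symmetric]) simp

lemma inversion_order_dual: "finite_strict_order {1..n::nat} (\<lambda>i j. i < j \<and> w j < (w i :: nat))"
  by unfold_locales auto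

lemma heavy_4312:
  assumes "i \<in> {1..n}" "l \<in> {1..n}" "i < j" "j < k" "k < l" "w j < w i" "w k < w l" "w l < w j"
  shows "heavy_perm n w 2"
  unfolding heavy_perm_dual
  using assms by (intro finite_strict_order.heavy_fork4[OF inversion_order_dual, of k n l j i]) auto

lemma heavy_54312:
  assumes "i \<in> {1..n}" "m \<in> {1..n}" "i < j" "j < k" "k < l" "l < m"
    "w j < w i" "w k < w j" "w l < w m" "w m < w k"
  shows "heavy_perm n w 3"
  unfolding heavy_perm_dual
  using assms by (intro finite_strict_order.heavy_fork5[OF inversion_order_dual, of l n m k j i]) auto

lemma heavy_54123:
  assumes "i \<in> {1..n}" "m \<in> {1..n}" "i < j" "j < k" "k < l" "l < m"
    "w j < w i" "w k < w l" "w l < w m" "w m < w j"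
  shows "heavy_perm n w 3"
  unfolding heavy_perm_dual
  using assms by (intro finite_strict_order.heavy_trident[OF inversion_order_dual, of k n l m j i]) auto

section \<open>Comparison of the two maxima\<close>

text \<open>Both sets complete the entries with \<open>a \<le> p\<close> and
  \<open>w a \<le> p\<close> to a set of \<open>p + 1\<close> elements, counted once by positions
  and once by values.\<close>

lemma card_crossings:
  assumes w: "bij w"
  shows "card {a. a \<le> p \<and> p < w a} = card {b. p < b \<and> w b \<le> (p::nat)}"
proof -
  define M where "M = {a. a \<le> p \<and> w a \<le> p}"
  define L where "L = {a. a \<le> p \<and> p < w a}"
  define R where "R = {b. p < b \<and> w b \<le> p}"
  have pre: "w -` {..p} = R \<union> M" by (auto simp: R_def M_def)
  have "finite (w -` {..p})" using w by (intro finite_vimageI) (auto simp: bij_def)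
  then have fin: "finite R" "finite M" "finite L" unfolding pre by (auto simp: L_def)
  have "card (w -` {..p}) = card {..p}"
    using w by (intro card_vimage_inj) (auto simp: bij_def)
  then have "card R + card M = card {..p}"
    unfolding pre using fin by (subst (asm) card_Un_disjoint) (auto simp: R_def M_def)
  moreover have "{..p} = L \<union> M" by (auto simp: L_def M_def)
  then have "card L + card M = card {..p}"
    using fin by (simp only:, subst card_Un_disjoint) (auto simp: L_def M_def)
  ultimately show ?thesis unfolding L_def R_def by linarith
qed

lemma two_elements:
  assumes "x \<in> S" "y \<in> S" "x \<noteq> y" "card S = card T" "finite S"
  obtains a b :: nat where "a \<in> T" "b \<in> T" "a < b"
proof -
  have "card {x, y} \<le> card S" using assms by (intro card_mono) auto
  then have "\<not> card T \<le> Suc 0" using assms by simp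
  moreover from this have "finite T" using card.infinite by fastforce
  ultimately obtain a b where "a \<in> T" "b \<in> T" "a \<noteq> b" using card_le_Suc0_iff_eq by blast
  then show ?thesis using that by (metis linorder_neqE_nat)
qed

lemma permutes_moved_mem:
  assumes "w permutes S" "w a \<noteq> a"
  shows "a \<in> S"
  using assms permutes_not_in by metis

lemma finite_crossings:
  assumes "bij w" shows "finite {b. p < b \<and> w b \<le> (p::nat)}"
proof -
  have "finite (w -` {..p})" using assms by (intro finite_vimageI) (auto simp: bij_def)
  then show ?thesis by (rule rev_finite_subset) auto
qed

text \<open>A doubled index forces a 321. If \<open>p\<close> is fixed, \<open>a\<close>,
  \<open>p\<close>, \<open>b\<close> is one. Otherwise the entry at \<open>p\<close> is a second one
  crossing a cut next to \<open>p\<close>, so two entries also cross in the opposite direction, and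
  a 321 is missing only if the four form a 3412.\<close>

lemma doubled_heavy_1:
  assumes w: "w permutes {1..n}" and av: "no_3412 w {1..n}" and p: "doubled w p"
  shows "heavy_perm n w 1"
proof -
  note bij = permutes_bij[OF w]
  note mem = permutes_moved_mem[OF w]
  obtain a b where a: "a < p" "p < w a" and b: "p < b" "w b < p" using p by (auto simp: doubled_def)
  have mab: "a \<in> {1..n}" "b \<in> {1..n}" using a b mem[of a] mem[of b] by auto
  have neq: "w i \<noteq> w j" if "i \<noteq> j" for i j using that permutes_inj[OF w] by (simp add: inj_eq)
  consider "w p = p" | "p < w p" | "w p < p" by linarith
  then show ?thesis
  proof cases
    case 1
    then show ?thesis using heavy_321[of a n b p w] a b mab by simp
  next
    case 2
    have mp: "p \<in> {1..n}" using 2 mem[of p] by auto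
    obtain b1 b2 where b12: "b1 \<in> {b. p < b \<and> w b \<le> p}" "b2 \<in> {b. p < b \<and> w b \<le> p}" "b1 < b2"
      by (rule two_elements[of a "{a. a \<le> p \<and> p < w a}" p])
        (use a 2 card_crossings[OF bij] in auto)
    then have mb: "b1 \<in> {1..n}" "b2 \<in> {1..n}" using mem[of b1] mem[of b2] by auto
    consider "w b2 < w b1" | "w p < w a" | "w b1 < w b2" "w a < w p"
      using neq[of b1 b2] neq[of a p] a b12 by force
    then show ?thesis
    proof cases
      case 1
      then show ?thesis using heavy_321[of a n b2 b1 w] a b12 mab mb by auto
    next
      case 2
      then show ?thesis using heavy_321[of a n b p w] \<open>p < w p\<close> a b mab by auto
    next
      case 3
      then show ?thesis using no_3412D[OF av mab(1) mp mb] a b12 by auto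
    qed
  next
    case 3
    have mp: "p \<in> {1..n}" using 3 mem[of p] by auto
    \<comment> \<open>Now the entries at \<open>p\<close> and \<open>b\<close> both cross the cut
      just before \<open>p\<close>, so the mirrored argument runs at \<open>p - 1\<close>.\<close>
    define q where "q = p - 1"
    have pq: "p = Suc q" using 3 by (simp add: q_def)
    have "p \<in> {b. q < b \<and> w b \<le> q}" "b \<in> {b. q < b \<and> w b \<le> q}" "p \<noteq> b"
      using b 3 by (auto simp: pq)
    then obtain a1 a2 where a12: "a1 \<in> {a. a \<le> q \<and> q < w a}" "a2 \<in> {a. a \<le> q \<and> q < w a}" "a1 < a2"
      by (rule two_elements[OF _ _ _ card_crossings[OF bij, symmetric] finite_crossings[OF bij]])
    then have ma: "a1 \<in> {1..n}" "a2 \<in> {1..n}" using mem[of a1] mem[of a2] by auto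
    consider "w a2 < w a1" | "w b < w p" | "w a1 < w a2" "w p < w b"
      using neq[of a1 a2] neq[of b p] b a12 by force
    then show ?thesis
    proof cases
      case 1
      then show ?thesis using heavy_321[of a1 n b a2 w] b a12 mab ma by (auto simp: pq)
    next
      case 2
      then show ?thesis using heavy_321[of a n b p w] \<open>w p < p\<close> a b mab by auto
    next
      case 3
      then show ?thesis using no_3412D[OF av ma mp mab(2)] b a12 by (auto simp: pq)
    qed
  qed
qed

text \<open>Two entries crossing the cut at \<open>p\<close> in each direction form 4321, 3421 or
  4312, since 3412 is excluded. If only one crosses each way, the same two entries witness both
  doubled indices, and the missing two points have to be found on either side of the cut.\<close>

lemma doubled_heavy_2:
  assumes w: "w permutes {1..n}" and av: "no_3412 w {1..n}" "no_4231 w {1..n}"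
    and p: "doubled w p" "doubled w (Suc p)"
  shows "heavy_perm n w 2"
proof -
  note bij = permutes_bij[OF w]
  note mem = permutes_moved_mem[OF w]
  have neq: "w i \<noteq> w j" if "i \<noteq> j" for i j using that permutes_inj[OF w] by (simp add: inj_eq)
  define L where "L = {a. a \<le> p \<and> p < w a}"
  define R where "R = {b. p < b \<and> w b \<le> p}"
  have card: "card L = card R" unfolding L_def R_def by (rule card_crossings[OF bij])
  have fin: "finite L" "finite R" using finite_crossings[OF bij] by (auto simp: L_def R_def)
  obtain a b where a: "a < p" "p < w a" and b: "p < b" "w b < p" using p by (auto simp: doubled_def)
  obtain c d where c: "c < Suc p" "Suc p < w c" and d: "Suc p < d" "w d < Suc p"
    using p by (auto simp: doubled_def)
  have LR: "a \<in> L" "c \<in> L" "b \<in> R" "d \<in> R" using a b c d by (auto simp: L_def R_def)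
  have memLR: "x \<in> {1..n}" if "x \<in> L \<or> x \<in> R" for x
    using that mem[of x] by (auto simp: L_def R_def)
  have heavy4: "heavy_perm n w 2" if "a1 \<in> L" "a2 \<in> L" "a1 < a2" "b1 \<in> R" "b2 \<in> R" "b1 < b2"
    for a1 a2 b1 b2
  proof -
    have m: "a1 \<in> {1..n}" "a2 \<in> {1..n}" "b1 \<in> {1..n}" "b2 \<in> {1..n}" using that memLR by auto
    have lt: "a1 < a2" "a2 < b1" "b1 < b2" "w b1 < w a1" "w b2 < w a1" "w b1 < w a2" "w b2 < w a2"
      using that by (auto simp: L_def R_def)
    consider "w a2 < w a1" "w b2 < w b1" | "w a1 < w a2" "w b2 < w b1"
      | "w a2 < w a1" "w b1 < w b2" | "w a1 < w a2" "w b1 < w b2"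
      using neq[of a1 a2] neq[of b1 b2] lt by (metis less_irrefl linorder_neqE_nat)
    then show ?thesis
      by cases (use heavy_4321[OF m(1,4) lt(1-3)] heavy_3421[OF m(1,4) lt(1-3)]
        heavy_4312[OF m(1,4) lt(1-3)] no_3412D[OF av(1) m lt(1-3)] lt in auto)
  qed
  show ?thesis
  proof (cases "\<exists>x\<in>L. \<exists>y\<in>L. x \<noteq> y")
    case True
    then obtain x y where xy: "x \<in> L" "y \<in> L" "x \<noteq> y" by blast
    obtain a1 a2 where "a1 \<in> L" "a2 \<in> L" "a1 < a2"
      by (rule two_elements[OF xy refl fin(1)])
    moreover obtain b1 b2 where "b1 \<in> R" "b2 \<in> R" "b1 < b2"
      by (rule two_elements[OF xy card fin(1)])
    ultimately show ?thesis using heavy4 by blast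
  next
    case False
    have onlyL: "x = a" if "x \<in> L" for x using False LR that by blast
    have onlyR: "x = b" if xR: "x \<in> R" for x
    proof (rule ccontr)
      assume "x \<noteq> b"
      then obtain a1 a2 where "a1 \<in> L" "a2 \<in> L" "a1 < a2"
        by (rule two_elements[OF xR LR(3) _ card[symmetric] fin(2)])
      then show False using False by (metis less_irrefl)
    qed
    have a': "Suc p < w a" and b': "Suc p < b" using onlyL[OF LR(2)] onlyR[OF LR(4)] c d by auto
    have ma: "a \<in> {1..n}" and mb: "b \<in> {1..n}" using LR memLR by auto
    have wp: "w p \<le> p" using onlyL[of p] a by (force simp: L_def)
    have wp': "Suc p \<le> w (Suc p)" using onlyR[of "Suc p"] b' by (force simp: R_def)
    have mp: "p \<in> {1..n}" "Suc p \<in> {1..n}" using ma mb a b' by auto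
    \<comment> \<open>Fixed \<open>p\<close> and \<open>Suc p\<close> would give a 4231 with
      \<open>a\<close> and \<open>b\<close>. Otherwise \<open>p\<close> with the place
      \<open>g\<close> of the value \<open>p\<close>, or \<open>Suc p\<close> with the place
      \<open>h\<close> of the value \<open>Suc p\<close>, joins \<open>a\<close> and
      \<open>b\<close> to form one of the four patterns above.\<close>
    consider "w p = p" "w (Suc p) = Suc p" | "w p < p" | "Suc p < w (Suc p)" using wp wp' by linarith
    then show ?thesis
    proof cases
      case 1
      then show ?thesis using no_4231D[OF av(2) ma mp mb] a b a' b' by auto
    next
      case 2
      obtain g where g: "w g = p" using permutes_surj[OF w] by (metis surjD)
      have "\<not> p < g" using onlyR[of g] g b by (force simp: R_def)
      moreover have "g \<noteq> p" using g 2 by auto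
      ultimately have gp: "g < p" by simp
      have mg: "g \<in> {1..n}" using mem[of g] g gp by simp
      consider "a < g" "w b < w p" | "a < g" "w p < w b" | "g < a" "w b < w p" | "g < a" "w p < w b"
        using neq[of b p] b g a by (metis less_irrefl linorder_neqE_nat)
      then show ?thesis
        by cases (use heavy_4321[OF ma mb, of g p w] heavy_4312[OF ma mb, of g p w]
          heavy_3421[OF mg mb, of a p w] no_3412D[OF av(1) mg ma mp(1) mb] a b 2 g gp in auto)
    next
      case 3
      obtain h where h: "w h = Suc p" using permutes_surj[OF w] by (metis surjD)
      have "\<not> h \<le> p" using onlyL[of h] h a' by (force simp: L_def)
      moreover have "h \<noteq> Suc p" using h 3 by auto
      ultimately have hp: "Suc p < h" by simp
      have mh: "h \<in> {1..n}" using mem[of h] h hp by simp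
      consider "h < b" "w (Suc p) < w a" | "b < h" "w (Suc p) < w a"
        | "h < b" "w a < w (Suc p)" | "b < h" "w a < w (Suc p)"
        using neq[of a "Suc p"] b h a by (metis Suc_lessD less_irrefl linorder_neqE_nat not_less_eq)
      then show ?thesis
        by cases (use heavy_4321[OF ma mb, of "Suc p" h w] heavy_4312[OF ma mh, of "Suc p" b w]
          heavy_3421[OF ma mb, of "Suc p" h w] no_3412D[OF av(1) ma mp(2) mb mh] a b a' b' 3 h hp in auto)
    qed
  qed
qed

lemma heavy_perm_0:
  assumes w: "w permutes {1..n}" and ne: "w \<noteq> id"
  shows "heavy_perm n w 0"
proof -
  obtain i where i: "i \<in> {1..n}" "Suc i \<in> {1..n}" "w (Suc i) < w i"
    using descent_exists assms by blast
  then have "(i, Suc i) \<in> cover_pairs n w" by (auto simp: in_cover_pairs_iff)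
  then show ?thesis unfolding heavy_perm_def by blast
qed

section \<open>Bounds for the two maxima\<close>

lemma finite_rank_set [simp]: "finite (rank_set n w k)"
  by (simp add: rank_set_def)

lemma le_max_over: "finite A \<Longrightarrow> u \<in> A \<Longrightarrow> f u \<le> max_over A f"
  by (auto simp: max_over_def)

lemma max_over_le: "finite A \<Longrightarrow> (\<And>u. u \<in> A \<Longrightarrow> f u \<le> c) \<Longrightarrow> max_over A f \<le> c"
  by (auto simp: max_over_def)

text \<open>There are at least as many edges as generators in the support; the swap loses one edge,
  hence the \<open>+ 1\<close>, and gains at least \<open>k\<close>.\<close>

lemma heavy_perm_le_max_ddeg:
  assumes w: "w permutes {1..n}" and av: "no_3412 w {1..n}" "no_4231 w {1..n}"
    and k: "heavy_perm n w k"
  shows "card (supp n w) + k \<le> max_over (rank_set n w (perm_length n w - 1)) (ddeg n w) + 1"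
proof -
  obtain x y where xy: "(x, y) \<in> cover_pairs n w"
    "k \<le> card {u. (u, x) \<in> cover_pairs n w} + card {d. (y, d) \<in> cover_pairs n w}"
    using k by (auto simp: heavy_perm_def)
  define v where "v = w \<circ> transpose x y"
  have v: "v \<in> rank_set n w (perm_length n w - 1)"
    unfolding v_def by (rule cover_pairs_coatom[OF w xy(1)])
  have "card (supp n w) + k \<le> card (cover_pairs n v) + 1"
    using card_supp_le[OF w] card_cover_pairs_swap[OF permutes_inj[OF w] av xy(1)] xy(2)
    unfolding v_def by linarith
  also have "card (cover_pairs n v) \<le> ddeg n w v"
    using v by (intro card_cover_pairs_le_ddeg) (simp add: rank_set_def)
  also have "ddeg n w v \<le> max_over (rank_set n w (perm_length n w - 1)) (ddeg n w)"
    using v by (intro le_max_over) auto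
  finally show ?thesis by simp
qed

lemma udeg_atom_le:
  assumes w: "w permutes {1..n}" and av: "no_3412 w {1..n}" "no_4231 w {1..n}"
    and ne: "w \<noteq> id" and u: "u \<in> rank_set n w 1"
  shows "\<exists>k\<le>2. heavy_perm n w k \<and> udeg n w u + 1 \<le> card (supp n w) + k"
proof -
  have uw: "u \<in> lower_interval n w" and up: "u permutes {1..n}" and len: "perm_length n u = 1"
    using u by (auto simp: rank_set_def lower_interval_def bruhat_le_def)
  obtain i where i: "i \<in> {1..n}" "Suc i \<in> {1..n}" "u = transpose i (Suc i)"
    using perm_length_1E up len by blast
  have le: "udeg n w u + 1 \<le> card (supp n w) + of_bool (doubled w i) + of_bool (doubled w (Suc i))"
    using udeg_simple_le[OF w i(3) i(1,2) uw] .
  consider "doubled w i" "doubled w (Suc i)" | "doubled w i \<noteq> doubled w (Suc i)"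
    | "\<not> doubled w i" "\<not> doubled w (Suc i)" by blast
  then show ?thesis
  proof cases
    case 1
    then show ?thesis using doubled_heavy_2[OF w av] le by (intro exI[of _ 2]) auto
  next
    case 2
    then have "heavy_perm n w 1" using doubled_heavy_1[OF w av(1)] by blast
    then show ?thesis using 2 le by (intro exI[of _ 1]) auto
  next
    case 3
    then show ?thesis using heavy_perm_0[OF w ne] le by (intro exI[of _ 0]) auto
  qed
qed

lemma max_udeg_le_max_ddeg:
  assumes "w permutes {1..n}" "no_3412 w {1..n}" "no_4231 w {1..n}" "w \<noteq> id"
  shows "max_over (rank_set n w 1) (udeg n w) \<le> max_over (rank_set n w (perm_length n w - 1)) (ddeg n w)"
  using udeg_atom_le[OF assms] heavy_perm_le_max_ddeg[OF assms(1-3)]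
  by (intro max_over_le) force+

text \<open>Only two neighbouring pairs can be doubled, so no atom exceeds
  \<open>card (supp n w) + 1\<close>, while some coatom reaches
  \<open>card (supp n w) + 2\<close>.\<close>

lemma max_udeg_less_max_ddeg:
  assumes "w permutes {1..n}" "no_3412 w {1..n}" "no_4231 w {1..n}" "w \<noteq> id" "heavy_perm n w 3"
  shows "max_over (rank_set n w 1) (udeg n w) < max_over (rank_set n w (perm_length n w - 1)) (ddeg n w)"
proof -
  have "max_over (rank_set n w 1) (udeg n w) \<le> card (supp n w) + 1"
    using udeg_atom_le[OF assms(1-4)] by (intro max_over_le) force+
  then show ?thesis using heavy_perm_le_max_ddeg[OF assms(1-3,5)] by simp
qed

section \<open>Order reversing involutions\<close>

text \<open>All conditions are local, on single steps, so no Bruhat comparison has to be decided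
  while gluing; that \<open>X\<close> is the interval below \<open>w\<close> follows afterwards. The
  ground set varies because the recursion works with \<open>{q..n}\<close>.\<close>

definition reversal :: "nat set \<Rightarrow> (nat \<Rightarrow> nat) set \<Rightarrow> ((nat \<Rightarrow> nat) \<Rightarrow> nat \<Rightarrow> nat) \<Rightarrow> (nat \<Rightarrow> nat) \<Rightarrow> bool" where
  "reversal S X f w \<longleftrightarrow> (\<forall>u\<in>X. u permutes S) \<and> id \<in> X \<and>
     (\<forall>u\<in>X. \<forall>i j. i < j \<and> u j < u i \<longrightarrow> u \<circ> transpose i j \<in> X) \<and>
     (\<forall>u\<in>X. f u \<in> X \<and> f (f u) = u) \<and>
     (\<forall>u\<in>X. \<forall>v\<in>X. ustep u v \<longrightarrow> ustep (f v) (f u)) \<and> f id = w"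

lemma reversalD:
  assumes "reversal S X f w"
  shows "u \<in> X \<Longrightarrow> u permutes S" "id \<in> X"
    "u \<in> X \<Longrightarrow> i < j \<Longrightarrow> u j < u i \<Longrightarrow> u \<circ> transpose i j \<in> X"
    "u \<in> X \<Longrightarrow> f u \<in> X" "u \<in> X \<Longrightarrow> f (f u) = u"
    "u \<in> X \<Longrightarrow> v \<in> X \<Longrightarrow> ustep u v \<Longrightarrow> ustep (f v) (f u)" "f id = w"
  using assms unfolding reversal_def by auto

lemma reversal_path:
  assumes r: "reversal {1..n} X f w" and y: "y \<in> X" and xy: "bruhat_le n x y"
  shows "x \<in> X \<and> bruhat_le n (f y) (f x)"
proof -
  have "(bruhat_step n)\<^sup>*\<^sup>* x y" using xy by (simp add: bruhat_le_iff)
  then show ?thesis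
  proof (induction rule: converse_rtranclp_induct)
    case base
    then show ?case using y reversalD(1,4)[OF r] by (simp add: bruhat_le_def)
  next
    case (step x z)
    then have z: "z \<in> X" "bruhat_le n (f y) (f z)" and s: "ustep x z" by (auto simp: bruhat_step_iff)
    then obtain i j where ij: "i < j" "x i < x j" "z = x \<circ> transpose i j" by (auto simp: ustep_def)
    have "z \<circ> transpose i j \<in> X" using ij by (intro reversalD(3)[OF r z(1)]) auto
    then have x: "x \<in> X" by (simp add: ij comp_assoc)
    have "bruhat_step n (f z) (f x)"
      using reversalD(1,4,6)[OF r] x z(1) s by (simp add: bruhat_step_iff)
    then show ?case using x z(2) by (auto simp: bruhat_le_iff)
  qed
qed

text \<open>Each \<open>f u\<close> is above the identity; applying \<open>f\<close> puts
  \<open>u\<close> below \<open>f id = w\<close>.\<close>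

lemma reversal_lower_interval:
  assumes r: "reversal {1..n} X f w"
  shows "X = lower_interval n w"
proof (intro equalityI subsetI)
  fix u assume u: "u \<in> X"
  have "bruhat_le n id (f u)" using u reversalD(1,4)[OF r] by (intro id_bruhat_le) auto
  then have "bruhat_le n (f (f u)) (f id)" using reversal_path[OF r] reversalD(4)[OF r u] by blast
  then show "u \<in> lower_interval n w" using reversalD(5,7)[OF r] u by (simp add: lower_interval_def)
next
  fix u assume "u \<in> lower_interval n w"
  moreover have "w \<in> X" using reversalD(2,4,7)[OF r] by auto
  ultimately show "u \<in> X" using reversal_path[OF r] by (simp add: lower_interval_def)
qed

lemma reversal_self_dual:
  assumes r: "reversal {1..n} X f w"
  shows "self_dual (lower_interval n w) (bruhat_le n)"
  unfolding self_dual_def reversal_lower_interval[OF r, symmetric]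
proof (intro exI[of _ f] conjI ballI)
  show "bij_betw f X X"
    using reversalD(4,5)[OF r] by (intro bij_betw_byWitness[of _ f]) auto
  fix x y assume "x \<in> X" "y \<in> X"
  then show "bruhat_le n x y \<longleftrightarrow> bruhat_le n (f y) (f x)"
    using reversal_path[OF r] reversalD(4,5)[OF r] by metis
qed

section \<open>Gluing a block of generators to a reversal\<close>

lemma comp_transpose_bij:
  assumes "bij a"
  shows "a \<circ> transpose i j = transpose (a i) (a j) \<circ> a"
  using assms by (auto simp: fun_eq_iff transpose_def bij_def inj_eq)

lemma permutes_Int:
  assumes "z permutes A" "z permutes B"
  shows "z permutes (A \<inter> B)"
  using assms unfolding permutes_def by auto

lemma permutes_order_outside:
  assumes "g permutes {p..n::nat}" "\<not> (p \<le> x \<and> p \<le> y)"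
  shows "g x < g y \<longleftrightarrow> x < y"
proof -
  have g1: "z < p \<Longrightarrow> g z = z" for z using permutes_not_in[OF assms(1), of z] by simp
  have g2: "p \<le> g z" if "p \<le> z" for z
    using that permutes_not_in[OF assms(1), of z] permutes_in_image[OF assms(1), of z]
    by (cases "z \<le> n") auto
  show ?thesis
    using assms(2) g1[of x] g1[of y] g2[of x] g2[of y] by (cases "x < p"; cases "y < p") auto
qed

lemma permutes_inversion_mem:
  assumes "a permutes {q..b::nat}" "i < j" "a j < a i"
  shows "i \<in> {q..b}" "j \<in> {q..b}"
proof -
  have a: "z \<notin> {q..b} \<Longrightarrow> a z = z" "z \<in> {q..b} \<Longrightarrow> a z \<in> {q..b}" for z
    using permutes_not_in[OF assms(1), of z] permutes_in_image[OF assms(1), of z] by auto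
  show "i \<in> {q..b}" using a[of i] a[of j] assms(2,3) by (cases "j \<in> {q..b}"; cases "i \<in> {q..b}") auto
  show "j \<in> {q..b}" using a[of i] a[of j] assms(2,3) by (cases "j \<in> {q..b}"; cases "i \<in> {q..b}") auto
qed

lemma ustep_transpose_iff:
  assumes "inj g" "x < y"
  shows "ustep (g \<circ> transpose x y) g \<longleftrightarrow> g y < g x"
proof
  assume "ustep (g \<circ> transpose x y) g"
  then obtain k l where kl: "k < l" "(g \<circ> transpose x y) k < (g \<circ> transpose x y) l"
    "g = g \<circ> transpose x y \<circ> transpose k l" by (auto simp: ustep_def)
  have "transpose x y (transpose k l z) = z" for z
    using fun_cong[OF kl(3), of z] assms(1) by (simp add: inj_eq)
  from this[of k] this[of l] have "k = x" "l = y"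
    using kl(1) assms(2) by (auto simp: transpose_def split: if_splits)
  then show "g y < g x" using kl(2) by simp
next
  assume "g y < g x"
  then show "ustep (g \<circ> transpose x y) g" by (rule ustep_downI[OF assms(2)])
qed

text \<open>Every element of the set below is a product \<open>u2 \<circ> a\<close>, unique up to moving a permutation of
  \<open>{b'..b}\<close> between the factors. This set has at most two elements, and \<open>f2\<close> and \<open>\<phi>\<close> are
  compatible with that ambiguity.\<close>

locale gluing =
  fixes q b' b n :: nat and X2 f2 w2 \<phi>
  assumes qb: "q \<le> b'" "b' \<le> b" "b \<le> Suc b'" "b \<le> n"
    and rev2: "reversal {b'..n} X2 f2 w2"
    and eqv: "\<And>u z. u \<in> X2 \<Longrightarrow> z permutes {b'..b} \<Longrightarrow> u \<circ> z \<in> X2 \<and> f2 (u \<circ> z) = f2 u \<circ> z"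
    and \<phi>: "\<And>a. a permutes {q..b} \<Longrightarrow> \<phi> a permutes {q..b} \<and> \<phi> (\<phi> a) = a"
    and \<phi>_eqv: "\<And>a z. a permutes {q..b} \<Longrightarrow> z permutes {b'..b} \<Longrightarrow> \<phi> (z \<circ> a) = z \<circ> \<phi> a"
    and \<phi>_rev: "\<And>a i j. a permutes {q..b} \<Longrightarrow> i \<in> {q..b} \<Longrightarrow> j \<in> {q..b} \<Longrightarrow> i < j \<Longrightarrow>
      \<exists>i' j'. i' < j' \<and> \<phi> (a \<circ> transpose i j) = \<phi> a \<circ> transpose i' j' \<and>
        (if b' \<le> a i \<and> b' \<le> a j then \<phi> a i' = a i \<and> \<phi> a j' = a j
         else (a i < a j \<longleftrightarrow> \<phi> a j' < \<phi> a i') \<and> \<not> (b' \<le> \<phi> a i' \<and> b' \<le> \<phi> a j'))"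
begin

definition X where "X = {u2 \<circ> a |u2 a. u2 \<in> X2 \<and> a permutes {q..b}}"

definition F where
  "F u = (SOME v. \<exists>u2 a. u2 \<in> X2 \<and> a permutes {q..b} \<and> u = u2 \<circ> a \<and> v = f2 u2 \<circ> \<phi> a)"

lemma XI: "u2 \<in> X2 \<Longrightarrow> a permutes {q..b} \<Longrightarrow> u2 \<circ> a \<in> X"
  unfolding X_def by blast

lemma XE:
  assumes "u \<in> X"
  obtains u2 a where "u2 \<in> X2" "a permutes {q..b}" "u = u2 \<circ> a"
  using assms unfolding X_def by blast

text \<open>The discrepancy \<open>inv v \<circ> u = c \<circ> inv a\<close> permutes both
  \<open>{b'..n}\<close> and \<open>{q..b}\<close>, hence their intersection.\<close>

lemma transfer_factor:
  assumes "u permutes {b'..n}" "v permutes {b'..n}" "a permutes {q..b}" "c permutes {q..b}"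
    and eq: "u \<circ> a = v \<circ> c"
  obtains z where "z permutes {b'..b}" "u = v \<circ> z" "c = z \<circ> a"
proof -
  define z where "z = inv v \<circ> u"
  have "v \<circ> z = u" unfolding z_def using permutes_inv_o(1)[OF assms(2)] by (simp add: o_assoc)
  have "inv v \<circ> (u \<circ> a) = c" unfolding eq using permutes_inv_o(2)[OF assms(2)] by (simp add: o_assoc)
  then have za: "z \<circ> a = c" unfolding z_def by (simp add: o_assoc)
  then have "c \<circ> inv a = z" using permutes_inv_o(1)[OF assms(3)] by (auto simp: comp_assoc)
  moreover have "c \<circ> inv a permutes {q..b}" using assms permutes_inv permutes_compose by metis
  moreover have "z permutes {b'..n}" unfolding z_def using assms permutes_inv permutes_compose by metis
  ultimately have "z permutes ({b'..n} \<inter> {q..b})" by (intro permutes_Int) simp_all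
  moreover have "{b'..n} \<inter> {q..b} = {b'..b}" using qb by auto
  ultimately show ?thesis using that[of z] za \<open>v \<circ> z = u\<close> by auto
qed

text \<open>The choice in \<open>F\<close> is harmless: a discrepancy \<open>z\<close> between two
  factorizations leaves \<open>f2\<close> on the right and enters \<open>\<phi>\<close> on the
  left.\<close>

lemma F_eq:
  assumes "u2 \<in> X2" "a permutes {q..b}"
  shows "F (u2 \<circ> a) = f2 u2 \<circ> \<phi> a"
proof -
  have "\<exists>v v2 c. v2 \<in> X2 \<and> c permutes {q..b} \<and> u2 \<circ> a = v2 \<circ> c \<and> v = f2 v2 \<circ> \<phi> c"
    using assms by (intro exI[of _ "f2 u2 \<circ> \<phi> a"] exI[of _ u2] exI[of _ a]) simp
  from someI_ex[OF this] obtain v2 c where v: "v2 \<in> X2" "c permutes {q..b}" "u2 \<circ> a = v2 \<circ> c"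
    "F (u2 \<circ> a) = f2 v2 \<circ> \<phi> c" unfolding F_def by blast
  obtain z where z: "z permutes {b'..b}" "u2 = v2 \<circ> z" "c = z \<circ> a"
    using transfer_factor[OF _ _ assms(2) v(2,3)] reversalD(1)[OF rev2] assms(1) v(1) by blast
  have "f2 u2 \<circ> \<phi> a = f2 v2 \<circ> (z \<circ> \<phi> a)" using eqv[OF v(1) z(1)] z(2) by (simp add: comp_assoc)
  moreover have "z \<circ> \<phi> a = \<phi> c" using \<phi>_eqv[OF assms(2) z(1)] z(3) by simp
  ultimately show ?thesis using v(4) by metis
qed

lemma X_permutes:
  assumes "u \<in> X" shows "u permutes {q..n}"
proof -
  obtain u2 a where u: "u2 \<in> X2" "a permutes {q..b}" "u = u2 \<circ> a" using assms by (rule XE)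
  have "u2 permutes {q..n}" using reversalD(1)[OF rev2 u(1)] qb by (auto intro: permutes_subset)
  moreover have "a permutes {q..n}" using u(2) qb by (auto intro: permutes_subset)
  ultimately show ?thesis unfolding u(3) by (intro permutes_compose)
qed

lemma id_X: "id \<in> X"
  using XI[OF reversalD(2)[OF rev2] permutes_id] by simp

text \<open>A descent of \<open>a\<close> at the two positions is removed in the right factor;
  otherwise the step conjugates through \<open>a\<close> to a downward step of
  \<open>u2\<close>.\<close>

lemma X_down:
  assumes "u \<in> X" "i < j" "u j < u i"
  shows "u \<circ> transpose i j \<in> X"
proof -
  obtain u2 a where u: "u2 \<in> X2" "a permutes {q..b}" "u = u2 \<circ> a" using assms(1) by (rule XE)
  have ne: "a i \<noteq> a j" using assms(2) permutes_inj[OF u(2)] by (simp add: inj_eq)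
  show ?thesis
  proof (cases "a j < a i")
    case True
    then have "a \<circ> transpose i j permutes {q..b}"
      using permutes_comp_transpose[OF u(2)] permutes_inversion_mem[OF u(2) assms(2)] by blast
    then show ?thesis unfolding u(3) comp_assoc using u(1) by (intro XI)
  next
    case False
    then have "u2 \<circ> transpose (a i) (a j) \<in> X2"
      using ne assms(3) u(3) by (intro reversalD(3)[OF rev2 u(1)]) auto
    then have "u2 \<circ> transpose (a i) (a j) \<circ> a \<in> X" using u(2) by (rule XI)
    then show ?thesis
      unfolding u(3) comp_assoc comp_transpose_bij[OF permutes_bij[OF u(2)]] .
  qed
qed

lemma F_X:
  assumes "u \<in> X" shows "F u \<in> X" "F (F u) = u"
proof -
  obtain u2 a where u: "u2 \<in> X2" "a permutes {q..b}" "u = u2 \<circ> a" using assms by (rule XE)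
  have 1: "f2 u2 \<in> X2" "f2 (f2 u2) = u2" using reversalD(4,5)[OF rev2 u(1)] by auto
  have 2: "\<phi> a permutes {q..b}" "\<phi> (\<phi> a) = a" using \<phi>[OF u(2)] by auto
  show "F u \<in> X" "F (F u) = u"
    unfolding u(3) F_eq[OF u(1,2)] F_eq[OF 1(1) 2(1)] using XI[OF 1(1) 2(1)] 1(2) 2(2) by auto
qed

text \<open>Right multiplication by the overlap swap \<open>t\<close> commutes with
  \<open>f2\<close>, so the step between \<open>u2\<close> and \<open>u2 \<circ> t\<close> becomes
  the opposite step between \<open>f2 u2\<close> and \<open>f2 u2 \<circ> t\<close>.\<close>

lemma reverse_left_pair:
  assumes u2: "u2 \<in> X2" and xy: "x \<in> {b'..b}" "y \<in> {b'..b}" "u2 x < u2 y"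
  shows "f2 u2 y < f2 u2 x"
proof -
  define t where "t = transpose x y"
  have t: "t permutes {b'..b}" unfolding t_def using xy by (intro permutes_swap_id)
  have e: "u2 \<circ> t \<in> X2" "f2 (u2 \<circ> t) = f2 u2 \<circ> t" using eqv[OF u2 t] by auto
  have inj: "inj u2" "inj (f2 u2)" using reversalD(1)[OF rev2] reversalD(4)[OF rev2] u2 permutes_inj by blast+
  have ne: "x \<noteq> y" using xy by auto
  show ?thesis
  proof (cases "x < y")
    case True
    have "ustep u2 (u2 \<circ> t)" unfolding ustep_def t_def using True xy by blast
    then have "ustep (f2 u2 \<circ> t) (f2 u2)" using reversalD(6)[OF rev2 u2 e(1)] e(2) by simp
    then show ?thesis unfolding t_def ustep_transpose_iff[OF inj(2) True] .
  next
    case False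
    then have yx: "y < x" using ne by simp
    have "ustep (u2 \<circ> t) u2"
      unfolding t_def transpose_commute[of x y] using xy yx by (intro ustep_downI)
    then have "ustep (f2 u2) (f2 u2 \<circ> t)" using reversalD(6)[OF rev2 e(1) u2] e(2) by simp
    moreover have "inj (f2 u2 \<circ> t)" using inj(2) by (simp add: t_def inj_compose)
    moreover have "f2 u2 \<circ> t \<circ> transpose y x = f2 u2" by (simp add: t_def comp_assoc transpose_commute)
    ultimately have "(f2 u2 \<circ> t) x < (f2 u2 \<circ> t) y"
      using ustep_transpose_iff[of "f2 u2 \<circ> t" y x] yx by simp
    then show ?thesis by (simp add: t_def)
  qed
qed

text \<open>Moved to the left of \<open>a\<close>, the step swaps \<open>x\<close> and
  \<open>y\<close> between the factors. If both are at most \<open>b\<close>, it is a step of the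
  right factor: \<open>\<phi>\<close> reverses it, except that a pair inside the overlap is left to
  \<open>f2\<close>. Otherwise both are at least \<open>b'\<close>, and it is a step of
  \<open>u2\<close>.\<close>

lemma F_reverse:
  assumes "u \<in> X" "v \<in> X" "ustep u v"
  shows "ustep (F v) (F u)"
proof -
  obtain u2 a where u: "u2 \<in> X2" "a permutes {q..b}" "u = u2 \<circ> a" using assms(1) by (rule XE)
  obtain v2 c where v: "v2 \<in> X2" "c permutes {q..b}" "v = v2 \<circ> c" using assms(2) by (rule XE)
  obtain i j where ij: "i < j" "u i < u j" "v = u \<circ> transpose i j" using assms(3) by (auto simp: ustep_def)
  define x y r where "x = a i" and "y = a j" and "r = transpose x y"
  have ne: "x \<noteq> y" using ij(1) permutes_inj[OF u(2)] by (simp add: x_def y_def inj_eq)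
  have lt: "u2 x < u2 y" using ij(2) by (simp add: u(3) x_def y_def)
  have pu2: "u2 permutes {b'..n}" and pv2: "v2 permutes {b'..n}"
    using reversalD(1)[OF rev2] u(1) v(1) by auto
  have pf2: "f2 u2 permutes {b'..n}" using reversalD(1,4)[OF rev2] u(1) by auto
  have ar: "a \<circ> transpose i j = r \<circ> a"
    unfolding r_def x_def y_def by (rule comp_transpose_bij[OF permutes_bij[OF u(2)]])
  have veq: "v2 \<circ> c = u2 \<circ> r \<circ> a" using ij(3) ar unfolding u(3) v(3) by (simp add: comp_assoc)
  have mem: "i \<in> {q..n}" "j \<in> {q..n}"
    using permutes_comp_transpose_mem[of u "{q..n}" i j] X_permutes assms(1,2) ij(1,3) by auto
  have a_out: "a z = z" if "z \<notin> {q..b}" for z using permutes_not_in[OF u(2) that] .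
  have a_in: "a z \<in> {q..b} \<longleftrightarrow> z \<in> {q..b}" for z using permutes_in_image[OF u(2)] .
  have xy_mem: "x \<in> {q..n}" "y \<in> {q..n}"
    using mem a_out[of i] a_out[of j] a_in[of i] a_in[of j] qb
    by (cases "i \<in> {q..b}"; cases "j \<in> {q..b}"; force simp: x_def y_def)+
  \<comment> \<open>A swap across the overlap would leave \<open>X\<close>: \<open>a\<close> and
    \<open>c\<close> fix \<open>l\<close>, so \<open>v2\<close> would send \<open>l\<close> to
    \<open>k\<close>, which \<open>v2\<close> already fixes.\<close>
  have no_cross: False if kl: "{k, l} = {x, y}" "k < b'" "b < l" for k l
  proof -
    have r: "r l = k" unfolding r_def using kl(1) ne by (auto simp: doubleton_eq_iff)
    have hl: "a l = l" "c l = l" using a_out[of l] permutes_not_in[OF v(2), of l] kl(3) by auto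
    have "v2 l = u2 k" using fun_cong[OF veq, of l] hl r by simp
    also have "u2 k = k" using permutes_not_in[OF pu2, of k] kl(2) by simp
    also have "k = v2 k" using permutes_not_in[OF pv2, of k] kl(2) by simp
    finally have "l = k" using permutes_inj[OF pv2] by (simp add: inj_eq)
    then show False using kl qb by simp
  qed
  consider (low) "x \<le> b" "y \<le> b" | (high) "b' \<le> x" "b' \<le> y" "\<not> (x \<le> b \<and> y \<le> b)"
    using no_cross[of x y] no_cross[of y x] qb
    by (cases "x \<le> b"; cases "y \<le> b"; cases "b' \<le> x"; cases "b' \<le> y") (auto simp: not_le insert_commute)
  then show ?thesis
  proof cases
    case low
    then have xy: "x \<in> {q..b}" "y \<in> {q..b}" using xy_mem by auto
    then have ijm: "i \<in> {q..b}" "j \<in> {q..b}" using a_in by (auto simp: x_def y_def)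
    obtain i' j' where ij': "i' < j'" "\<phi> (a \<circ> transpose i j) = \<phi> a \<circ> transpose i' j'"
      and cond: "if b' \<le> x \<and> b' \<le> y then \<phi> a i' = x \<and> \<phi> a j' = y
         else (x < y \<longleftrightarrow> \<phi> a j' < \<phi> a i') \<and> \<not> (b' \<le> \<phi> a i' \<and> b' \<le> \<phi> a j')"
      using \<phi>_rev[OF u(2) ijm ij(1)] unfolding x_def y_def by blast
    have at: "a \<circ> transpose i j permutes {q..b}" by (rule permutes_comp_transpose[OF u(2) ijm])
    have "v = u2 \<circ> (a \<circ> transpose i j)" unfolding ij(3) u(3) by (simp add: comp_assoc)
    then have Fv: "F v = F u \<circ> transpose i' j'"
      using F_eq[OF u(1) at] F_eq[OF u(1,2)] ij'(2) u(3) by (simp add: comp_assoc)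
    have "f2 u2 (\<phi> a j') < f2 u2 (\<phi> a i')"
    proof (cases "b' \<le> x \<and> b' \<le> y")
      case True
      then show ?thesis using cond xy reverse_left_pair[OF u(1) _ _ lt] by auto
    next
      case False
      then have "x < y" using permutes_order_outside[OF pu2] lt by blast
      then have "\<phi> a j' < \<phi> a i'" "\<not> (b' \<le> \<phi> a j' \<and> b' \<le> \<phi> a i')" using cond False by auto
      then show ?thesis using permutes_order_outside[OF pf2] by blast
    qed
    then have "F u j' < F u i'" using F_eq[OF u(1,2)] u(3) by simp
    then show ?thesis unfolding Fv by (rule ustep_downI[OF ij'(1)])
  next
    case high
    have "x < y"
    proof (rule ccontr)
      assume "\<not> x < y"
      then have "y < x" "b < x" using ne high by auto
      then have "i = x" using a_out[of i] a_in[of i] by (auto simp: x_def)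
      then have "y = j" using \<open>b < x\<close> ij(1) a_out[of j] by (auto simp: y_def)
      then show False using \<open>i = x\<close> \<open>y < x\<close> ij(1) by simp
    qed
    then have yb: "b < y" using high by auto
    have pr: "r permutes {b'..n}" unfolding r_def using high xy_mem by (intro permutes_swap_id) auto
    have pu2r: "u2 \<circ> r permutes {b'..n}" using pr pu2 by (rule permutes_compose)
    obtain z where z: "z permutes {b'..b}" "u2 \<circ> r = v2 \<circ> z"
      using transfer_factor[OF pu2r pv2 u(2) v(2) veq[symmetric]] by blast
    have ur: "u2 \<circ> r \<in> X2" unfolding z(2) using eqv[OF v(1) z(1)] by blast
    have pfr: "f2 (u2 \<circ> r) permutes {b'..n}" using reversalD(1,4)[OF rev2] ur by auto
    have "ustep u2 (u2 \<circ> r)" unfolding ustep_def r_def using \<open>x < y\<close> lt by blast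
    then have "ustep (f2 (u2 \<circ> r)) (f2 u2)" using reversalD(6)[OF rev2 u(1) ur] by blast
    then obtain k l where kl: "k < l" "f2 (u2 \<circ> r) k < f2 (u2 \<circ> r) l"
      "f2 u2 = f2 (u2 \<circ> r) \<circ> transpose k l" by (auto simp: ustep_def)
    have klm: "k \<in> {b'..n}" "l \<in> {b'..n}"
      using permutes_comp_transpose_mem[OF pfr, of k l] kl pf2 by auto
    \<comment> \<open>The reversed step must involve a position beyond \<open>b\<close>. Otherwise
      its transposition commutes with \<open>f2\<close> and thus equals \<open>r\<close>, although
      \<open>r\<close> moves \<open>y\<close>, which exceeds \<open>b\<close>.\<close>
    have lb: "b < l"
    proof (rule ccontr)
      assume "\<not> b < l"
      then have t: "transpose k l permutes {b'..b}" using klm kl(1) by (intro permutes_swap_id) auto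
      have "f2 (u2 \<circ> r \<circ> transpose k l) = f2 u2" using eqv[OF ur t] kl(3) by simp
      then have "u2 \<circ> r \<circ> transpose k l = u2" using reversalD(5)[OF rev2] eqv[OF ur t] u(1) by metis
      then have *: "r (transpose k l z) = z" for z
        using permutes_inj[OF pu2] by (auto dest!: fun_cong[of _ _ z] simp: inj_eq)
      have "transpose k l y \<noteq> y" using *[of y] ne by (auto simp: r_def)
      then have "y = k \<or> y = l" by (auto simp: transpose_def split: if_splits)
      then show False using yb \<open>\<not> b < l\<close> kl(1) by auto
    qed
    have pa: "\<phi> a permutes {q..b}" using \<phi>[OF u(2)] by blast
    \<comment> \<open>\<open>\<phi> a\<close> preserves \<open>{q..b}\<close> and fixes
      \<open>l\<close>, so moving the transposition to its other side keeps the order of the two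
      positions.\<close>
    define g where "g = inv (\<phi> a)"
    have pg: "g permutes {q..b}" unfolding g_def by (rule permutes_inv[OF pa])
    have ag: "\<phi> a (g z) = z" for z unfolding g_def using permutes_inverses(1)[OF pa] .
    have gl: "g l = l" using permutes_not_in[OF pg, of l] lb by simp
    have gk: "g k < g l"
      using permutes_not_in[OF pg, of k] permutes_in_image[OF pg, of k] kl(1) lb gl
      by (cases "k \<in> {q..b}") auto
    have v': "v = (u2 \<circ> r) \<circ> a" using veq v(3) by simp
    have Fv: "F v = f2 (u2 \<circ> r) \<circ> \<phi> a" unfolding v' by (rule F_eq[OF ur u(2)])
    have "F u = f2 (u2 \<circ> r) \<circ> (transpose k l \<circ> \<phi> a)"
      using F_eq[OF u(1,2)] kl(3) u(3) by (simp add: comp_assoc)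
    moreover have "transpose k l \<circ> \<phi> a = \<phi> a \<circ> transpose (g k) (g l)"
      unfolding comp_transpose_bij[OF permutes_bij[OF pa]] ag ..
    ultimately have Fu: "F u = F v \<circ> transpose (g k) (g l)" unfolding Fv by (metis comp_assoc)
    show ?thesis
      unfolding ustep_def using gk Fu kl(2) by (intro exI[of _ "g k"] exI[of _ "g l"]) (simp add: Fv ag)
  qed
qed

lemma F_id: "F id = w2 \<circ> \<phi> id"
  using F_eq[OF reversalD(2)[OF rev2] permutes_id] reversalD(7)[OF rev2] by simp

theorem reversal_F: "reversal {q..n} X F (w2 \<circ> \<phi> id)"
  unfolding reversal_def
proof (intro conjI ballI allI impI)
  fix u i j assume "u \<in> X" "i < j \<and> u j < u i"
  then show "u \<circ> transpose i j \<in> X" using X_down by simp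
qed (simp_all add: X_permutes id_X F_X F_reverse F_id)

end

section \<open>Gluing by longest elements, and equivariance\<close>

lemma reversal_mono:
  assumes r: "reversal S X f w" and "S \<subseteq> S'"
  shows "reversal S' X f w"
proof -
  have "\<forall>u\<in>X. u permutes S'" using reversalD(1)[OF r] permutes_subset[OF _ assms(2)] by simp
  then show ?thesis using r unfolding reversal_def by simp
qed

text \<open>The longest element of the symmetric group on \<open>{q..b}\<close>.\<close>

definition block_flip :: "nat \<Rightarrow> nat \<Rightarrow> nat \<Rightarrow> nat" where
  "block_flip q b i = (if i \<in> {q..b} then q + b - i else i)"

lemma block_flip_flip [simp]: "block_flip q b (block_flip q b i) = i"
  by (auto simp: block_flip_def)

lemma block_flip_comp [simp]: "block_flip q b \<circ> block_flip q b = id"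
  by (simp add: fun_eq_iff)

lemma block_flip_permutes: "block_flip q b permutes {q..b}"
  by (rule bij_imp_permutes, rule bij_betw_byWitness[of _ "block_flip q b"])
    (auto simp: block_flip_def)

lemma block_flip_mem: "i \<in> {q..b} \<Longrightarrow> block_flip q b i \<in> {q..b}"
  by (auto simp: block_flip_def)

lemma block_flip_less: "i \<in> {q..b} \<Longrightarrow> j \<in> {q..b} \<Longrightarrow> block_flip q b i < block_flip q b j \<longleftrightarrow> j < i"
  by (auto simp: block_flip_def)

lemma permutes_pair_cases:
  assumes "z permutes {p..b::nat}" "b \<le> Suc p" "p \<le> b"
  shows "z = id \<or> z = transpose p b"
proof -
  have "{p..b} = {p, b}" using assms(2,3) by auto
  then show ?thesis using assms(1) permutes_doubleton_iff[of z p b] by auto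
qed

lemma transpose_comm_permutes:
  assumes "u permutes {p..n::nat}" "i < p" "j < p"
  shows "transpose i j \<circ> u = u \<circ> transpose i j"
  using comp_transpose_bij[OF permutes_bij[OF assms(1)], of i j]
    permutes_not_in[OF assms(1), of i] permutes_not_in[OF assms(1), of j] assms(2,3) by simp

text \<open>Right multiplication by the longest element reverses all pairs and commutes with the
  overlap acting on the left. A pair of values inside the overlap is already reversed by
  \<open>f2\<close>, so \<open>transpose b' b\<close> in front undoes its second reversal. For
  \<open>b' = b\<close> that factor is the identity.\<close>

lemma gluing_right:
  assumes qb: "q \<le> b'" "b' \<le> b" "b \<le> Suc b'" "b \<le> n"
    and rev2: "reversal {b'..n} X2 f2 w2"
    and eqv: "\<And>u. b' < b \<Longrightarrow> u \<in> X2 \<Longrightarrow> u \<circ> transpose b' b \<in> X2 \<and> f2 (u \<circ> transpose b' b) = f2 u \<circ> transpose b' b"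
  shows "gluing q b' b n X2 f2 w2 (\<lambda>a. transpose b' b \<circ> a \<circ> block_flip q b)"
proof
  let ?s = "transpose b' b" and ?h = "block_flip q b"
  have s: "?s permutes {q..b}" using qb by (intro permutes_swap_id) auto
  fix a assume a: "a permutes {q..b}"
  show "(?s \<circ> a \<circ> ?h) permutes {q..b} \<and> ?s \<circ> (?s \<circ> a \<circ> ?h) \<circ> ?h = a"
    using permutes_compose[OF permutes_compose[OF block_flip_permutes a] s]
    by (simp add: comp_assoc) (simp add: o_assoc)
  {
    fix z assume "z permutes {b'..b}"
    then have "z = id \<or> z = ?s" using qb by (intro permutes_pair_cases)
    then show "?s \<circ> (z \<circ> a) \<circ> ?h = z \<circ> (?s \<circ> a \<circ> ?h)" by (auto simp: comp_assoc)
  next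
    fix i j assume ij: "i \<in> {q..b}" "j \<in> {q..b}" "i < j"
    have am: "a i \<in> {q..b}" "a j \<in> {q..b}" "a i \<noteq> a j"
      using permutes_in_image[OF a] ij permutes_inj[OF a] by (auto simp: inj_eq)
    have "a \<circ> transpose i j \<circ> ?h = a \<circ> ?h \<circ> transpose (?h j) (?h i)"
      using comp_transpose_bij[OF permutes_bij[OF block_flip_permutes], of q b "?h j" "?h i"]
      by (simp add: comp_assoc transpose_commute)
    then have 1: "?s \<circ> (a \<circ> transpose i j) \<circ> ?h = ?s \<circ> a \<circ> ?h \<circ> transpose (?h j) (?h i)"
      by (metis comp_assoc)
    have 2: "?h j < ?h i" using ij by (simp add: block_flip_less)
    have 3: "if b' \<le> a i \<and> b' \<le> a j then ?s (a j) = a i \<and> ?s (a i) = a j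
      else (a i < a j \<longleftrightarrow> ?s (a i) < ?s (a j)) \<and> \<not> (b' \<le> ?s (a j) \<and> b' \<le> ?s (a i))"
      using am qb by (auto simp: transpose_def)
    show "\<exists>i' j'. i' < j' \<and> ?s \<circ> (a \<circ> transpose i j) \<circ> ?h = ?s \<circ> a \<circ> ?h \<circ> transpose i' j' \<and>
      (if b' \<le> a i \<and> b' \<le> a j then (?s \<circ> a \<circ> ?h) i' = a i \<and> (?s \<circ> a \<circ> ?h) j' = a j
       else (a i < a j \<longleftrightarrow> (?s \<circ> a \<circ> ?h) j' < (?s \<circ> a \<circ> ?h) i') \<and>
         \<not> (b' \<le> (?s \<circ> a \<circ> ?h) i' \<and> b' \<le> (?s \<circ> a \<circ> ?h) j'))"
      using 1 2 3 by (intro exI[of _ "?h j"] exI[of _ "?h i"] conjI) simp_all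
  }
next
  fix u z assume u: "u \<in> X2" and z: "z permutes {b'..b}"
  then have "z = id \<or> z = transpose b' b" using qb by (intro permutes_pair_cases)
  then show "u \<circ> z \<in> X2 \<and> f2 (u \<circ> z) = f2 u \<circ> z"
    using u eqv qb(2) by (cases "b' = b") auto
qed (use qb rev2 in auto)

text \<open>Left multiplication by the longest element need not commute with a shared generator
  acting on the left, so only one point is shared here. In return the map commutes with right
  multiplication inside the block.\<close>

lemma gluing_left:
  assumes qb: "q \<le> b" "b \<le> n" and rev2: "reversal {b..n} X2 f2 w2"
  shows "gluing q b b n X2 f2 w2 (\<lambda>a. block_flip q b \<circ> a)"
proof
  let ?h = "block_flip q b"
  fix a assume a: "a permutes {q..b}"
  show "(?h \<circ> a) permutes {q..b} \<and> ?h \<circ> (?h \<circ> a) = a"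
    using permutes_compose[OF a block_flip_permutes] by (simp add: o_assoc)
  {
    fix z assume "z permutes {b..b}"
    then show "?h \<circ> (z \<circ> a) = z \<circ> (?h \<circ> a)" using permutes_pair_cases[of z b b] by auto
  next
    fix i j assume ij: "i \<in> {q..b}" "j \<in> {q..b}" "i < j"
    have am: "a i \<in> {q..b}" "a j \<in> {q..b}" "a i \<noteq> a j"
      using permutes_in_image[OF a] ij permutes_inj[OF a] by (auto simp: inj_eq)
    have "?h (a i) \<noteq> ?h (a j)"
      using am(3) inj_eq[OF permutes_inj[OF block_flip_permutes]] by blast
    then show "\<exists>i' j'. i' < j' \<and> ?h \<circ> (a \<circ> transpose i j) = ?h \<circ> a \<circ> transpose i' j' \<and>
      (if b \<le> a i \<and> b \<le> a j then (?h \<circ> a) i' = a i \<and> (?h \<circ> a) j' = a j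
       else (a i < a j \<longleftrightarrow> (?h \<circ> a) j' < (?h \<circ> a) i') \<and> \<not> (b \<le> (?h \<circ> a) i' \<and> b \<le> (?h \<circ> a) j'))"
      using block_flip_mem[OF am(1)] block_flip_mem[OF am(2)] am ij block_flip_less[of "a j" q b "a i"]
      by (intro exI[of _ i] exI[of _ j] conjI) (auto simp: comp_assoc)
  }
next
  fix u z assume "u \<in> X2" "z permutes {b..b}"
  then show "u \<circ> z \<in> X2 \<and> f2 (u \<circ> z) = f2 u \<circ> z" using permutes_pair_cases[of z b b] by auto
qed (use qb rev2 in auto)

definition right_equivariant :: "nat \<Rightarrow> (nat \<Rightarrow> nat) set \<Rightarrow> ((nat \<Rightarrow> nat) \<Rightarrow> nat \<Rightarrow> nat) \<Rightarrow> bool" where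
  "right_equivariant q X f \<longleftrightarrow> (\<forall>u\<in>X. u \<circ> transpose q (Suc q) \<in> X \<and>
     f (u \<circ> transpose q (Suc q)) = f u \<circ> transpose q (Suc q))"

definition left_equivariant :: "nat \<Rightarrow> (nat \<Rightarrow> nat) set \<Rightarrow> ((nat \<Rightarrow> nat) \<Rightarrow> nat \<Rightarrow> nat) \<Rightarrow> bool" where
  "left_equivariant q X f \<longleftrightarrow> (\<forall>u\<in>X. transpose q (Suc q) \<circ> u \<in> X \<and>
     f (transpose q (Suc q) \<circ> u) = transpose q (Suc q) \<circ> f u)"

text \<open>The generator at \<open>q\<close> commutes with the elements of \<open>X2\<close>, which
  move nothing below \<open>p\<close>, and with \<open>transpose b' b\<close>; the longest element
  acts on the other side.\<close>

lemma gluing_right_left_equivariant: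
  assumes g: "gluing q b' b n X2 f2 w2 (\<lambda>a. transpose b' b \<circ> a \<circ> block_flip q b)"
    and X2: "\<And>u. u \<in> X2 \<Longrightarrow> u permutes {p..n}" and p: "Suc q < p"
    and b: "Suc q \<le> b" "b' < b \<Longrightarrow> Suc q < b'"
  shows "left_equivariant q (gluing.X q b X2) (gluing.F q b X2 f2 (\<lambda>a. transpose b' b \<circ> a \<circ> block_flip q b))"
proof -
  interpret gluing q b' b n X2 f2 w2 "\<lambda>a. transpose b' b \<circ> a \<circ> block_flip q b" by (rule g)
  define t where "t = transpose q (Suc q)"
  have st: "transpose b' b \<circ> t = t \<circ> transpose b' b"
    using b qb unfolding t_def by (cases "b' < b") (auto simp: fun_eq_iff transpose_def)
  have pt: "t permutes {q..b}" unfolding t_def using b by (intro permutes_swap_id) auto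
  have comm: "t \<circ> u = u \<circ> t" if "u \<in> X2" for u
    unfolding t_def using X2[OF that] p by (intro transpose_comm_permutes) auto
  show ?thesis unfolding left_equivariant_def t_def[symmetric]
  proof (intro ballI)
    fix u assume "u \<in> X"
    then obtain u2 a where u: "u2 \<in> X2" "a permutes {q..b}" "u = u2 \<circ> a" by (rule XE)
    have ta: "t \<circ> a permutes {q..b}" using u(2) pt by (rule permutes_compose)
    have tu: "t \<circ> u = u2 \<circ> (t \<circ> a)" unfolding u(3) using comm[OF u(1)] by (metis comp_assoc)
    have f2: "f2 u2 \<in> X2" using reversalD(4)[OF rev2 u(1)] .
    have "F (t \<circ> u) = f2 u2 \<circ> (transpose b' b \<circ> (t \<circ> a) \<circ> block_flip q b)"
      unfolding tu by (rule F_eq[OF u(1) ta])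
    also have "\<dots> = t \<circ> (f2 u2 \<circ> (transpose b' b \<circ> a \<circ> block_flip q b))"
      using st comm[OF f2] by (metis comp_assoc)
    also have "\<dots> = t \<circ> F u" unfolding u(3) F_eq[OF u(1,2)] ..
    finally show "t \<circ> u \<in> X \<and> F (t \<circ> u) = t \<circ> F u" using XI[OF u(1) ta] tu by simp
  qed
qed

lemma gluing_left_right_equivariant:
  assumes g: "gluing q b b n X2 f2 w2 (\<lambda>a. block_flip q b \<circ> a)" and b: "Suc q \<le> b"
  shows "right_equivariant q (gluing.X q b X2) (gluing.F q b X2 f2 (\<lambda>a. block_flip q b \<circ> a))"
proof -
  interpret gluing q b b n X2 f2 w2 "\<lambda>a. block_flip q b \<circ> a" by (rule g)
  define t where "t = transpose q (Suc q)"
  have pt: "t permutes {q..b}" unfolding t_def using b by (intro permutes_swap_id) auto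
  show ?thesis unfolding right_equivariant_def t_def[symmetric]
  proof (intro ballI)
    fix u assume "u \<in> X"
    then obtain u2 a where u: "u2 \<in> X2" "a permutes {q..b}" "u = u2 \<circ> a" by (rule XE)
    have at: "a \<circ> t permutes {q..b}" using pt u(2) by (rule permutes_compose)
    have tu: "u \<circ> t = u2 \<circ> (a \<circ> t)" unfolding u(3) by (rule comp_assoc)
    have "F (u \<circ> t) = f2 u2 \<circ> (block_flip q b \<circ> (a \<circ> t))"
      unfolding tu by (rule F_eq[OF u(1) at])
    also have "\<dots> = F u \<circ> t" unfolding u(3) F_eq[OF u(1,2)] by (simp only: comp_assoc)
    finally show "u \<circ> t \<in> X \<and> F (u \<circ> t) = F u \<circ> t" using XI[OF u(1) at] tu by simp
  qed
qed

section \<open>Reversals of inverse permutations\<close>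

lemma inv_transpose_comp:
  assumes "u permutes S"
  shows "inv (u \<circ> transpose i j) = inv u \<circ> transpose (u i) (u j)" (is ?A)
    and "inv (transpose i j \<circ> u) = inv u \<circ> transpose i j" (is ?B)
proof -
  have b: "bij u" using permutes_bij[OF assms] .
  have "u \<circ> transpose i j = transpose (u i) (u j) \<circ> u" by (rule comp_transpose_bij[OF b])
  then show ?A by (simp add: o_inv_distrib[OF bij_transpose b])
  show ?B by (simp add: o_inv_distrib[OF bij_transpose b])
qed

lemma ustep_inv:
  assumes "u permutes S" "ustep u v"
  shows "ustep (inv u) (inv v)"
proof -
  obtain i j where ij: "i < j" "u i < u j" "v = u \<circ> transpose i j" using assms(2) by (auto simp: ustep_def)
  then show ?thesis
    unfolding ustep_def using inv_transpose_comp(1)[OF assms(1), of i j] permutes_inverses(2)[OF assms(1)]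
    by (intro exI[of _ "u i"] exI[of _ "u j"]) simp
qed

lemma reversal_inv:
  assumes r: "reversal S X f w"
  shows "reversal S (inv ` X) (inv \<circ> f \<circ> inv) (inv w)"
proof -
  have p: "u permutes S" if "u \<in> X" for u using reversalD(1)[OF r that] .
  have ii: "inv (inv u) = u" if "u \<in> X" for u using permutes_inv_inv[OF p[OF that]] .
  have fX: "f u \<in> X" if "u \<in> X" for u using reversalD(4)[OF r that] .
  show ?thesis unfolding reversal_def
  proof (intro conjI ballI allI impI)
    fix u assume "u \<in> inv ` X"
    then obtain u' where u': "u' \<in> X" "u = inv u'" by blast
    show "u permutes S" unfolding u'(2) using permutes_inv[OF p[OF u'(1)]] .
    show "(inv \<circ> f \<circ> inv) u \<in> inv ` X" using u' fX ii by simp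
    show "(inv \<circ> f \<circ> inv) ((inv \<circ> f \<circ> inv) u) = u" using u' fX ii reversalD(5)[OF r] by simp
    fix i j :: nat assume ij: "i < j \<and> u j < u i"
    have x: "u' (inv u' k) = k" for k using permutes_inverses(1)[OF p[OF u'(1)]] .
    have "u' \<circ> transpose (u j) (u i) \<in> X" using ij x u' by (intro reversalD(3)[OF r u'(1)]) auto
    moreover have "inv (u' \<circ> transpose (u j) (u i)) = u \<circ> transpose i j"
      using inv_transpose_comp(1)[OF p[OF u'(1)], of "u j" "u i"] x u'(2) by (simp add: transpose_commute)
    ultimately show "u \<circ> transpose i j \<in> inv ` X" by (metis imageI)
  next
    show "id \<in> inv ` X" using reversalD(2)[OF r] by (metis imageI inv_id)
    show "(inv \<circ> f \<circ> inv) id = inv w" using reversalD(7)[OF r] by (simp add: inv_id)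
  next
    fix u v assume "u \<in> inv ` X" "v \<in> inv ` X" and uv: "ustep u v"
    then obtain u' v' where u': "u' \<in> X" "u = inv u'" and v': "v' \<in> X" "v = inv v'" by blast
    have "ustep u' v'" using ustep_inv[OF permutes_inv[OF p[OF u'(1)]]] uv ii u' v' by metis
    then have "ustep (f v') (f u')" using reversalD(6)[OF r u'(1) v'(1)] by blast
    then have "ustep (inv (f v')) (inv (f u'))" using ustep_inv[OF p[OF fX[OF v'(1)]]] by blast
    then show "ustep ((inv \<circ> f \<circ> inv) v) ((inv \<circ> f \<circ> inv) u)" using ii u' v' by simp
  qed
qed

lemma right_equivariant_inv:
  assumes r: "reversal S X f w" and e: "right_equivariant q X f"
  shows "left_equivariant q (inv ` X) (inv \<circ> f \<circ> inv)"
  unfolding left_equivariant_def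
proof (intro ballI)
  let ?t = "transpose q (Suc q)"
  fix u assume "u \<in> inv ` X"
  then obtain v where v: "v \<in> X" "u = inv v" by blast
  have p: "x permutes S" if "x \<in> X" for x using reversalD(1)[OF r that] .
  have ii: "inv (inv x) = x" if "x \<in> X" for x using permutes_inv_inv[OF p[OF that]] .
  have i: "inv (x \<circ> ?t) = ?t \<circ> inv x" if "x \<in> X" for x
    using o_inv_distrib[OF permutes_bij[OF p[OF that]] bij_transpose] by simp
  have vt: "v \<circ> ?t \<in> X" "f (v \<circ> ?t) = f v \<circ> ?t" using e v(1) by (auto simp: right_equivariant_def)
  have fv: "f v \<in> X" using reversalD(4)[OF r v(1)] .
  have tu: "?t \<circ> u = inv (v \<circ> ?t)" using i[OF v(1)] v(2) by simp
  have "(inv \<circ> f \<circ> inv) (?t \<circ> u) = inv (f v \<circ> ?t)" unfolding tu using ii[OF vt(1)] vt(2) by simp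
  then show "?t \<circ> u \<in> inv ` X \<and> (inv \<circ> f \<circ> inv) (?t \<circ> u) = ?t \<circ> (inv \<circ> f \<circ> inv) u"
    using tu vt(1) i[OF fv] v(2) ii[OF v(1)] by simp
qed

lemma left_equivariant_inv:
  assumes r: "reversal S X f w" and e: "left_equivariant q X f"
  shows "right_equivariant q (inv ` X) (inv \<circ> f \<circ> inv)"
  unfolding right_equivariant_def
proof (intro ballI)
  let ?t = "transpose q (Suc q)"
  fix u assume "u \<in> inv ` X"
  then obtain v where v: "v \<in> X" "u = inv v" by blast
  have p: "x permutes S" if "x \<in> X" for x using reversalD(1)[OF r that] .
  have ii: "inv (inv x) = x" if "x \<in> X" for x using permutes_inv_inv[OF p[OF that]] .
  have i: "inv (?t \<circ> x) = inv x \<circ> ?t" if "x \<in> X" for x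
    using inv_transpose_comp(2)[OF p[OF that]] .
  have vt: "?t \<circ> v \<in> X" "f (?t \<circ> v) = ?t \<circ> f v" using e v(1) by (auto simp: left_equivariant_def)
  have fv: "f v \<in> X" using reversalD(4)[OF r v(1)] .
  have tu: "u \<circ> ?t = inv (?t \<circ> v)" using i[OF v(1)] v(2) by simp
  have "(inv \<circ> f \<circ> inv) (u \<circ> ?t) = inv (?t \<circ> f v)" unfolding tu using ii[OF vt(1)] vt(2) by simp
  then show "u \<circ> ?t \<in> inv ` X \<and> (inv \<circ> f \<circ> inv) (u \<circ> ?t) = (inv \<circ> f \<circ> inv) u \<circ> ?t"
    using tu vt(1) i[OF fv] v(2) ii[OF v(1)] by simp
qed

section \<open>Decomposition of pattern avoiding permutations\<close>

definition no_54312 :: "(nat \<Rightarrow> nat) \<Rightarrow> nat set \<Rightarrow> bool" where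
  "no_54312 w A \<longleftrightarrow> (\<forall>i\<in>A. \<forall>j\<in>A. \<forall>k\<in>A. \<forall>l\<in>A. \<forall>m\<in>A.
     i < j \<longrightarrow> j < k \<longrightarrow> k < l \<longrightarrow> l < m \<longrightarrow> \<not> (w l < w m \<and> w m < w k \<and> w k < w j \<and> w j < w i))"

definition no_54123 :: "(nat \<Rightarrow> nat) \<Rightarrow> nat set \<Rightarrow> bool" where
  "no_54123 w A \<longleftrightarrow> (\<forall>i\<in>A. \<forall>j\<in>A. \<forall>k\<in>A. \<forall>l\<in>A. \<forall>m\<in>A.
     i < j \<longrightarrow> j < k \<longrightarrow> k < l \<longrightarrow> l < m \<longrightarrow> \<not> (w k < w l \<and> w l < w m \<and> w m < w j \<and> w j < w i))"

definition no_34521 :: "(nat \<Rightarrow> nat) \<Rightarrow> nat set \<Rightarrow> bool" where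
  "no_34521 w A \<longleftrightarrow> (\<forall>i\<in>A. \<forall>j\<in>A. \<forall>k\<in>A. \<forall>l\<in>A. \<forall>m\<in>A.
     i < j \<longrightarrow> j < k \<longrightarrow> k < l \<longrightarrow> l < m \<longrightarrow> \<not> (w m < w l \<and> w l < w i \<and> w i < w j \<and> w j < w k))"

definition no_45321 :: "(nat \<Rightarrow> nat) \<Rightarrow> nat set \<Rightarrow> bool" where
  "no_45321 w A \<longleftrightarrow> (\<forall>i\<in>A. \<forall>j\<in>A. \<forall>k\<in>A. \<forall>l\<in>A. \<forall>m\<in>A.
     i < j \<longrightarrow> j < k \<longrightarrow> k < l \<longrightarrow> l < m \<longrightarrow> \<not> (w m < w l \<and> w l < w k \<and> w k < w i \<and> w i < w j))"

lemma no_54312D: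
  assumes "no_54312 w A" "i \<in> A" "j \<in> A" "k \<in> A" "l \<in> A" "m \<in> A"
    "i < j" "j < k" "k < l" "l < m" "w l < w m" "w m < w k" "w k < w j" "w j < w i"
  shows False
  using assms unfolding no_54312_def by blast

lemma no_54123D:
  assumes "no_54123 w A" "i \<in> A" "j \<in> A" "k \<in> A" "l \<in> A" "m \<in> A"
    "i < j" "j < k" "k < l" "l < m" "w k < w l" "w l < w m" "w m < w j" "w j < w i"
  shows False
  using assms unfolding no_54123_def by blast

lemma no_34521D:
  assumes "no_34521 w A" "i \<in> A" "j \<in> A" "k \<in> A" "l \<in> A" "m \<in> A"
    "i < j" "j < k" "k < l" "l < m" "w m < w l" "w l < w i" "w i < w j" "w j < w k"
  shows False
  using assms unfolding no_34521_def by blast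

lemma no_45321D:
  assumes "no_45321 w A" "i \<in> A" "j \<in> A" "k \<in> A" "l \<in> A" "m \<in> A"
    "i < j" "j < k" "k < l" "l < m" "w m < w l" "w l < w k" "w k < w i" "w i < w j"
  shows False
  using assms unfolding no_45321_def by blast

definition tame :: "(nat \<Rightarrow> nat) \<Rightarrow> nat set \<Rightarrow> bool" where
  "tame w A \<longleftrightarrow> no_3412 w A \<and> no_4231 w A \<and> no_54312 w A \<and> no_54123 w A \<and>
     no_34521 w A \<and> no_45321 w A"

text \<open>\<open>h\<close> places the positions of \<open>v\<close> in order among those of
  \<open>w\<close>, so every pattern of \<open>v\<close> occurs in \<open>w\<close>. The
  decomposition uses it when the first entries of a block become the first entries of the remaining
  factor.\<close>

lemma tame_transfer:
  assumes p: "tame w A" and h: "\<And>i. i \<in> B \<Longrightarrow> h i \<in> A" "strict_mono_on B h"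
    and v: "\<And>i. i \<in> B \<Longrightarrow> v i = w (h i)"
  shows "tame v B"
proof -
  note m = strict_mono_onD[OF h(2)]
  have "no_3412 v B" unfolding no_3412_def
  proof (intro ballI impI notI, elim conjE)
    fix i j k l assume "i \<in> B" "j \<in> B" "k \<in> B" "l \<in> B" "i < j" "j < k" "k < l"
      "v k < v l" "v l < v i" "v i < v j"
    then show False
      using p no_3412D[of w A "h i" "h j" "h k" "h l"] h(1) m v by (simp add: tame_def)
  qed
  moreover have "no_4231 v B" unfolding no_4231_def
  proof (intro ballI impI notI, elim conjE)
    fix i j k l assume "i \<in> B" "j \<in> B" "k \<in> B" "l \<in> B" "i < j" "j < k" "k < l"
      "v l < v j" "v j < v k" "v k < v i"
    then show False
      using p no_4231D[of w A "h i" "h j" "h k" "h l"] h(1) m v by (simp add: tame_def)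
  qed
  moreover have "no_54312 v B" unfolding no_54312_def
  proof (intro ballI impI notI, elim conjE)
    fix i j k l q assume "i \<in> B" "j \<in> B" "k \<in> B" "l \<in> B" "q \<in> B" "i < j" "j < k" "k < l" "l < q"
      "v l < v q" "v q < v k" "v k < v j" "v j < v i"
    then show False
      using p no_54312D[of w A "h i" "h j" "h k" "h l" "h q"] h(1) m v by (simp add: tame_def)
  qed
  moreover have "no_54123 v B" unfolding no_54123_def
  proof (intro ballI impI notI, elim conjE)
    fix i j k l q assume "i \<in> B" "j \<in> B" "k \<in> B" "l \<in> B" "q \<in> B" "i < j" "j < k" "k < l" "l < q"
      "v k < v l" "v l < v q" "v q < v j" "v j < v i"
    then show False
      using p no_54123D[of w A "h i" "h j" "h k" "h l" "h q"] h(1) m v by (simp add: tame_def)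
  qed
  moreover have "no_34521 v B" unfolding no_34521_def
  proof (intro ballI impI notI, elim conjE)
    fix i j k l q assume "i \<in> B" "j \<in> B" "k \<in> B" "l \<in> B" "q \<in> B" "i < j" "j < k" "k < l" "l < q"
      "v q < v l" "v l < v i" "v i < v j" "v j < v k"
    then show False
      using p no_34521D[of w A "h i" "h j" "h k" "h l" "h q"] h(1) m v by (simp add: tame_def)
  qed
  moreover have "no_45321 v B" unfolding no_45321_def
  proof (intro ballI impI notI, elim conjE)
    fix i j k l q assume "i \<in> B" "j \<in> B" "k \<in> B" "l \<in> B" "q \<in> B" "i < j" "j < k" "k < l" "l < q"
      "v q < v l" "v l < v k" "v k < v i" "v i < v j"
    then show False
      using p no_45321D[of w A "h i" "h j" "h k" "h l" "h q"] h(1) m v by (simp add: tame_def)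
  qed
  ultimately show ?thesis by (simp add: tame_def)
qed

lemma tame_subset: "tame w A \<Longrightarrow> B \<subseteq> A \<Longrightarrow> tame w B"
  by (rule tame_transfer[of w A B "\<lambda>i. i"]) (auto simp: strict_mono_on_def)

text \<open>3412 and 4231 are their own inverses; inversion exchanges 54312 with 45321 and 54123
  with 34521.\<close>

lemma tame_inv:
  assumes w: "w permutes A" and p: "tame w A"
  shows "tame (inv w) A"
proof -
  define v where "v = inv w"
  have m: "v i \<in> A" if "i \<in> A" for i
    using that permutes_in_image[OF permutes_inv[OF w]] by (simp add: v_def)
  have wv: "w (v i) = i" for i unfolding v_def using permutes_inverses(1)[OF w] .
  have "no_3412 v A" unfolding no_3412_def
  proof (intro ballI impI notI, elim conjE)
    fix i j k l assume "i \<in> A" "j \<in> A" "k \<in> A" "l \<in> A" "i < j" "j < k" "k < l"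
      "v k < v l" "v l < v i" "v i < v j"
    then show False
      using p no_3412D[of w A "v k" "v l" "v i" "v j"] m wv by (simp add: tame_def)
  qed
  moreover have "no_4231 v A" unfolding no_4231_def
  proof (intro ballI impI notI, elim conjE)
    fix i j k l assume "i \<in> A" "j \<in> A" "k \<in> A" "l \<in> A" "i < j" "j < k" "k < l"
      "v l < v j" "v j < v k" "v k < v i"
    then show False
      using p no_4231D[of w A "v l" "v j" "v k" "v i"] m wv by (simp add: tame_def)
  qed
  moreover have "no_54312 v A" unfolding no_54312_def
  proof (intro ballI impI notI, elim conjE)
    fix i j k l q assume "i \<in> A" "j \<in> A" "k \<in> A" "l \<in> A" "q \<in> A" "i < j" "j < k" "k < l" "l < q"
      "v l < v q" "v q < v k" "v k < v j" "v j < v i"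
    then show False
      using p no_45321D[of w A "v l" "v q" "v k" "v j" "v i"] m wv by (simp add: tame_def)
  qed
  moreover have "no_54123 v A" unfolding no_54123_def
  proof (intro ballI impI notI, elim conjE)
    fix i j k l q assume "i \<in> A" "j \<in> A" "k \<in> A" "l \<in> A" "q \<in> A" "i < j" "j < k" "k < l" "l < q"
      "v k < v l" "v l < v q" "v q < v j" "v j < v i"
    then show False
      using p no_34521D[of w A "v k" "v l" "v q" "v j" "v i"] m wv by (simp add: tame_def)
  qed
  moreover have "no_34521 v A" unfolding no_34521_def
  proof (intro ballI impI notI, elim conjE)
    fix i j k l q assume "i \<in> A" "j \<in> A" "k \<in> A" "l \<in> A" "q \<in> A" "i < j" "j < k" "k < l" "l < q"
      "v q < v l" "v l < v i" "v i < v j" "v j < v k"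
    then show False
      using p no_54123D[of w A "v q" "v l" "v i" "v j" "v k"] m wv by (simp add: tame_def)
  qed
  moreover have "no_45321 v A" unfolding no_45321_def
  proof (intro ballI impI notI, elim conjE)
    fix i j k l q assume "i \<in> A" "j \<in> A" "k \<in> A" "l \<in> A" "q \<in> A" "i < j" "j < k" "k < l" "l < q"
      "v q < v l" "v l < v k" "v k < v i" "v i < v j"
    then show False
      using p no_54312D[of w A "v q" "v l" "v k" "v i" "v j"] m wv by (simp add: tame_def)
  qed
  ultimately show ?thesis by (simp add: tame_def v_def)
qed

text \<open>\<open>extendable w q\<close> says that a decreasing run may be glued to the left of \<open>w\<close> along the
  generator \<open>(q q+1)\<close>; this needs a reversal commuting with that generator.\<close>

definition extendable :: "(nat \<Rightarrow> nat) \<Rightarrow> nat \<Rightarrow> bool" where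
  "extendable w q \<longleftrightarrow> w (Suc q) < w q \<and>
     \<not> (\<exists>r r'. Suc q < r \<and> r < r' \<and> w r < w r' \<and> w r' < w (Suc q))"

text \<open>The claim carried by the induction. A block sharing a generator needs a right
  equivariant reversal; the left version makes the claim stable under inverses. The maps in the
  three clauses may differ.\<close>

definition reversible :: "nat \<Rightarrow> nat \<Rightarrow> (nat \<Rightarrow> nat) \<Rightarrow> bool" where
  "reversible n q w \<longleftrightarrow> (\<exists>X f. reversal {q..n} X f w) \<and>
     (extendable w q \<longrightarrow> (\<exists>X f. reversal {q..n} X f w \<and> right_equivariant q X f)) \<and>
     (extendable (inv w) q \<longrightarrow> (\<exists>X f. reversal {q..n} X f w \<and> left_equivariant q X f))"

lemma reversible_inv:
  assumes w: "w permutes {q..n}" and r: "reversible n q (inv w)"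
  shows "reversible n q w"
proof -
  have ii: "inv (inv w) = w" using permutes_inv_inv[OF w] .
  have 1: "\<exists>X f. reversal {q..n} X f w" using r reversal_inv[of "{q..n}" _ _ "inv w"] ii
    unfolding reversible_def by metis
  have 2: "\<exists>X f. reversal {q..n} X f w \<and> right_equivariant q X f" if "extendable w q"
  proof -
    have "\<exists>X f. reversal {q..n} X f (inv w) \<and> left_equivariant q X f"
      using r that by (simp add: reversible_def ii)
    then obtain X f where "reversal {q..n} X f (inv w)" "left_equivariant q X f" by blast
    then show ?thesis using reversal_inv[of "{q..n}" X f "inv w"] left_equivariant_inv ii by metis
  qed
  have 3: "\<exists>X f. reversal {q..n} X f w \<and> left_equivariant q X f" if "extendable (inv w) q"
  proof -
    have "\<exists>X f. reversal {q..n} X f (inv w) \<and> right_equivariant q X f"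
      using r that by (simp add: reversible_def)
    then obtain X f where "reversal {q..n} X f (inv w)" "right_equivariant q X f" by blast
    then show ?thesis using reversal_inv[of "{q..n}" X f "inv w"] right_equivariant_inv ii by metis
  qed
  show ?thesis unfolding reversible_def using 1 2 3 by blast
qed

text \<open>The values below \<open>w k\<close> are exactly those standing behind \<open>k\<close>
  in the run, so their number \<open>w k - q\<close> is \<open>b - k\<close>.\<close>

lemma decreasing_run_values:
  fixes q n :: nat
  assumes w: "w permutes {q..n}" and b: "w b = q" "b \<le> n" "q \<le> s"
    and dec: "\<And>i j. s \<le> i \<Longrightarrow> i < j \<Longrightarrow> j \<le> b \<Longrightarrow> w j < w i"
    and low: "\<And>i. i \<in> {q..n} \<Longrightarrow> w i < w s \<Longrightarrow> i \<in> {s..b}"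
    and k: "k \<in> {s..b}"
  shows "w k = q + b - k"
proof -
  have ge: "q \<le> w i" if "i \<in> {q..n}" for i using permutes_in_image[OF w, of i] that by simp
  have ks: "w k \<le> w s" using dec[of s k] k by (cases "k = s") auto
  have "{q..<w k} = w ` {k<..b}"
  proof (intro equalityI subsetI)
    fix v assume v: "v \<in> {q..<w k}"
    have "w k \<in> {q..n}" using permutes_in_image[OF w, of k] k b by simp
    then have vn: "v \<in> {q..n}" using v by simp
    obtain i where i: "w i = v" using permutes_surj[OF w] by (metis surjD)
    then have "i \<in> {q..n}" using vn permutes_in_image[OF w, of i] by simp
    then have "i \<in> {s..b}" using low[of i] i v ks by simp
    moreover have "k < i"
    proof (rule ccontr)
      assume "\<not> k < i"
      then have "w k \<le> w i" using dec[of i k] k \<open>i \<in> {s..b}\<close> by (cases "i = k") auto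
      then show False using i v by simp
    qed
    ultimately show "v \<in> w ` {k<..b}" using i by auto
  next
    fix v assume "v \<in> w ` {k<..b}"
    then obtain i where i: "v = w i" "k < i" "i \<le> b" by auto
    then show "v \<in> {q..<w k}" using dec[of k i] k ge[of i] b by auto
  qed
  then have "card {q..<w k} = card {k<..b}"
    using permutes_inj_on[OF w, of "{k<..b}"] by (metis card_image)
  moreover have "q \<le> w k" using ge[of k] k b by simp
  ultimately show ?thesis using k by auto
qed

text \<open>By 4231 the entries from \<open>q\<close> to \<open>b\<close> decrease. By 54312 only
  the first two of them can exceed an entry to the right of \<open>b\<close>, so splitting off the
  longest element of \<open>{q..b}\<close>, up to a shared generator, leaves a permutation of
  \<open>{b..n}\<close> or \<open>{b - 1..n}\<close>.\<close>

lemma reversible_step: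
  assumes w: "w permutes {q..n}" and pol: "tame w {q..n}" and qn: "q \<le> n"
    and b: "w b = q" "q < b"
    and T: "\<And>t. q < t \<Longrightarrow> t < b \<Longrightarrow> w t < w q"
    and IH: "\<And>p v. q < p \<Longrightarrow> v permutes {p..n} \<Longrightarrow> tame v {p..n} \<Longrightarrow> reversible n p v"
  shows "reversible n q w"
proof -
  have in_iff: "w i \<in> {q..n} \<longleftrightarrow> i \<in> {q..n}" for i using permutes_in_image[OF w] .
  have out: "w i = i" if "i \<notin> {q..n}" for i using permutes_not_in[OF w that] .
  have neq: "w i \<noteq> w j" if "i \<noteq> j" for i j using that permutes_inj[OF w] by (simp add: inj_eq)
  have bn: "b \<le> n" using in_iff[of b] b qn by simp
  have ge: "q \<le> w i" if "i \<in> {q..n}" for i using in_iff[of i] that by simp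
  have gt: "q < w i" if "i \<in> {q..n}" "i \<noteq> b" for i using ge[OF that(1)] neq[OF that(2)] b by simp
  have big: "n < w i" if "n < i" for i using out[of i] that by simp
  have le_n: "w i \<le> n" if "i \<in> {q..n}" for i using in_iff[of i] that by simp
  have dec: "w j < w i" if ij: "q \<le> i" "i < j" "j \<le> b" for i j
  proof -
    have m: "i \<in> {q..n}" "j \<in> {q..n}" using ij bn by auto
    consider "j = b" | "j < b" "i = q" | "j < b" "q < i" using ij by linarith
    then show ?thesis
    proof cases
      case 1
      then show ?thesis using gt[of i] m ij b by simp
    next
      case 2
      then show ?thesis using T[of j] ij by simp
    next
      case 3
      have "\<not> w i < w j"
        using no_4231D[of w "{q..n}" q i j b] pol 3 ij m bn qn b gt[of i] T[of j]
        by (auto simp: tame_def)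
      then show ?thesis using neq[of i j] ij by simp
    qed
  qed
  have wb: "w (Suc q) < w q" using dec[of q "Suc q"] b by simp
  define h where "h = block_flip q b"
  have h: "h permutes {q..b}" unfolding h_def by (rule block_flip_permutes)
  have hh: "h \<circ> h = id" unfolding h_def by simp
  have hn: "h permutes {q..n}" using h bn by (auto intro: permutes_subset)
  show ?thesis
  proof (cases "\<forall>r>b. w (Suc q) < w r")
    case True
    have val: "w k = q + b - k" if "k \<in> {Suc q..b}" for k
    proof (rule decreasing_run_values[OF w b(1) bn, of "Suc q"])
      show "i \<in> {Suc q..b}" if "i \<in> {q..n}" "w i < w (Suc q)" for i
      proof -
        have "i \<noteq> q" "\<not> b < i" using that wb True by auto
        then show ?thesis using that by auto
      qed
    qed (use that dec in auto)
    define w2 where "w2 = w \<circ> h"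
    have ww2: "w = w2 \<circ> h" unfolding w2_def by (simp add: comp_assoc hh)
    have "w2 permutes {q..n}" unfolding w2_def using hn w by (rule permutes_compose)
    moreover have fixed: "w2 k = k" if "k \<in> {q..n} - {b..n}" for k
    proof -
      have "q \<le> k" "k < b" using that by auto
      then have "q + b - k \<in> {Suc q..b}" "q + b - (q + b - k) = k" "h k = q + b - k"
        by (auto simp: h_def block_flip_def)
      then show ?thesis using val[of "q + b - k"] by (simp add: w2_def)
    qed
    ultimately have w2: "w2 permutes {b..n}" by (rule permutes_superset) (use fixed in auto)
    have pol2: "tame w2 {b..n}"
    proof (rule tame_transfer[OF pol, where h = "\<lambda>i. if i = b then q else i"])
      show "w2 i = w (if i = b then q else i)" if "i \<in> {b..n}" for i
        using that b by (auto simp: w2_def h_def block_flip_def)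
    qed (use b bn in \<open>auto simp: strict_mono_on_def\<close>)
    obtain X2 f2 where r2: "reversal {b..n} X2 f2 w2"
      using IH[OF b(2) w2 pol2] unfolding reversible_def by blast
    interpret C: gluing q b b n X2 f2 w2 "\<lambda>a. block_flip q b \<circ> a"
      by (rule gluing_left[OF less_imp_le[OF b(2)] bn r2])
    have C: "reversal {q..n} C.X C.F w"
      using C.reversal_F ww2 by (simp add: h_def)
    have "right_equivariant q C.X C.F"
      by (rule gluing_left_right_equivariant[OF C.gluing_axioms]) (use b(2) in simp)
    then have 1: "\<exists>X f. reversal {q..n} X f w \<and> right_equivariant q X f" using C by blast
    have 2: "\<exists>X f. reversal {q..n} X f w \<and> left_equivariant q X f" if ext: "extendable (inv w) q"
    proof -
      \<comment> \<open>The remaining factor must commute with the generator at \<open>q\<close>, so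
        \<open>p\<close> has to exceed \<open>Suc q\<close>. If \<open>b = Suc q\<close>,
        extendability of \<open>inv w\<close> forces \<open>w q = b\<close>; then \<open>w2\<close>
        fixes \<open>b\<close> and may start one place later.\<close>
      define p where "p = (if w2 b = b then Suc b else b)"
      have w2p: "w2 permutes {p..n}"
      proof (rule permutes_superset[OF w2])
        fix x assume "x \<in> {b..n} - {p..n}"
        then show "w2 x = x" by (cases "w2 b = b"; cases "x = b") (auto simp: p_def)
      qed
      have pb: "b \<le> p" by (simp add: p_def)
      have qp: "Suc q < p"
      proof (cases "w2 b = b")
        case True
        then show ?thesis using b by (simp add: p_def)
      next
        case False
        have "Suc q \<noteq> b"
        proof
          assume sb: "Suc q = b"
          have iq: "inv w q = b" using b(1) permutes_inverses(2)[OF w, of b] by simp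
          have wi: "w (inv w (Suc q)) = Suc q" using permutes_inverses(1)[OF w] .
          then have "inv w (Suc q) \<in> {q..n}" using in_iff[of "inv w (Suc q)"] sb bn by simp
          moreover have "inv w (Suc q) < b" using ext iq unfolding extendable_def by simp
          ultimately have "inv w (Suc q) = q" using sb by auto
          then have "w q = b" using wi sb by simp
          moreover have "w2 b = w q" using b by (simp add: w2_def h_def block_flip_def)
          ultimately show False using False by simp
        qed
        then show ?thesis using b pb by simp
      qed
      have "tame w2 {p..n}" using tame_subset[OF pol2] pb by simp
      then obtain X3 f3 where r3: "reversal {p..n} X3 f3 w2"
        using IH[of p w2] w2p qp unfolding reversible_def by auto
      have r3b: "reversal {b..n} X3 f3 w2" using reversal_mono[OF r3] pb by simp
      interpret A: gluing q b b n X3 f3 w2 "\<lambda>a. transpose b b \<circ> a \<circ> block_flip q b"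
        by (rule gluing_right) (use b(2) bn r3b in auto)
      have "reversal {q..n} A.X A.F w" using A.reversal_F ww2 by (simp add: h_def)
      moreover have "left_equivariant q A.X A.F"
        by (rule gluing_right_left_equivariant[OF A.gluing_axioms reversalD(1)[OF r3] qp])
          (use b(2) in simp_all)
      ultimately show ?thesis by blast
    qed
    show ?thesis unfolding reversible_def using 1 2 by blast
  next
    case False
    then obtain r0 where r0: "b < r0" "\<not> w (Suc q) < w r0" by blast
    moreover have "w r0 \<noteq> w (Suc q)" using neq[of r0 "Suc q"] r0(1) b(2) by simp
    ultimately have r0: "b < r0" "w r0 < w (Suc q)" by simp_all
    have r0n: "r0 \<le> n" using r0 big[of r0] le_n[of "Suc q"] b bn by force
    have b2: "Suc (Suc q) \<le> b"
    proof (rule ccontr)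
      assume "\<not> ?thesis"
      then have "b = Suc q" using b by simp
      then show False using r0 b gt[of r0] r0n by simp
    qed
    have w21: "w (Suc (Suc q)) < w (Suc q)" using dec[of "Suc q" "Suc (Suc q)"] b2 by simp
    \<comment> \<open>A smaller entry at \<open>r\<close> would make \<open>q\<close>,
      \<open>q + 1\<close>, \<open>q + 2\<close>, \<open>b\<close>, \<open>r\<close> a
      54312.\<close>
    have low: "w (Suc (Suc q)) < w r" if r: "b < r" for r
    proof (rule ccontr)
      assume "\<not> ?thesis"
      then have lt: "w r < w (Suc (Suc q))" using neq[of r "Suc (Suc q)"] r b2 by simp
      then have rn: "r \<le> n" using big[of r] le_n[of "Suc (Suc q)"] b2 bn by force
      have "q < w r" using gt[of r] r rn b by simp
      then have "Suc (Suc q) < b" using lt b b2 by (metis le_neq_implies_less less_asym)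
      then show False
        using no_54312D[of w "{q..n}" q "Suc q" "Suc (Suc q)" b r] pol wb w21 lt \<open>q < w r\<close> r rn b bn
        by (simp add: tame_def)
    qed
    have val: "w k = q + b - k" if "k \<in> {Suc (Suc q)..b}" for k
    proof (rule decreasing_run_values[OF w b(1) bn, of "Suc (Suc q)"])
      show "i \<in> {Suc (Suc q)..b}" if "i \<in> {q..n}" "w i < w (Suc (Suc q))" for i
      proof -
        have "i \<noteq> q" "i \<noteq> Suc q" using that wb w21 by auto
        moreover have "\<not> b < i" using low[of i] that by auto
        ultimately show ?thesis using that by auto
      qed
    qed (use that dec in auto)
    define b' where "b' = b - 1"
    have b': "Suc b' = b" "q < b'" using b2 by (auto simp: b'_def)
    define s where "s = transpose b' b"
    have s: "s permutes {q..n}" unfolding s_def using b' bn by (intro permutes_swap_id) auto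
    \<comment> \<open>The generator \<open>s\<close> is taken out because
      \<open>gluing_right\<close> produces the top element
      \<open>w2 \<circ> s \<circ> h\<close>.\<close>
    define w2 where "w2 = w \<circ> h \<circ> s"
    have ww2: "w = w2 \<circ> (s \<circ> h)"
      unfolding w2_def by (simp add: comp_assoc hh s_def) (simp add: o_assoc hh)
    have "w2 permutes {q..n}"
      unfolding w2_def using s permutes_compose[OF hn w] by (rule permutes_compose)
    moreover have fixed: "w2 k = k" if "k \<in> {q..n} - {b'..n}" for k
    proof -
      have k: "q \<le> k" "k < b'" using that by auto
      then have "q + b - k \<in> {Suc (Suc q)..b}" "q + b - (q + b - k) = k" "h k = q + b - k" "s k = k"
        using b' by (auto simp: h_def block_flip_def s_def)
      then show ?thesis using val[of "q + b - k"] by (simp add: w2_def)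
    qed
    ultimately have w2: "w2 permutes {b'..n}" by (rule permutes_superset) (use fixed in auto)
    have w2q: "w2 b' = w q" "w2 b = w (Suc q)"
      using b b' by (auto simp: w2_def h_def block_flip_def s_def)
    have w2r: "w2 i = w i" if "b < i" for i
      using that b' by (auto simp: w2_def h_def block_flip_def s_def)
    have pol2: "tame w2 {b'..n}"
    proof (rule tame_transfer[OF pol, where h = "\<lambda>i. if i = b' then q else if i = b then Suc q else i"])
      show "w2 i = w (if i = b' then q else if i = b then Suc q else i)" if "i \<in> {b'..n}" for i
        using that b' w2q w2r[of i] by auto
    qed (use b b' bn in \<open>auto simp: strict_mono_on_def\<close>)
    \<comment> \<open>Otherwise \<open>q\<close>, \<open>q + 1\<close>, \<open>q + 2\<close>,
      \<open>r\<close>, \<open>r'\<close> would be a 54123. Extendability yields the reversal of the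
      rest that commutes with the shared generator.\<close>
    have ext2: "extendable w2 b'"
      unfolding extendable_def b'(1)
    proof (intro conjI notI)
      show "w2 b < w2 b'" using w2q wb by simp
      assume "\<exists>r r'. b < r \<and> r < r' \<and> w2 r < w2 r' \<and> w2 r' < w2 b"
      then obtain r r' where r: "b < r" "r < r'" "w r < w r'" "w r' < w (Suc q)"
        using w2q w2r by (metis less_trans)
      have "r' \<le> n" using r big[of r'] le_n[of "Suc q"] b bn by force
      then show False
        using no_54123D[of w "{q..n}" q "Suc q" "Suc (Suc q)" r r'] pol r low[of r] wb b b2 bn
        by (simp add: tame_def)
    qed
    obtain X2 f2 where r2: "reversal {b'..n} X2 f2 w2" and e2: "right_equivariant b' X2 f2"
      using IH[OF b'(2) w2 pol2] ext2 unfolding reversible_def by blast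
    interpret B: gluing q b' b n X2 f2 w2 "\<lambda>a. transpose b' b \<circ> a \<circ> block_flip q b"
      by (rule gluing_right) (use b' bn r2 e2 in \<open>auto simp: right_equivariant_def\<close>)
    have B: "reversal {q..n} B.X B.F w" using B.reversal_F ww2 by (simp add: h_def s_def)
    \<comment> \<open>The entries at \<open>b\<close> and \<open>r0\<close> violate extendability,
      so no right equivariant reversal is owed.\<close>
    have 1: "\<not> extendable w q"
      using b b2 r0 gt[of r0] r0n unfolding extendable_def
      by (metis Suc_le_lessD atLeastAtMost_iff less_imp_le less_irrefl less_trans)
    have 2: "left_equivariant q B.X B.F" if ext: "extendable (inv w) q"
    proof -
      \<comment> \<open>If \<open>b = q + 2\<close>, extendability of \<open>inv w\<close> puts the
        value \<open>q + 1\<close> at \<open>q\<close> or \<open>q + 1\<close>; then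
        \<open>w (Suc q) \<le> q + 1\<close>, and no value is left for \<open>r0\<close>.\<close>
      have "Suc q < b'"
      proof (rule ccontr)
        assume "\<not> ?thesis"
        then have sb: "b = Suc (Suc q)" using b' b2 by simp
        have iq: "inv w q = b" using b(1) permutes_inverses(2)[OF w, of b] by simp
        have wi: "w (inv w (Suc q)) = Suc q" using permutes_inverses(1)[OF w] .
        then have "inv w (Suc q) \<in> {q..n}" using in_iff[of "inv w (Suc q)"] sb bn by simp
        moreover have "inv w (Suc q) < b" using ext iq unfolding extendable_def by simp
        ultimately have "inv w (Suc q) = q \<or> inv w (Suc q) = Suc q" using sb by auto
        then have "w (Suc q) \<le> Suc q" using wi wb by auto
        then show False using r0 gt[of r0] r0n b by simp
      qed
      then show ?thesis
        by (intro gluing_right_left_equivariant[OF B.gluing_axioms reversalD(1)[OF r2]])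
          (use b(2) in simp_all)
    qed
    show ?thesis unfolding reversible_def using B 1 2 by blast
  qed
qed

theorem tame_reversible:
  assumes "w permutes {q..n}" "tame w {q..n}"
  shows "reversible n q w"
  using assms
proof (induction "Suc n - q" arbitrary: q w rule: less_induct)
  case less
  note w = less.prems(1)
  show ?case
  proof (cases "q \<le> n")
    case False
    then have w: "w = id" using w by simp
    have "reversal {q..n} {id} (\<lambda>u. u) w"
      unfolding reversal_def w by (auto simp: permutes_id ustep_def)
    then show ?thesis unfolding reversible_def by (auto simp: extendable_def w inv_id)
  next
    case True
    have IH: "reversible n p v" if "q < p" "v permutes {p..n}" "tame v {p..n}" for p v
      using less.hyps[of p v] that True by simp
    have in_iff: "w i \<in> {q..n} \<longleftrightarrow> i \<in> {q..n}" for i using permutes_in_image[OF w] .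
    define b where "b = inv w q"
    have b: "w b = q" unfolding b_def using permutes_inverses(1)[OF w] .
    have iw: "inv w (w i) = i" "w (inv w i) = i" for i using permutes_inverses[OF w] by auto
    have bm: "b \<in> {q..n}" using in_iff[of b] b True by simp
    show ?thesis
    proof (cases "b = q")
      case True
      have w': "w permutes {Suc q..n}"
      proof (rule permutes_superset[OF w])
        fix x assume "x \<in> {q..n} - {Suc q..n}"
        then have "x = q" by auto
        then show "w x = x" using b True by simp
      qed
      have "tame w {Suc q..n}" using tame_subset[OF less.prems(2)] by simp
      then obtain X f where "reversal {Suc q..n} X f w"
        using IH[OF lessI w'] unfolding reversible_def by blast
      then have "reversal {q..n} X f w" by (rule reversal_mono) auto
      moreover have "\<not> extendable v q" if "v permutes {Suc q..n}" for v
        using permutes_inversion_mem(1)[OF that, of q "Suc q"] by (auto simp: extendable_def)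
      ultimately show ?thesis
        unfolding reversible_def using w' permutes_inv[OF w'] by blast
    next
      case False
      then have qb: "q < b" using bm by simp
      show ?thesis
      proof (cases "\<forall>t. q < t \<and> t < b \<longrightarrow> w t < w q")
        case True
        then have T: "w t < w q" if "q < t" "t < b" for t using that by blast
        show ?thesis by (rule reversible_step[OF w less.prems(2) \<open>q \<le> n\<close> b qb T IH])
      next
        case False
        then obtain t where t: "q < t" "t < b" "\<not> w t < w q" by blast
        moreover have "w t \<noteq> w q" using t(1) inj_eq[OF permutes_inj[OF w]] by simp
        ultimately have t: "q < t" "t < b" "w q < w t" by simp_all
        \<comment> \<open>A smaller entry at \<open>r\<close> would give a 3412 with
          \<open>q\<close>, \<open>t\<close>, \<open>b\<close>. This is what makes
          \<open>inv w\<close> satisfy the hypothesis of \<open>reversible_step\<close>, with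
          \<open>w q\<close> in the role of \<open>b\<close>.\<close>
        have R: "w q < w r" if r: "b < r" for r
        proof (rule ccontr)
          assume "\<not> w q < w r"
          moreover have "w r \<noteq> w q" using r qb inj_eq[OF permutes_inj[OF w]] by simp
          ultimately have lt: "w r < w q" by simp
          then have "r \<in> {q..n}"
            using permutes_not_in[OF w, of r] in_iff[of q] True r bm by (cases "r \<in> {q..n}") auto
          moreover have "q < w r" using in_iff[of r] calculation b r inj_eq[OF permutes_inj[OF w], of r b]
            by (metis atLeastAtMost_iff le_neq_implies_less less_irrefl)
          ultimately show False
            using no_3412D[of w "{q..n}" q t b r] less.prems(2) t lt b r bm True by (simp add: tame_def)
        qed
        have wq: "q < w q"
          using in_iff[of q] \<open>q \<le> n\<close> b qb inj_eq[OF permutes_inj[OF w], of q b]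
          by (metis atLeastAtMost_iff le_neq_implies_less less_irrefl order_refl)
        have "reversible n q (inv w)"
        proof (rule reversible_step[where b = "w q"])
          show "inv w permutes {q..n}" by (rule permutes_inv[OF w])
          show "tame (inv w) {q..n}" by (rule tame_inv[OF less.prems])
          show "inv w (w q) = q" by (rule iw)
          show "inv w t < inv w q" if "q < t" "t < w q" for t
          proof (rule ccontr)
            assume "\<not> inv w t < inv w q"
            moreover have "inv w t \<noteq> b" using that b iw(2)[of t] by auto
            ultimately have "w q < w (inv w t)" using R unfolding b_def by simp
            then show False using that iw by simp
          qed
        qed (use \<open>q \<le> n\<close> wq IH in blast)+
        then show ?thesis by (rule reversible_inv[OF w])
      qed
    qed
  qed
qed

section \<open>Self-duality and the equality case\<close>

lemma rank_set_1_iff: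
  assumes "w permutes {1..n}"
  shows "u \<in> rank_set n w 1 \<longleftrightarrow> u \<in> lower_interval n w \<and> bruhat_covered_by n id u"
proof -
  have "perm_length n u = 1 \<longleftrightarrow> bruhat_covered_by n id u" if u: "u \<in> lower_interval n w"
  proof (cases "u = id")
    case True
    have "\<not> bruhat_less n id id" using bruhat_less_length[of n id id] by blast
    then show ?thesis unfolding True bruhat_covered_by_def by simp
  next
    case False
    have "u permutes {1..n}" using u by (simp add: lower_interval_def bruhat_le_def)
    then have "bruhat_less n id u" using False id_bruhat_le by (metis bruhat_less_iff)
    then show ?thesis using bruhat_covered_by_length[of n id u] by simp
  qed
  then show ?thesis by (auto simp: rank_set_def)
qed

lemma rank_set_corank_1_iff:
  assumes "0 < perm_length n w"
  shows "u \<in> rank_set n w (perm_length n w - 1) \<longleftrightarrow> u \<in> lower_interval n w \<and> bruhat_covered_by n u w"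
proof -
  have "perm_length n u = perm_length n w - 1 \<longleftrightarrow> bruhat_covered_by n u w" if u: "u \<in> lower_interval n w"
  proof (cases "u = w")
    case True
    have "\<not> bruhat_less n w w" using bruhat_less_length[of n w w] by blast
    then show ?thesis unfolding True bruhat_covered_by_def using assms by simp
  next
    case False
    then have "bruhat_less n u w" using u by (simp add: bruhat_less_iff lower_interval_def)
    then show ?thesis using bruhat_covered_by_length[of n u w] assms by auto
  qed
  then show ?thesis by (auto simp: rank_set_def)
qed

text \<open>An order reversing bijection sends the identity to \<open>w\<close>, hence atoms to
  coatoms and upper covers to lower covers.\<close>

lemma self_dual_max_eq:
  assumes w: "w permutes {1..n}" and pos: "0 < perm_length n w"
    and sd: "self_dual (lower_interval n w) (bruhat_le n)"
  shows "max_over (rank_set n w 1) (udeg n w) = max_over (rank_set n w (perm_length n w - 1)) (ddeg n w)"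
proof -
  define X where "X = lower_interval n w"
  obtain f where bij: "bij_betw f X X"
    and le: "\<And>x y. x \<in> X \<Longrightarrow> y \<in> X \<Longrightarrow> bruhat_le n x y \<longleftrightarrow> bruhat_le n (f y) (f x)"
    using sd unfolding self_dual_def X_def by blast
  have inj: "inj_on f X" and im: "f ` X = X" using bij by (auto simp: bij_betw_def)
  have fX: "f x \<in> X" if "x \<in> X" for x using im that by blast
  have pre: "\<exists>y\<in>X. f y = x" if "x \<in> X" for x using im that by (metis imageE)
  have down: "x \<in> X" if "bruhat_le n x y" "y \<in> X" for x y
    using that bruhat_le_trans by (auto simp: X_def lower_interval_def)
  have less: "bruhat_less n x y \<longleftrightarrow> bruhat_less n (f y) (f x)" if "x \<in> X" "y \<in> X" for x y
    using le[OF that] inj_onD[OF inj _ that] by (auto simp: bruhat_less_iff)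
  have cov: "bruhat_covered_by n x y \<longleftrightarrow> bruhat_covered_by n (f y) (f x)" if xy: "x \<in> X" "y \<in> X" for x y
  proof -
    \<comment> \<open>Coverings are taken in the whole group, but the interval is closed downwards,
      so elements between two of its members belong to it.\<close>
    have "(\<exists>z. bruhat_less n x z \<and> bruhat_less n z y) \<longleftrightarrow>
        (\<exists>z\<in>X. bruhat_less n x z \<and> bruhat_less n z y)" if "y \<in> X" for x y
      using down that by (auto simp: bruhat_less_iff)
    note * = this
    have "(\<exists>z\<in>X. bruhat_less n x z \<and> bruhat_less n z y) \<longleftrightarrow>
        (\<exists>z\<in>X. bruhat_less n (f y) (f z) \<and> bruhat_less n (f z) (f x))"
      using less xy by blast
    also have "\<dots> \<longleftrightarrow> (\<exists>z\<in>X. bruhat_less n (f y) z \<and> bruhat_less n z (f x))"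
      using pre fX by metis
    finally show ?thesis
      unfolding bruhat_covered_by_def *[OF xy(2)] *[OF fX[OF xy(1)]] using less[OF xy] by simp
  qed
  have idX: "id \<in> X" using id_bruhat_le[OF w] by (simp add: X_def lower_interval_def)
  have wX: "w \<in> X" using w by (simp add: X_def lower_interval_def bruhat_le_def)
  have bot: "bruhat_le n id x" if "x \<in> X" for x
    using that by (intro id_bruhat_le) (simp add: X_def lower_interval_def bruhat_le_def)
  have fid: "f id = w"
  proof -
    obtain y where y: "y \<in> X" "f y = w" using pre[OF wX] by blast
    have "bruhat_le n w (f id)" using le[OF idX y(1)] bot[OF y(1)] y(2) by simp
    moreover have "bruhat_le n (f id) w" using fX[OF idX] by (simp add: X_def lower_interval_def)
    ultimately show ?thesis by (rule bruhat_le_antisym[symmetric])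
  qed
  have atoms: "u \<in> rank_set n w 1 \<longleftrightarrow> u \<in> X \<and> bruhat_covered_by n id u" for u
    using rank_set_1_iff[OF w] by (simp add: X_def)
  have coatoms: "u \<in> rank_set n w (perm_length n w - 1) \<longleftrightarrow> u \<in> X \<and> bruhat_covered_by n u w" for u
    using rank_set_corank_1_iff[OF pos] by (simp add: X_def)
  have ranks: "f ` rank_set n w 1 = rank_set n w (perm_length n w - 1)"
  proof (intro equalityI subsetI)
    fix v assume "v \<in> f ` rank_set n w 1"
    then obtain u where "u \<in> X" "bruhat_covered_by n id u" "v = f u" using atoms by blast
    then show "v \<in> rank_set n w (perm_length n w - 1)"
      unfolding coatoms using cov[OF idX] fid fX by simp
  next
    fix v assume "v \<in> rank_set n w (perm_length n w - 1)"
    then have v: "v \<in> X" "bruhat_covered_by n v w" unfolding coatoms by auto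
    obtain u where u: "u \<in> X" "f u = v" using pre[OF v(1)] by blast
    then have "bruhat_covered_by n id u" using cov[OF idX u(1)] fid v(2) by simp
    then show "v \<in> f ` rank_set n w 1" using u atoms by blast
  qed
  have deg: "udeg n w u = ddeg n w (f u)" if u: "u \<in> X" for u
  proof -
    have "f ` {v \<in> X. bruhat_covered_by n u v} = {v \<in> X. bruhat_covered_by n v (f u)}"
    proof (intro equalityI subsetI)
      fix v assume "v \<in> f ` {v \<in> X. bruhat_covered_by n u v}"
      then show "v \<in> {v \<in> X. bruhat_covered_by n v (f u)}" using cov u fX by auto
    next
      fix v assume "v \<in> {v \<in> X. bruhat_covered_by n v (f u)}"
      then have v: "v \<in> X" "bruhat_covered_by n v (f u)" by auto
      then obtain y where "y \<in> X" "f y = v" using pre by blast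
      then show "v \<in> f ` {v \<in> X. bruhat_covered_by n u v}" using cov[OF u] v(2) by blast
    qed
    moreover have "card (f ` {v \<in> X. bruhat_covered_by n u v}) = card {v \<in> X. bruhat_covered_by n u v}"
      by (rule card_image, rule inj_on_subset[OF inj]) auto
    ultimately show ?thesis unfolding udeg_def ddeg_def X_def[symmetric] by simp
  qed
  have "udeg n w ` rank_set n w 1 = ddeg n w ` f ` rank_set n w 1"
    unfolding image_image
  proof (rule image_cong[OF refl])
    fix u assume "u \<in> rank_set n w 1"
    then have "u \<in> X" using atoms[of u] by blast
    then show "udeg n w u = ddeg n w (f u)" by (rule deg)
  qed
  then show ?thesis unfolding max_over_def ranks[symmetric] by simp
qed

section \<open>Assembling the equality case\<close>

lemma avoids_3412:
  assumes "avoids n w [3, 4, 1, 2]"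
  shows "no_3412 w {1..n}"
  unfolding no_3412_def
proof (intro ballI impI notI, elim conjE)
  fix i j k l
  assume *: "i \<in> {1..n}" "j \<in> {1..n}" "k \<in> {1..n}" "l \<in> {1..n}" "i < j" "j < k" "k < l"
    "w k < w l" "w l < w i" "w i < w j"
  have "length [i, j, k, l] = length [3, 4, 1, 2 :: nat] \<and> sorted_wrt (<) [i, j, k, l] \<and>
     set [i, j, k, l] \<subseteq> {1..n} \<and> (\<forall>a<length [3, 4, 1, 2 :: nat]. \<forall>b<length [3, 4, 1, 2 :: nat].
       w ([i, j, k, l] ! a) < w ([i, j, k, l] ! b) \<longleftrightarrow> [3, 4, 1, 2 :: nat] ! a < [3, 4, 1, 2] ! b)"
    using * by (auto simp: less_Suc_eq numeral_eq_Suc)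
  then show False using assms unfolding avoids_def by blast
qed

lemma avoids_4231:
  assumes "avoids n w [4, 2, 3, 1]"
  shows "no_4231 w {1..n}"
  unfolding no_4231_def
proof (intro ballI impI notI, elim conjE)
  fix i j k l
  assume *: "i \<in> {1..n}" "j \<in> {1..n}" "k \<in> {1..n}" "l \<in> {1..n}" "i < j" "j < k" "k < l"
    "w l < w j" "w j < w k" "w k < w i"
  have "length [i, j, k, l] = length [4, 2, 3, 1 :: nat] \<and> sorted_wrt (<) [i, j, k, l] \<and>
     set [i, j, k, l] \<subseteq> {1..n} \<and> (\<forall>a<length [4, 2, 3, 1 :: nat]. \<forall>b<length [4, 2, 3, 1 :: nat].
       w ([i, j, k, l] ! a) < w ([i, j, k, l] ! b) \<longleftrightarrow> [4, 2, 3, 1 :: nat] ! a < [4, 2, 3, 1] ! b)"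
    using * by (auto simp: less_Suc_eq numeral_eq_Suc)
  then show False using assms unfolding avoids_def by blast
qed

lemma not_heavy_tame:
  assumes "no_3412 w {1..n}" "no_4231 w {1..n}" "\<not> heavy_perm n w 3"
  shows "tame w {1..n}"
  unfolding tame_def
proof (intro conjI)
  show "no_54312 w {1..n}" unfolding no_54312_def using heavy_54312[of _ n _ _ _ _ w] assms(3) by metis
  show "no_54123 w {1..n}" unfolding no_54123_def using heavy_54123[of _ n _ _ _ _ w] assms(3) by metis
  show "no_34521 w {1..n}" unfolding no_34521_def using heavy_34521[of _ n _ _ _ _ w] assms(3) by metis
  show "no_45321 w {1..n}" unfolding no_45321_def using heavy_45321[of _ n _ _ _ _ w] assms(3) by metis
qed (use assms in auto)

lemma tame_self_dual:
  assumes "w permutes {1..n}" "tame w {1..n}"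
  shows "self_dual (lower_interval n w) (bruhat_le n)"
  using tame_reversible[OF assms] reversal_self_dual unfolding reversible_def by blast

text \<open>The truncated rank \<open>0 - 1 = 0\<close> makes the identity stand in for a coatom; it
  covers nothing, and there are no atoms, so both maxima are 0.\<close>

lemma max_over_id:
  "max_over (rank_set n id 1) (udeg n id) = max_over (rank_set n id (perm_length n id - 1)) (ddeg n id)"
proof -
  have "lower_interval n id = {id}"
    using bruhat_less_length[of n _ id] by (auto simp: lower_interval_def bruhat_le_def permutes_id)
  then have "rank_set n id 1 = {}" "\<And>u. ddeg n id u = card {v \<in> {id}. bruhat_covered_by n v u}"
    "rank_set n id (perm_length n id - 1) = {id}"
    by (auto simp: rank_set_def ddeg_def)
  moreover have "{v \<in> {id}. bruhat_covered_by n v id} = {}"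
    using bruhat_less_length[of n id id] by (auto simp: bruhat_covered_by_def)
  ultimately show ?thesis by (simp add: max_over_def)
qed

theorem theorem1p3:
  fixes n :: nat and w :: "nat \<Rightarrow> nat"
  assumes "smooth_perm n w"
  shows "max_over (rank_set n w 1) (udeg n w)
           \<le> max_over (rank_set n w (perm_length n w - 1)) (ddeg n w)
         \<and> (max_over (rank_set n w 1) (udeg n w)
           = max_over (rank_set n w (perm_length n w - 1)) (ddeg n w)
         \<longleftrightarrow> self_dual (lower_interval n w) (bruhat_le n))"
proof -
  have w: "w permutes {1..n}" and av: "no_3412 w {1..n}" "no_4231 w {1..n}"
    using assms avoids_3412 avoids_4231 by (auto simp: smooth_perm_def)
  show ?thesis
  proof (cases "w = id")
    case True
    have "\<not> heavy_perm n w 3" by (auto simp: heavy_perm_def in_cover_pairs_iff True)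
    then have "self_dual (lower_interval n w) (bruhat_le n)"
      using not_heavy_tame[OF av] tame_self_dual[OF w] by blast
    then show ?thesis using max_over_id[of n] True by simp
  next
    case False
    then have "0 < perm_length n w" using perm_length_0_iff[OF w] by simp
    \<comment> \<open>Equality rules out a correction of 3, which leaves the tame case and hence
      self-duality.\<close>
    then show ?thesis
      using max_udeg_le_max_ddeg[OF w av False] max_udeg_less_max_ddeg[OF w av False]
        self_dual_max_eq[OF w] not_heavy_tame[OF av] tame_self_dual[OF w]
      by (metis less_irrefl)
  qed
qed

end
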